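(* Let $f\in\mathcal F$. There exist a countable partition $\mathcal I$ of $M$ (mod 0) into open intervals and an inducing time function $\tau:M\to\mathbb N$, constant on each element of $\mathcal I$, such that the induced map $\hat f(x)=f^{\tau(x)}(x)$ is a $C^1$ diffeomorphism from each $I\in\mathcal I$ onto its image, is uniformly expanding (there is $\lambda>1$ with $|D\hat f|\ge\lambda$ on every element of $\mathcal I$), and satisfies: (1) (summable variation) $\sum_{I\in\mathcal I}\operatorname{var}_M\omega_I<\infty$, where $\omega_I(x)=\mathbb 1_I(x)/|D\hat f(x)|$; (2) (summable inducing times) $\sum_{I\in\mathcal I}\tau(I)\,|I|<\infty$.
   Context: Let $M$ be a compact interval and $f:M\to M$ piecewise $C^2$: there is a finite set $\mathcal C'\subset M$ such that $f$ is $C^2$ and strictly monotone on each connected component of $M\setminus\mathcal C'$, and the one-sided limits of $f$ at each point of $\mathcal C'$ exist. Let $\mathcal C$ be the set of one-sided points $c^+,c^-$ ($c\in\mathcal C'$); for $c\in\mathcal C$, $f(c)$ denotes the corresponding one-sided limit, $\Delta(c^+,\delta)=(c,c+\delta)$, $\Delta(c^-,\delta)=(c-\delta,c)$. Write $d(x)=d(x,\mathcal C')$. Notation: $A\approx B$ means $A/B$ is bounded above and below by positive constants. The class $\mathcal F$ consists of such maps satisfying: (N) Each $c\in\mathcal C$ has an order $\ell=\ell(c)>0$, $\ell\neq1$, such that for $x$ in some $\Delta(c,\delta_0)$: $|f(x)-f(c)|\approx d(x,c)^{\ell}$, $|Df(x)|\approx d(x,c)^{\ell-1}$, $|D^2f(x)|\approx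 d(x,c)^{\ell-2}$. (E1) There is $\kappa>0$, independent of $\delta$, such that for every $\delta>0$, every $x$ and $n\ge1$ with $d(f^j(x),\mathcal C)>\delta$ for $0\le j\le n-1$ and $d(f^n(x),\mathcal C)\le\delta$, one has $|Df^n(x)|\ge\kappa$. (E2) For every $\delta>0$ there are $c(\delta),\lambda(\delta)>0$ such that $|Df^n(x)|\ge c(\delta)e^{\lambda(\delta)n}$ for all $x$, $n\ge1$ with $d(f^j(x),\mathcal C)>\delta$ for $0\le j\le n-1$. ($\star$) For each $c\in\mathcal C$ with $\ell=\ell(c)>1$, writing $c_n=f^n(c)$, $D_n=|Df^n(f(c))|$ ($D_0=1$) and $d(c_n)=d(c_n,\mathcal C)$: $\sum_n\frac{-n\log d(c_n)}{d(c_n)\,D_{n-1}^{1/(2\ell-1)}}<\infty$. The variation of $\varphi:M\to\mathbb R$ on an interval $[a,b]$ is $\operatorname{var}_{[a,b]}\varphi=\sup\sum_{i=1}^N|\varphi(c_i)-\varphi(c_{i-1})|$ over all partitions $a=c_0<\dots<c_N=b$. *)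

theory Defs
  imports "HOL-Analysis.Analysis"
begin

text \<open>The interval is M = {a..b} with a < b; Cc is the finite set C' of
 discontinuity/critical points. A one-sided point c^+ (resp. c^-) is encoded as the
 pair (c, 1) (resp. (c, -1)); only the sides pointing into M are considered.\<close>

definition sides :: "real \<Rightarrow> real \<Rightarrow> real set \<Rightarrow> (real \<times> real) set" where
  "sides a b Cc = {(c, s). c \<in> Cc \<and> ((s = 1 \<and> c < b) \<or> (s = -1 \<and> a < c))}"

definition side_filter :: "real \<Rightarrow> real \<Rightarrow> real filter" where
  "side_filter c s = (if s = 1 then at_right c else at_left c)"

definition Delta :: "real \<Rightarrow> real \<Rightarrow> real \<Rightarrow> real set" where
  "Delta c s \<delta> = (if s = 1 then {c<..<c + \<delta>} else {c - \<delta><..<c})"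

definition side_val :: "(real \<Rightarrow> real) \<Rightarrow> real \<Rightarrow> real \<Rightarrow> real" where
  "side_val f c s = Lim (side_filter c s) f"

definition der :: "(real \<Rightarrow> real) \<Rightarrow> real set \<Rightarrow> real \<Rightarrow> real" where
  "der g S x = (THE D. (g has_real_derivative D) (at x within S))"

definition dfn :: "real \<Rightarrow> real \<Rightarrow> (real \<Rightarrow> real) \<Rightarrow> real set \<Rightarrow> nat \<Rightarrow> real \<Rightarrow> real" where
  "dfn a b f Cc n x = (\<Prod>j<n. der f ({a..b} - Cc) ((f ^^ j) x))"

definition piecewise_C2 :: "real \<Rightarrow> real \<Rightarrow> (real \<Rightarrow> real) \<Rightarrow> real set \<Rightarrow> bool" where
  "piecewise_C2 a b f Cc \<longleftrightarrow>
     a < b \<and> (\<forall>x\<in>{a..b}. f x \<in> {a..b}) \<and> finite Cc \<and> Cc \<subseteq> {a..b} \<and>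
     (\<forall>I\<in>components ({a..b} - Cc).
        ((\<forall>x\<in>I. \<forall>y\<in>I. x < y \<longrightarrow> f x < f y) \<or> (\<forall>x\<in>I. \<forall>y\<in>I. x < y \<longrightarrow> f y < f x)) \<and>
        (\<exists>f1 f2. (\<forall>x\<in>I. (f has_real_derivative f1 x) (at x within I) \<and>
                           (f1 has_real_derivative f2 x) (at x within I)) \<and>
                 continuous_on I f2)) \<and>
     (\<forall>(c, s)\<in>sides a b Cc. \<exists>L. (f \<longlongrightarrow> L) (side_filter c s))"

definition cond_N :: "real \<Rightarrow> real \<Rightarrow> (real \<Rightarrow> real) \<Rightarrow> real set \<Rightarrow> real \<Rightarrow> real \<Rightarrow> real \<Rightarrow> bool" where
  "cond_N a b f Cc c s l \<longleftrightarrow>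
     (\<exists>\<delta>0>0. \<exists>K>0. \<forall>x\<in>Delta c s \<delta>0. x \<in> {a..b} - Cc \<longrightarrow>
        (1 / K) * \<bar>x - c\<bar> powr l \<le> \<bar>f x - side_val f c s\<bar> \<and>
        \<bar>f x - side_val f c s\<bar> \<le> K * \<bar>x - c\<bar> powr l \<and>
        (1 / K) * \<bar>x - c\<bar> powr (l - 1) \<le> \<bar>der f ({a..b} - Cc) x\<bar> \<and>
        \<bar>der f ({a..b} - Cc) x\<bar> \<le> K * \<bar>x - c\<bar> powr (l - 1) \<and>
        (1 / K) * \<bar>x - c\<bar> powr (l - 2) \<le> \<bar>der (der f ({a..b} - Cc)) ({a..b} - Cc) x\<bar> \<and>
        \<bar>der (der f ({a..b} - Cc)) ({a..b} - Cc) x\<bar> \<le> K * \<bar>x - c\<bar> powr (l - 2))"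

definition cond_E1 :: "real \<Rightarrow> real \<Rightarrow> (real \<Rightarrow> real) \<Rightarrow> real set \<Rightarrow> bool" where
  "cond_E1 a b f Cc \<longleftrightarrow>
     (\<exists>\<kappa>>0. \<forall>\<delta>>0. \<forall>x\<in>{a..b}. \<forall>n\<ge>1.
        (\<forall>j<n. \<forall>c\<in>Cc. \<delta> < \<bar>(f ^^ j) x - c\<bar>) \<and> (\<exists>c\<in>Cc. \<bar>(f ^^ n) x - c\<bar> \<le> \<delta>)
        \<longrightarrow> \<kappa> \<le> \<bar>dfn a b f Cc n x\<bar>)"

definition cond_E2 :: "real \<Rightarrow> real \<Rightarrow> (real \<Rightarrow> real) \<Rightarrow> real set \<Rightarrow> bool" where
  "cond_E2 a b f Cc \<longleftrightarrow>
     (\<forall>\<delta>>0. \<exists>C>0. \<exists>lam>0. \<forall>x\<in>{a..b}. \<forall>n\<ge>1.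
        (\<forall>j<n. \<forall>c\<in>Cc. \<delta> < \<bar>(f ^^ j) x - c\<bar>)
        \<longrightarrow> C * exp (lam * real n) \<le> \<bar>dfn a b f Cc n x\<bar>)"

text \<open>Condition (star). With c_1 = f(c) (one-sided limit), c_{k+1} = f^k(c_1),
 D_k = |Df^k(c_1)|, the term of index n = k+1 is
 -n log d(c_n) / (d(c_n) D_{n-1}^{1/(2l-1)}). Finiteness of every term
 (d(c_n) > 0, D_{n-1} > 0) and convergence of the series are required.\<close>
definition cond_star :: "real \<Rightarrow> real \<Rightarrow> (real \<Rightarrow> real) \<Rightarrow> real set \<Rightarrow> real \<Rightarrow> real \<Rightarrow> real \<Rightarrow> bool" where
  "cond_star a b f Cc c s l \<longleftrightarrow>
     (let c1 = side_val f c s;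
          cn = (\<lambda>k. (f ^^ k) c1);
          Dk = (\<lambda>k. \<bar>dfn a b f Cc k c1\<bar>)
      in (\<forall>k. 0 < infdist (cn k) Cc \<and> 0 < Dk k) \<and>
         summable (\<lambda>k. - real (Suc k) * ln (infdist (cn k) Cc)
                        / (infdist (cn k) Cc * Dk k powr (1 / (2 * l - 1)))))"

definition in_class_F :: "real \<Rightarrow> real \<Rightarrow> (real \<Rightarrow> real) \<Rightarrow> real set \<Rightarrow> bool" where
  "in_class_F a b f Cc \<longleftrightarrow>
     piecewise_C2 a b f Cc \<and>
     (\<forall>(c, s)\<in>sides a b Cc. \<exists>l. 0 < l \<and> l \<noteq> 1 \<and> cond_N a b f Cc c s l \<and>
                                  (1 < l \<longrightarrow> cond_star a b f Cc c s l)) \<and>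
     cond_E1 a b f Cc \<and> cond_E2 a b f Cc"

definition variation :: "(real \<Rightarrow> real) \<Rightarrow> real \<Rightarrow> real \<Rightarrow> ereal" where
  "variation \<phi> a b =
     (SUP p \<in> {p :: real list. p \<noteq> [] \<and> hd p = a \<and> last p = b \<and> sorted_wrt (<) p}.
        ereal (\<Sum>i < length p - 1. \<bar>\<phi> (p ! Suc i) - \<phi> (p ! i)\<bar>))"

definition induced :: "(real \<Rightarrow> real) \<Rightarrow> (real \<Rightarrow> nat) \<Rightarrow> real \<Rightarrow> real" where
  "induced f \<tau> x = (f ^^ \<tau> x) x"

definition C1_diffeo_onto :: "(real \<Rightarrow> real) \<Rightarrow> real set \<Rightarrow> bool" where
  "C1_diffeo_onto F I \<longleftrightarrow>
     (\<exists>g. (\<forall>x\<in>I. (F has_real_derivative g x) (at x)) \<and> continuous_on I g) \<and>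
     inj_on F I \<and>
     (\<exists>h h'. (\<forall>x\<in>I. h (F x) = x) \<and>
             (\<forall>y\<in>F ` I. (h has_real_derivative h' y) (at y within F ` I)) \<and>
             continuous_on (F ` I) h')"

end

theory Submission
  imports Defs "HOL-Analysis.Analysis"
begin

text \<open>
  A point that starts near a critical point \<open>c\<close> shadows the critical orbit. Write \<open>v = f(c)\<close>,
  \<open>D\<^sub>k = |Df\<^sup>k(v)|\<close>, \<open>d\<^sub>k = d(f\<^sup>k(v))\<close>, \<open>\<beta> = 1/(2\<ell>-1)\<close> and \<open>T\<^sub>n = \<Sum>k<n. D\<^sub>k/d\<^sub>k\<close>. As long as
  \<open>|x-c|\<^sup>\<ell> T\<^sub>n\<close> is small, \<open>f\<^sup>n\<close> has bounded distortion between \<open>v\<close> and \<open>f(x)\<close>. Instead of stopping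
  when the shadowing breaks down, one stops at the last record time \<open>q\<^sub>i = min {n. D\<^sub>n \<ge> 2\<^sup>i}\<close> before
  that. On the corresponding interval \<open>1/|Df\<^bsup>1+q\<^esup>|\<close> is of order \<open>T(q\<^bsub>i+1\<^esub>)\<^bsup>(\<ell>-1)/\<ell>\<^esup> / 2\<^sup>i\<close>, which is at most
  of order \<open>i 2\<^bsup>-i\<beta>\<^esup>\<close>, and the interval has length at most of order \<open>T(q\<^sub>i)\<^bsup>-1/\<ell>\<^esup>\<close>.

  The series in condition \<open>(\<star>)\<close> can have terms of both signs when some \<open>d\<^sub>k\<close> exceeds \<open>1\<close>, so its
  convergence need not be absolute. Only the boundedness of its terms with \<open>d\<^sub>k \<le> 1/e\<close> is used; the
  orbit segments with \<open>d\<^sub>k > 1/e\<close> are controlled by (E2).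

  Near singular points (\<open>\<ell> < 1\<close>) one step already expands. Away from \<open>\<C>'\<close>, (E2) yields expansion after
  \<open>N\<close> free steps, and a point that gets close to \<open>\<C>'\<close> earlier has lost at most the factor \<open>\<kappa>\<close> of (E1),
  which does not depend on how close; the subsequent binding period makes up for it.
\<close>

section \<open>Growth of the derivative along a critical orbit\<close>

text \<open>The exponent \<beta> = 1/(2l-1) balances two effects. A near time k contributes D_k/d_k
  <= B D_k^(1+\<beta>)/(k+1) to T, and before the record time q_(i+1) all D_k are below 2^(i+1). A
  harmonic sum therefore gives T(q_(i+1)) = O(i 2^(i(1+\<beta>))), the factor i being the order of
  log q_(i+1). The first step, from distance r to c, costs a factor r^(1-l) in 1/|Df|, with r about
  T^(-1/l) at worst. The resulting T^((l-1)/l) has exponential part 2^(i(1-\<beta>)), because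
  (1+\<beta>)(l-1)/l = 1-\<beta>, and the gain 2^i beats it. Record times are used because both
  quantities are known there: D is at least 2^i, and every earlier value is smaller, whereas at the
  time when shadowing fails D may have dropped again.

  The variation is estimated by integrating |(1/Df^n)'|, which near c is at most a multiple of
  r^(-l) for every order l. For l < 1 this is integrable up to c; for l > 1 one must stay away from
  c, and cutting into shells achieves this.\<close>

text \<open>
  Here \<open>near\<close> is all that is kept of condition \<open>(\<star>)\<close>, \<open>far\<close> is (E2), and \<open>low\<close>, \<open>upp\<close> hold
  because \<open>|Df|\<close> is comparable to a power of the distance near each point of \<open>\<C>'\<close>.
\<close>
locale orbit_growth =
  fixes D d :: "nat \<Rightarrow> real" and \<delta> B \<beta> C lam c E K W :: real
  assumes D0: "D 0 = 1" and Dpos: "\<And>k. 0 < D k" and dpos: "\<And>k. 0 < d k"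
    and dW: "\<And>k. d k \<le> W"
    and near: "\<And>k. d k \<le> \<delta> \<Longrightarrow> real (Suc k) \<le> B * d k * D k powr \<beta>"
    and far: "\<And>m n. (\<And>j. m \<le> j \<Longrightarrow> j < m + n \<Longrightarrow> \<delta> < d j) \<Longrightarrow> C * exp (lam * real n) * D m \<le> D (m + n)"
    and low: "\<And>k. c * d k powr E * D k \<le> D (Suc k)"
    and upp: "\<And>k. D (Suc k) \<le> K * (D k / d k)"
    and pos: "0 < \<delta>" "0 < B" "0 < \<beta>" "0 < C" "0 < lam" "0 < c" "0 \<le> E" "0 < K"
begin

definition T :: "nat \<Rightarrow> real" where "T n = (\<Sum>k<n. D k / d k)"

lemma T_mono: "m \<le> n \<Longrightarrow> T m \<le> T n"
  unfolding T_def by (rule sum_mono2) (auto simp: less_imp_le Dpos dpos)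

lemma D_le_T: "k < n \<Longrightarrow> D k / d k \<le> T n"
  unfolding T_def by (rule member_le_sum) (auto simp: less_imp_le Dpos dpos)

lemma W_pos: "0 < W"
  using dpos[of 0] dW[of 0] by simp

text \<open>
  (E2) makes \<open>D\<close> grow exponentially along a run of far times, so each run is controlled by the near
  time that ends it. No factor \<open>n\<close> is lost, which is essential in \<open>T_upper\<close>.
\<close>
lemma far_sum:
  assumes "1 \<le> n"
  shows "(\<Sum>k | k < n \<and> \<delta> < d k. D k) \<le> (1 / (C * (1 - exp (- lam)))) * ((\<Sum>k | k < n \<and> d k \<le> \<delta>. D k) + D (n - 1))"
proof -
  \<comment> \<open>The time \<open>n - 1\<close> is included so that the last run, which need not
    be ended by a near time below \<open>n\<close>, also has an endpoint to be charged to.\<close>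
  define A where "A = {k. k < n \<and> (d k \<le> \<delta> \<or> k = n - 1)}"
  have fA: "finite A" by (auto simp: A_def)
  define e where "e = exp (- lam)"
  have e: "0 < e" "e < 1" using pos by (auto simp: e_def)
  \<comment> \<open>Each \<open>k\<close> is charged to the first \<open>m\<close> in
    \<open>A\<close> at or after it. All times from \<open>k\<close> to \<open>m - 1\<close> are
    far, so (E2) yields the geometric weight; a near \<open>k\<close> is charged to itself.\<close>
  have step: "D k \<le> (\<Sum>m\<in>A. (if k \<le> m then e ^ (m - k) else 0) / C * D m)" if "k < n" for k
  proof -
    define m where "m = (LEAST m. k \<le> m \<and> m \<in> A)"
    have "k \<le> n - 1 \<and> n - 1 \<in> A" using that by (auto simp: A_def)
    then have m: "k \<le> m" "m \<in> A" unfolding m_def by (rule LeastI2; blast)+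
    have "\<delta> < d j" if "k \<le> j" "j < m" for j
    proof -
      have "j \<notin> A" using not_less_Least[of j "\<lambda>m. k \<le> m \<and> m \<in> A"] that by (auto simp: m_def)
      then show ?thesis using m that by (auto simp: A_def)
    qed
    then have "C * exp (lam * real (m - k)) * D k \<le> D (k + (m - k))"
      by (intro far) (use m in auto)
    then have "C * exp (lam * real (m - k)) * D k \<le> D m" using m by simp
    then have "(C * exp (lam * real (m - k)) * D k) * (e ^ (m - k) / C) \<le> D m * (e ^ (m - k) / C)"
      by (rule mult_right_mono) (use pos e in auto)
    moreover have "exp (lam * real (m - k)) * e ^ (m - k) = 1"
      by (simp add: e_def flip: exp_of_nat_mult exp_add)
    ultimately have "D k \<le> e ^ (m - k) / C * D m" using pos by (simp add: field_simps)
    also have "\<dots> = (if k \<le> m then e ^ (m - k) else 0) / C * D m" using m by simp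
    also have "\<dots> \<le> (\<Sum>m\<in>A. (if k \<le> m then e ^ (m - k) else 0) / C * D m)"
      by (rule member_le_sum[where f = "\<lambda>m. (if k \<le> m then e ^ (m - k) else 0) / C * D m"])
        (use m fA pos e Dpos in \<open>auto intro!: mult_nonneg_nonneg divide_nonneg_nonneg simp: less_imp_le\<close>)
    finally show ?thesis .
  qed
  have geo: "(\<Sum>k<n. (if k \<le> m then e ^ (m - k) else 0)) \<le> 1 / (1 - e)" if "m \<in> A" for m
  proof -
    have mn: "m < n" using that by (auto simp: A_def)
    have "(\<Sum>k<n. (if k \<le> m then e ^ (m - k) else 0)) = (\<Sum>k\<le>m. e ^ (m - k))"
      by (rule sum.mono_neutral_cong_right) (use mn in auto)
    also have "\<dots> = (\<Sum>k\<le>m. e ^ k)" by (rule sum.nat_diff_reindex[of "\<lambda>k. e ^ k" "Suc m", unfolded lessThan_Suc_atMost, simplified])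
    also have "\<dots> = (1 - e ^ Suc m) / (1 - e)" using e sum_gp0[of e m] by simp
    also have "\<dots> \<le> 1 / (1 - e)" using e by (intro divide_right_mono) auto
    finally show ?thesis .
  qed
  have "(\<Sum>k | k < n \<and> \<delta> < d k. D k) \<le> (\<Sum>k<n. D k)"
    by (rule sum_mono2) (auto simp: less_imp_le Dpos)
  also have "\<dots> \<le> (\<Sum>k<n. \<Sum>m\<in>A. (if k \<le> m then e ^ (m - k) else 0) / C * D m)"
    by (rule sum_mono) (use step in auto)
  also have "\<dots> = (\<Sum>m\<in>A. \<Sum>k<n. (if k \<le> m then e ^ (m - k) else 0) / C * D m)"
    by (rule sum.swap)
  also have "\<dots> = (\<Sum>m\<in>A. (\<Sum>k<n. (if k \<le> m then e ^ (m - k) else 0)) * (D m / C))"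
    unfolding sum_distrib_right by simp
  also have "\<dots> \<le> (\<Sum>m\<in>A. 1 / (1 - e) * (D m / C))"
    by (intro sum_mono mult_right_mono geo) (use pos Dpos in \<open>auto simp: less_imp_le\<close>)
  also have "\<dots> = 1 / (C * (1 - e)) * (\<Sum>m\<in>A. D m)"
    by (simp add: sum_divide_distrib mult.commute)
  also have "\<dots> \<le> 1 / (C * (1 - e)) * ((\<Sum>k | k < n \<and> d k \<le> \<delta>. D k) + D (n - 1))"
  proof (rule mult_left_mono)
    have "(\<Sum>m\<in>A. D m) \<le> (\<Sum>m\<in>{k. k < n \<and> d k \<le> \<delta>} \<union> {n-1}. D m)"
      by (rule sum_mono2) (auto simp: A_def less_imp_le Dpos)
    also have "\<dots> \<le> (\<Sum>k | k < n \<and> d k \<le> \<delta>. D k) + (\<Sum>k\<in>{n-1}. D k)"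
      using sum.union_inter[of "{k. k < n \<and> d k \<le> \<delta>}" "{n-1}" D]
        sum_nonneg[of "{k. k < n \<and> d k \<le> \<delta>} \<inter> {n-1}" D] by (simp add: less_imp_le Dpos)
    finally show "(\<Sum>m\<in>A. D m) \<le> (\<Sum>k | k < n \<and> d k \<le> \<delta>. D k) + D (n - 1)" by simp
  qed (use pos e in auto)
  finally show ?thesis by (simp add: e_def)
qed

text \<open>Up to the last near time, \<open>near\<close> bounds the index by a multiple of
  R^\<beta>. Only a far run can follow. Since d_k >= 1/(B R^\<beta>) at that near time,
  \<open>low\<close> lets the derivative drop at most to a negative power of R before the run, and
  exponential growth then limits the run to O(1 + log R) steps, hence to O(R^\<beta>).\<close>

lemma time_bound:
  "\<exists>M>0. \<forall>n\<ge>1. \<forall>R\<ge>1. (\<forall>k<n. D k \<le> R) \<longrightarrow> real n \<le> M * R powr \<beta>"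
proof -
  \<comment> \<open>At a near time \<open>near\<close> implies 1 <= B \<delta> D_k^\<beta>, so
    \<open>m0\<close> is a lower bound for D at all near times.\<close>
  define m0 where "m0 = (1 / (B * \<delta>)) powr (1 / \<beta>)"
  have m0: "0 < m0" using pos by (simp add: m0_def)
  \<comment> \<open>The first entry serves the run after a last near time, the second the case
    without near times, where the run starts from \<open>D 0 = 1\<close>.\<close>
  define a where "a = min (C * c * (1 / B) powr E * m0) C"
  have a: "0 < a" "a \<le> C * c * (1 / B) powr E * m0" "a \<le> C" using pos m0 by (auto simp: a_def)
  define C3 where "C3 = (\<bar>ln (1 / a)\<bar> + (1 + \<beta> * E) / \<beta>) / lam"
  have C3: "0 \<le> C3" using pos by (auto simp: C3_def)
  have key: "real n \<le> (B * \<delta> + 2 + C3) * R powr \<beta>"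
    if n: "1 \<le> n" and R: "1 \<le> R" and DR: "\<And>k. k < n \<Longrightarrow> D k \<le> R" for n R
  proof -
    have R1: "1 \<le> R powr \<beta>" using R pos by (simp add: ge_one_powr_ge_zero)
    have fin: "real p \<le> C3 * R powr \<beta>" if "a * exp (lam * real p) \<le> R powr (1 + \<beta> * E)" for p
    proof -
      have "ln (a * exp (lam * real p)) \<le> ln (R powr (1 + \<beta> * E))"
        using that a R by (subst ln_le_cancel_iff) auto
      then have 1: "ln a + lam * real p \<le> (1 + \<beta> * E) * ln R" using a R
        by (simp add: ln_mult ln_powr)
      have "\<beta> * ln R = ln (R powr \<beta>)" using R by (simp add: ln_powr)
      also have "\<dots> \<le> R powr \<beta>" using R1 ln_le_minus_one[of "R powr \<beta>"] by linarith
      finally have "ln R \<le> R powr \<beta> / \<beta>" using pos by (simp add: field_simps)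
      then have "(1 + \<beta> * E) * ln R \<le> (1 + \<beta> * E) * (R powr \<beta> / \<beta>)"
        using pos by (intro mult_left_mono) auto
      moreover have "- ln a = ln (1 / a)" using a by (simp add: ln_div)
      moreover have "ln (1 / a) \<le> \<bar>ln (1 / a)\<bar> * R powr \<beta>"
        using mult_left_mono[OF R1, of "\<bar>ln (1 / a)\<bar>"] by simp
      ultimately have "lam * real p \<le> \<bar>ln (1 / a)\<bar> * R powr \<beta> + (1 + \<beta> * E) * (R powr \<beta> / \<beta>)"
        using 1 by linarith
      then show ?thesis using pos by (simp add: C3_def field_simps)
    qed
    have gR: "R \<le> R powr (1 + \<beta> * E)" using R pos powr_mono[of 1 "1 + \<beta> * E" R] by simp
    show ?thesis
    proof (cases "\<exists>k<n. d k \<le> \<delta>")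
      case False
      then have "C * exp (lam * real (n - 1)) * D 0 \<le> D (0 + (n - 1))"
        by (intro far) (force simp: not_le)
      also have "\<dots> \<le> R" using DR n by simp
      finally have "C * exp (lam * real (n - 1)) \<le> R powr (1 + \<beta> * E)" using gR D0 by simp
      moreover have "a * exp (lam * real (n - 1)) \<le> C * exp (lam * real (n - 1))"
        using a by (intro mult_right_mono) auto
      ultimately have "real (n - 1) \<le> C3 * R powr \<beta>" by (intro fin) linarith
      then have "real n \<le> C3 * R powr \<beta> + 1" using n by simp
      also have "\<dots> \<le> C3 * R powr \<beta> + (B * \<delta> + 2) * R powr \<beta>"
        using R1 pos mult_mono[of 1 "B * \<delta> + 2" 1 "R powr \<beta>"] by simp
      finally show ?thesis by (simp add: algebra_simps)
    next
      case True
      define k where "k = Max {k. k < n \<and> d k \<le> \<delta>}"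
      have "k \<in> {k. k < n \<and> d k \<le> \<delta>}" unfolding k_def by (rule Max_in) (use True in auto)
      then have k: "k < n" "d k \<le> \<delta>" by auto
      have far': "\<delta> < d j" if "Suc k \<le> j" "j < n" for j
      proof (rule ccontr)
        assume "\<not> \<delta> < d j"
        then have "j \<le> k" unfolding k_def using that by (intro Max_ge) auto
        then show False using that by simp
      qed
      have DkR: "D k powr \<beta> \<le> R powr \<beta>" using DR[OF k(1)] Dpos[of k] pos by (intro powr_mono2) auto
      have nk: "real (Suc k) \<le> B * d k * D k powr \<beta>" using near k by blast
      have "B * d k * D k powr \<beta> \<le> B * \<delta> * R powr \<beta>"
        using k dpos[of k] pos DkR by (intro mult_mono) auto
      then have k1: "real (Suc k) \<le> B * \<delta> * R powr \<beta>" using nk by linarith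
      show ?thesis
      proof (cases "Suc k < n")
        case False
        then have "n = Suc k" using k by simp
        moreover have "0 \<le> (2 + C3) * R powr \<beta>" using C3 by simp
        ultimately show ?thesis using k1 by (simp add: algebra_simps)
      next
        case True
        \<comment> \<open>Only values at times below \<open>n\<close> are bounded by
          \<open>R\<close>, so the run is followed from \<open>Suc k\<close> to
          \<open>n - 1\<close>; hence the extra 1 when \<open>n\<close> is recovered from
          \<open>p\<close>.\<close>
        define p where "p = n - 1 - Suc k"
        have "C * exp (lam * real p) * D (Suc k) \<le> D (Suc k + p)"
          by (rule far, rule far') (auto simp: p_def)
        also have "Suc k + p = n - 1" using True by (simp add: p_def)
        also have "D (n - 1) \<le> R" using DR n by simp
        finally have 1: "C * exp (lam * real p) * D (Suc k) \<le> R" .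
        have 2: "1 \<le> B * d k * D k powr \<beta>" using nk by simp
        have dk: "1 / (B * R powr \<beta>) \<le> d k"
        proof -
          have "B * d k * D k powr \<beta> \<le> B * d k * R powr \<beta>"
            using DkR pos dpos[of k] by (intro mult_left_mono) auto
          then have "1 \<le> B * d k * R powr \<beta>" using 2 by linarith
          moreover have "0 < B * R powr \<beta>" using pos R by simp
          ultimately show ?thesis by (simp add: pos_divide_le_eq mult_ac)
        qed
        have Dk: "m0 \<le> D k"
        proof -
          have "B * d k * D k powr \<beta> \<le> B * \<delta> * D k powr \<beta>"
            using k pos by (intro mult_right_mono mult_left_mono) auto
          then have "1 \<le> B * \<delta> * D k powr \<beta>" using 2 by linarith
          moreover have "0 < B * \<delta>" using pos by simp
          ultimately have "1 / (B * \<delta>) \<le> D k powr \<beta>" by (simp add: pos_divide_le_eq mult_ac)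
          then have "m0 \<le> (D k powr \<beta>) powr (1 / \<beta>)" unfolding m0_def
            using pos by (intro powr_mono2) auto
          then show ?thesis using pos Dpos[of k] by (simp add: powr_powr)
        qed
        have "c * (1 / (B * R powr \<beta>)) powr E * m0 \<le> c * d k powr E * D k"
          using dk Dk m0 pos R1 by (intro mult_mono powr_mono2) auto
        also have "\<dots> \<le> D (Suc k)" by (rule low)
        finally have 3: "c * (1 / (B * R powr \<beta>)) powr E * m0 \<le> D (Suc k)" .
        have 4: "(1 / (B * R powr \<beta>)) powr E = (1 / B) powr E * R powr (- (\<beta> * E))"
          using pos R by (simp add: powr_divide powr_mult powr_powr powr_minus field_simps)
        have "a * exp (lam * real p) * R powr (- (\<beta> * E))
              \<le> (C * c * (1 / B) powr E * m0) * exp (lam * real p) * R powr (- (\<beta> * E))"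
          using a by (intro mult_right_mono) auto
        also have "\<dots> = C * exp (lam * real p) * (c * (1 / (B * R powr \<beta>)) powr E * m0)"
          unfolding 4 by (simp add: algebra_simps)
        also have "\<dots> \<le> C * exp (lam * real p) * D (Suc k)"
          using 3 pos by (intro mult_left_mono) auto
        also note 1
        finally have "a * exp (lam * real p) * R powr (- (\<beta> * E)) * R powr (\<beta> * E) \<le> R * R powr (\<beta> * E)"
          by (intro mult_right_mono) auto
        moreover have "R powr (- (\<beta> * E)) * R powr (\<beta> * E) = 1" using R by (simp flip: powr_add)
        ultimately have "a * exp (lam * real p) \<le> R powr (1 + \<beta> * E)"
          using R by (simp add: powr_add mult.assoc)
        then have "real p \<le> C3 * R powr \<beta>" by (rule fin)
        moreover have "real n = real (Suc k) + real p + 1" using True by (simp add: p_def)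
        ultimately have "real n \<le> B * \<delta> * R powr \<beta> + C3 * R powr \<beta> + 1" using k1 by linarith
        also have "\<dots> \<le> B * \<delta> * R powr \<beta> + C3 * R powr \<beta> + 2 * R powr \<beta>" using R1 by simp
        finally show ?thesis by (simp add: algebra_simps)
      qed
    qed
  qed
  show ?thesis
    by (rule exI[of _ "B * \<delta> + 2 + C3"]) (use key C3 pos in \<open>auto simp: add_pos_nonneg\<close>)
qed

text \<open>The factor k+1 in \<open>near\<close> makes the near terms sum to a harmonic number. For
  far terms 1/d_k is below 1/\<delta>, and \<open>far_sum\<close> replaces them by near terms and
  one last D, so that they cost only a constant.\<close>

lemma T_upper:
  "\<exists>M>0. \<forall>n\<ge>1. \<forall>R\<ge>1. (\<forall>k<n. D k \<le> R) \<longrightarrow> T n \<le> M * R powr (1 + \<beta>) * (1 + ln (real n))"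
proof -
  define M0 where "M0 = 1 / (C * (1 - exp (- lam)))"
  have M0: "0 < M0" using pos by (simp add: M0_def)
  define M where "M = B + M0 * B + M0 / \<delta>"
  have M: "0 < M" using pos M0 by (auto simp: M_def intro!: add_pos_pos)
  have key: "T n \<le> M * R powr (1 + \<beta>) * (1 + ln (real n))"
    if n: "1 \<le> n" and R: "1 \<le> R" and DR: "\<And>k. k < n \<Longrightarrow> D k \<le> R" for n R
  proof -
    have harm: "harm n \<le> 1 + ln (real n)"
    proof -
      obtain m where m: "n = Suc m" using n by (cases n) auto
      have "harm (Suc m) - ln (Suc m) \<le> harm (Suc 0) - ln (real (Suc 0))"
        using decseqD[OF decseq_harm_diff_ln, of 0 m] by simp
      then show ?thesis by (simp add: m harm_def)
    qed
    let ?N = "\<Sum>k | k < n \<and> d k \<le> \<delta>. D k / d k"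
    have N: "?N \<le> B * R powr (1 + \<beta>) * (1 + ln (real n))"
    proof -
      have "?N \<le> (\<Sum>k | k < n \<and> d k \<le> \<delta>. B * R powr (1 + \<beta>) * inverse (real (Suc k)))"
      proof (rule sum_mono)
        fix k assume "k \<in> {k. k < n \<and> d k \<le> \<delta>}"
        then have k: "k < n" "d k \<le> \<delta>" by auto
        have "real (Suc k) \<le> B * d k * D k powr \<beta>" using near k by blast
        then have "1 / d k \<le> B * D k powr \<beta> * inverse (real (Suc k))"
          using dpos[of k] by (simp add: field_simps)
        then have "D k * (1 / d k) \<le> D k * (B * D k powr \<beta> * inverse (real (Suc k)))"
          using Dpos[of k] by (intro mult_left_mono) auto
        also have "\<dots> = B * D k powr (1 + \<beta>) * inverse (real (Suc k))"
          using Dpos[of k] by (simp add: powr_add)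
        also have "\<dots> \<le> B * R powr (1 + \<beta>) * inverse (real (Suc k))"
          using DR[OF k(1)] pos Dpos[of k] by (intro mult_right_mono mult_left_mono powr_mono2) auto
        finally show "D k / d k \<le> B * R powr (1 + \<beta>) * inverse (real (Suc k))" by simp
      qed
      also have "\<dots> \<le> (\<Sum>k<n. B * R powr (1 + \<beta>) * inverse (real (Suc k)))"
        by (rule sum_mono2) (use pos in auto)
      also have "\<dots> = B * R powr (1 + \<beta>) * harm n"
        unfolding harm_altdef sum_distrib_left[symmetric] by simp
      also have "\<dots> \<le> B * R powr (1 + \<beta>) * (1 + ln (real n))"
        using harm pos by (intro mult_left_mono) auto
      finally show ?thesis .
    qed
    have "(\<Sum>k | k < n \<and> \<delta> < d k. D k / d k) \<le> (\<Sum>k | k < n \<and> \<delta> < d k. D k / \<delta>)"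
      by (rule sum_mono, rule divide_left_mono) (use pos Dpos dpos in \<open>auto simp: less_imp_le\<close>)
    also have "\<dots> = (\<Sum>k | k < n \<and> \<delta> < d k. D k) / \<delta>" by (simp add: sum_divide_distrib)
    also have "\<dots> \<le> M0 * ((\<Sum>k | k < n \<and> d k \<le> \<delta>. D k) + D (n - 1)) / \<delta>"
      using far_sum[OF n] pos by (intro divide_right_mono) (auto simp: M0_def)
    also have "\<dots> = M0 * (\<Sum>k | k < n \<and> d k \<le> \<delta>. D k / \<delta>) + M0 / \<delta> * D (n - 1)"
      by (simp add: sum_divide_distrib distrib_left add_divide_distrib sum_distrib_left)
    \<comment> \<open>At near times d_k <= \<delta>, so D_k/\<delta> is at most the term D_k/d_k of
      T.\<close>
    also have "\<dots> \<le> M0 * ?N + M0 / \<delta> * R"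
      by (intro add_mono mult_left_mono sum_mono divide_left_mono) (use pos Dpos dpos M0 DR n in \<open>auto simp: less_imp_le\<close>)
    finally have F: "(\<Sum>k | k < n \<and> \<delta> < d k. D k / d k) \<le> M0 * ?N + M0 / \<delta> * R" .
    have "T n = ?N + (\<Sum>k | k < n \<and> \<delta> < d k. D k / d k)"
      unfolding T_def by (subst sum.union_disjoint[symmetric]) (auto intro!: sum.cong)
    also have "\<dots> \<le> ?N + M0 * ?N + M0 / \<delta> * R" using F by simp
    also have "\<dots> \<le> B * R powr (1 + \<beta>) * (1 + ln (real n)) + M0 * (B * R powr (1 + \<beta>) * (1 + ln (real n)))
        + M0 / \<delta> * (R powr (1 + \<beta>) * (1 + ln (real n)))"
    proof (intro add_mono mult_left_mono N)
      have "R * 1 \<le> R powr (1 + \<beta>) * (1 + ln (real n))"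
        using R n pos powr_mono[of 1 "1 + \<beta>" R] by (intro mult_mono) auto
      then show "R \<le> R powr (1 + \<beta>) * (1 + ln (real n))" by simp
    qed (use M0 pos in auto)
    finally show ?thesis by (simp add: M_def algebra_simps add_divide_distrib)
  qed
  show ?thesis by (rule exI[of _ M]) (use key M in auto)
qed

text \<open>These are the inputs for the partition near c. The bound on \<open>T (q (Suc i))\<close>
  controls how close to c the i-th interval comes, hence its smallest derivative; the bound on
  \<open>q i\<close> and 2^i = O(T(q i)) make time multiplied by length decay geometrically.\<close>

lemma record_times:
  "\<exists>q C. 0 < C \<and> (\<forall>i\<ge>1. 1 \<le> q i \<and> q i \<le> q (Suc i) \<and> 2 ^ i \<le> D (q i) \<and> 2 ^ i \<le> C * T (q i) \<and>
     T (q (Suc i)) \<le> C * 2 powr (real i * (1 + \<beta>)) * real (Suc i) \<and> real (q i) \<le> C * T (q i) powr \<beta>)"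
proof -
  obtain MB where MB: "MB > 0" and B: "\<And>n R. 1 \<le> n \<Longrightarrow> 1 \<le> R \<Longrightarrow> (\<And>k. k < n \<Longrightarrow> D k \<le> R) \<Longrightarrow> real n \<le> MB * R powr \<beta>"
    using time_bound by blast
  obtain MU where MU: "MU > 0" and U: "\<And>n R. 1 \<le> n \<Longrightarrow> 1 \<le> R \<Longrightarrow> (\<And>k. k < n \<Longrightarrow> D k \<le> R) \<Longrightarrow> T n \<le> MU * R powr (1 + \<beta>) * (1 + ln (real n))"
    using T_upper by blast
  define q where "q i = (LEAST n. (2::real) ^ i \<le> D n)" for i
  \<comment> \<open>If D stayed below 2^i forever, \<open>time_bound\<close> would bound every
    natural number.\<close>
  have ex: "\<exists>n. (2::real) ^ i \<le> D n" for i
  proof (rule ccontr)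
    assume "\<nexists>n. 2 ^ i \<le> D n"
    then have *: "D n \<le> 2 ^ i" for n using less_imp_le not_le by blast
    obtain n where n: "MB * (2 ^ i) powr \<beta> < real n" using reals_Archimedean2 by blast
    moreover have "0 \<le> MB * (2 ^ i) powr \<beta>" using MB by simp
    ultimately have "1 \<le> n" by (cases n) auto
    from this * have "real n \<le> MB * (2 ^ i) powr \<beta>" by (intro B) auto
    then show False using n by simp
  qed
  have q: "(2::real) ^ i \<le> D (q i)" for i unfolding q_def using ex by (rule LeastI_ex)
  have ql: "D k < 2 ^ i" if "k < q i" for i k using not_less_Least[of k] that unfolding q_def by force
  have q1: "1 \<le> q i" if "1 \<le> i" for i
  proof (rule ccontr)
    assume "\<not> 1 \<le> q i"
    then have "q i = 0" by simp
    then have "(2::real) ^ i \<le> 1" using q[of i] D0 by simp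
    moreover have "(2::real) ^ 1 \<le> 2 ^ i" using that by (intro power_increasing) auto
    ultimately show False by simp
  qed
  have qm: "q i \<le> q (Suc i)" for i
  proof -
    have "(2::real) ^ i \<le> 2 ^ Suc i" by simp
    then have "(2::real) ^ i \<le> D (q (Suc i))" using q[of "Suc i"] by linarith
    then show ?thesis unfolding q_def[of i] by (rule Least_le)
  qed
  \<comment> \<open>By \<open>upp\<close> the step into a record time multiplies D by at most K/d,
    so the last term of T before it is already at least 2^i/K.\<close>
  have T2: "2 ^ i \<le> K * T (q i)" if i: "1 \<le> i" for i
  proof -
    obtain k where k: "q i = Suc k" using q1[OF i] by (cases "q i") auto
    have "2 ^ i \<le> K * (D k / d k)" using q[of i] upp[of k] k by simp
    also have "\<dots> \<le> K * T (q i)" using pos D_le_T[of k "q i"] k by (intro mult_left_mono) auto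
    finally show ?thesis .
  qed
  define L where "L = \<bar>ln MB\<bar> + 2 * \<beta> + 1"
  have TU: "T (q (Suc i)) \<le> MU * 2 powr (1 + \<beta>) * L * 2 powr (real i * (1 + \<beta>)) * real (Suc i)" for i
  proof -
    have q1': "1 \<le> q (Suc i)" by (rule q1) simp
    have "T (q (Suc i)) \<le> MU * (2 ^ Suc i) powr (1 + \<beta>) * (1 + ln (real (q (Suc i))))"
      by (rule U) (use q1' ql less_imp_le in \<open>auto simp del: power_Suc\<close>)
    also have "((2::real) ^ Suc i) powr (1 + \<beta>) = 2 powr (1 + \<beta>) * 2 powr (real i * (1 + \<beta>))"
      by (simp add: powr_mult powr_powr flip: powr_realpow)
    also have "MU * (2 powr (1 + \<beta>) * 2 powr (real i * (1 + \<beta>))) * (1 + ln (real (q (Suc i))))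
        \<le> MU * (2 powr (1 + \<beta>) * 2 powr (real i * (1 + \<beta>))) * (L * real (Suc i))"
    proof (rule mult_left_mono)
      have "real (q (Suc i)) \<le> MB * (2 ^ Suc i) powr \<beta>"
        by (rule B) (use q1' ql less_imp_le in \<open>auto simp del: power_Suc\<close>)
      then have "ln (real (q (Suc i))) \<le> ln (MB * (2 ^ Suc i) powr \<beta>)"
        using q1' MB by (subst ln_le_cancel_iff) auto
      also have "\<dots> = ln MB + \<beta> * (real (Suc i) * ln 2)"
        using MB by (simp add: ln_mult ln_powr ln_realpow del: power_Suc)
      also have "\<dots> \<le> \<bar>ln MB\<bar> + \<beta> * (real (Suc i) * 1)"
        using pos ln_2_less_1 by (intro add_mono mult_left_mono) auto
      finally have 1: "1 + ln (real (q (Suc i))) \<le> (\<bar>ln MB\<bar> + 1) * 1 + \<beta> * real (Suc i)" by simp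
      have 2: "(\<bar>ln MB\<bar> + 1) * 1 \<le> (\<bar>ln MB\<bar> + 1) * real (Suc i)" by (intro mult_left_mono) auto
      have 3: "\<beta> * real (Suc i) \<le> 2 * \<beta> * real (Suc i)" using pos by (intro mult_right_mono) auto
      show "1 + ln (real (q (Suc i))) \<le> L * real (Suc i)"
        using 1 2 3 unfolding L_def distrib_right by linarith
    qed (use MU in auto)
    finally show ?thesis by (simp add: mult_ac)
  qed
  \<comment> \<open>Each earlier D_k is at most d_k T <= W T, so a multiple of T can serve as the
    threshold in \<open>time_bound\<close>; adding K makes that threshold at least 1.\<close>
  define M3 where "M3 = MB * (K + W) powr \<beta>"
  have qT: "real (q i) \<le> M3 * T (q i) powr \<beta>" if "1 \<le> i" for i
  proof -
    have "1 \<le> (2::real) ^ i" by simp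
    then have KT: "1 \<le> K * T (q i)" using T2[OF that] by linarith
    then have T0: "0 < T (q i)" using pos zero_less_mult_pos[of K "T (q i)"] by linarith
    have "real (q i) \<le> MB * ((K + W) * T (q i)) powr \<beta>"
    proof (rule B)
      show "1 \<le> (K + W) * T (q i)" using KT mult_pos_pos[OF W_pos T0] unfolding distrib_right by linarith
      fix k assume "k < q i"
      then have "D k \<le> d k * T (q i)" using D_le_T[of k "q i"] dpos[of k] by (simp add: field_simps)
      also have "\<dots> \<le> (K + W) * T (q i)" using dW[of k] pos T0 by (intro mult_right_mono) auto
      finally show "D k \<le> (K + W) * T (q i)" .
    qed (use q1 that in auto)
    then show ?thesis using T0 W_pos pos by (simp add: powr_mult M3_def mult_ac)
  qed
  define CC where "CC = max (max K M3) (MU * 2 powr (1 + \<beta>) * L)"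
  show ?thesis
  proof (intro exI[of _ q] exI[of _ CC] conjI allI impI)
    show "0 < CC" using pos by (auto simp: CC_def)
    fix i :: nat assume i: "1 \<le> i"
    have "1 \<le> (2::real) ^ i" by simp
    then have KT: "1 \<le> K * T (q i)" using T2[OF i] by linarith
    then have T0: "0 < T (q i)" using pos zero_less_mult_pos[of K "T (q i)"] by linarith
    show "1 \<le> q i" "q i \<le> q (Suc i)" "2 ^ i \<le> D (q i)" using q1 i qm q by auto
    have "K * T (q i) \<le> CC * T (q i)" using T0 by (intro mult_right_mono) (auto simp: CC_def)
    then show "2 ^ i \<le> CC * T (q i)" using T2[OF i] by linarith
    have "MU * 2 powr (1 + \<beta>) * L * (2 powr (real i * (1 + \<beta>)) * real (Suc i)) \<le> CC * (2 powr (real i * (1 + \<beta>)) * real (Suc i))"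
      by (intro mult_right_mono) (auto simp: CC_def)
    then show "T (q (Suc i)) \<le> CC * 2 powr (real i * (1 + \<beta>)) * real (Suc i)"
      using TU[of i] by (simp only: mult.assoc)
    have "M3 * T (q i) powr \<beta> \<le> CC * T (q i) powr \<beta>" by (intro mult_right_mono) (auto simp: CC_def)
    then show "real (q i) \<le> CC * T (q i) powr \<beta>" using qT[OF i] by linarith
  qed
qed

end

section \<open>First consequences of the class axioms\<close>

locale cusp_map =
  fixes a b :: real and f :: "real \<Rightarrow> real" and Cc :: "real set"
  assumes F: "in_class_F a b f Cc"
begin

abbreviation "S \<equiv> {a..b} - Cc"
abbreviation "f1 \<equiv> der f S"
abbreviation "f2 \<equiv> der f1 S"
abbreviation "Df \<equiv> dfn a b f Cc"
abbreviation "dC x \<equiv> infdist x Cc"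

lemma ab: "a < b" and maps: "x \<in> {a..b} \<Longrightarrow> f x \<in> {a..b}"
  and finC: "finite Cc" and subC: "Cc \<subseteq> {a..b}"
  using F by (auto simp: in_class_F_def piecewise_C2_def)

lemma finite_sides: "finite (sides a b Cc)"
  by (rule finite_subset[of _ "Cc \<times> {1, -1}"]) (use finC in \<open>auto simp: sides_def\<close>)

lemma iter_maps: "x \<in> {a..b} \<Longrightarrow> (f ^^ n) x \<in> {a..b}"
  by (induction n) (use maps in auto)

section \<open>Derivatives of f off the exceptional set\<close>

lemma S_nhd:
  assumes "x \<in> S"
  obtains e where "0 < e" "{a..b} \<inter> ball x e \<subseteq> S"
proof -
  have "open (- Cc)" using finC by (simp add: finite_imp_closed open_Compl)
  then obtain e where "0 < e" "ball x e \<subseteq> - Cc" using assms by (force simp: open_contains_ball)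
  then show thesis by (intro that[of e]) auto
qed

lemma at_S: assumes "x \<in> S" shows "at x within S = at x within {a..b}"
proof -
  obtain e where e: "0 < e" "{a..b} \<inter> ball x e \<subseteq> S" using S_nhd[OF assms] .
  show ?thesis by (rule at_within_nhd[of x "ball x e"]) (use e in auto)
qed

lemma at_S_nonbot: assumes "x \<in> S" shows "at x within S \<noteq> bot"
proof -
  have "x islimpt {a..b}" by (rule connected_imp_perfect) (use ab assms in auto)
  then show ?thesis by (simp add: at_S[OF assms] trivial_limit_within)
qed

lemma at_component:
  assumes "I \<in> components S" "x \<in> I"
  shows "at x within I = at x within S"
proof -
  have IS: "I \<subseteq> S" using assms in_components_subset by blast
  then have "x \<in> S" using assms(2) by blast
  then obtain e where e: "0 < e" "{a..b} \<inter> ball x e \<subseteq> S" by (rule S_nhd)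
  have "{a..b} \<inter> ball x e \<subseteq> I"
  proof (rule components_maximal[OF assms(1)])
    show "connected ({a..b} \<inter> ball x e)" by (intro convex_connected convex_Int) auto
    show "I \<inter> ({a..b} \<inter> ball x e) \<noteq> {}" using assms IS e by force
  qed (use e in auto)
  then show ?thesis using IS by (intro at_within_nhd[of x "ball x e"]) (use e in auto)
qed

lemma der_eq:
  assumes "x \<in> S" "(g has_real_derivative D) (at x within S)"
  shows "der g S x = D"
  unfolding der_def using assms has_field_derivative_unique at_S_nonbot by (intro the_equality) blast+

text \<open>The class supplies derivatives on each component, relative to that component. Components
  are relatively open in M, so these are also derivatives relative to \<open>S\<close>, and
  uniqueness glues them into the global functions \<open>f1\<close> and \<open>f2\<close>.\<close>

lemma piece_derivatives:
  assumes "x \<in> S"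
  shows "(f has_real_derivative f1 x) (at x within S) \<and> (f1 has_real_derivative f2 x) (at x within S) \<and>
    continuous (at x within S) f2"
proof -
  obtain I where I: "I \<in> components S" "x \<in> I" using assms by (metis UnionE Union_components)
  have IS: "I \<subseteq> S" using I in_components_subset by blast
  obtain g1 g2 where g: "\<And>x. x \<in> I \<Longrightarrow> (f has_real_derivative g1 x) (at x within I)"
    "\<And>x. x \<in> I \<Longrightarrow> (g1 has_real_derivative g2 x) (at x within I)" "continuous_on I g2"
    using F I(1) by (auto simp: in_class_F_def piecewise_C2_def) meson
  have 1: "f1 y = g1 y" if "y \<in> I" for y
    using that IS g(1) at_component[OF I(1)] by (intro der_eq) auto
  have 2: "(f1 has_real_derivative g2 y) (at y within S)" if "y \<in> I" for y
  proof -
    have "(f1 has_real_derivative g2 y) (at y within I)"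
      by (rule has_field_derivative_transform_within[OF g(2)[OF that], of 1]) (use that 1 in auto)
    then show ?thesis using at_component[OF I(1) that] by simp
  qed
  have 3: "f2 y = g2 y" if "y \<in> I" for y using that IS 2 by (intro der_eq) auto
  have "continuous (at x within I) f2"
    using g(3) 3 I(2) by (metis continuous_on_cong continuous_on_eq_continuous_within)
  then show ?thesis using g(1)[OF I(2)] 1 2 3 I at_component[OF I] by simp
qed

lemma f_deriv: "x \<in> S \<Longrightarrow> (f has_real_derivative f1 x) (at x within S)"
  and f1_deriv: "x \<in> S \<Longrightarrow> (f1 has_real_derivative f2 x) (at x within S)"
  using piece_derivatives by auto

lemma f2_cont: "continuous_on S f2"
  using piece_derivatives by (auto simp: continuous_on_eq_continuous_within)

lemma f1_cont: "continuous_on S f1"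
  unfolding continuous_on_eq_continuous_within using DERIV_continuous[OF f1_deriv] by blast

lemma Df_0 [simp]: "Df 0 x = 1" and Df_Suc: "Df (Suc n) x = Df n x * f1 ((f ^^ n) x)"
  by (auto simp: dfn_def)

lemma Df_add: "Df (m + n) x = Df m x * Df n ((f ^^ m) x)"
proof (induction n)
  case (Suc n)
  have "(f ^^ (m + n)) x = (f ^^ n) ((f ^^ m) x)" by (metis add.commute comp_apply funpow_add)
  then show ?case using Suc by (simp add: Df_Suc)
qed auto

lemma E2: "0 < \<delta> \<Longrightarrow> \<exists>C>0. \<exists>lam>0. \<forall>x\<in>{a..b}. \<forall>n. n \<ge> 1 \<longrightarrow>
        (\<forall>j<n. \<forall>c\<in>Cc. \<delta> < \<bar>(f ^^ j) x - c\<bar>) \<longrightarrow> C * exp (lam * real n) \<le> \<bar>Df n x\<bar>"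
  using F by (auto simp: in_class_F_def cond_E2_def)

text \<open>A single step of (E2), with a threshold below the distance from \<open>x\<close> to
  \<open>Cc\<close>, already excludes a vanishing derivative.\<close>

lemma f1_nz: assumes "x \<in> S" shows "f1 x \<noteq> 0"
proof -
  obtain e where e: "0 < e" "{a..b} \<inter> ball x e \<subseteq> S" using S_nhd[OF assms] .
  have "e / 2 < \<bar>x - c\<bar>" if "c \<in> Cc" for c
  proof (rule ccontr)
    assume "\<not> e / 2 < \<bar>x - c\<bar>"
    then have "c \<in> {a..b} \<inter> ball x e" using that subC e by (auto simp: dist_real_def)
    then show False using e that by auto
  qed
  then obtain C lam where "0 < C" "C * exp (lam * real 1) \<le> \<bar>Df 1 x\<bar>"
    using E2[of "e/2"] e assms by (auto dest!: bspec[of _ _ x] spec[of _ 1])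
  moreover have "0 < C * exp (lam * real 1)" using \<open>0 < C\<close> by simp
  ultimately have "Df 1 x \<noteq> 0" by linarith
  then show ?thesis by (simp add: dfn_def)
qed

lemma Df_nz: "(\<And>j. j < n \<Longrightarrow> (f ^^ j) x \<in> S) \<Longrightarrow> Df n x \<noteq> 0"
  by (auto simp: dfn_def f1_nz)

text \<open>Distances are compared point by point because \<open>infdist\<close> to an empty
  \<open>Cc\<close> is 0, whereas \<open>Z r\<close> must then be all of M.\<close>

definition Z :: "real \<Rightarrow> real set" where "Z r = {x\<in>{a..b}. \<forall>c\<in>Cc. r \<le> \<bar>x - c\<bar>}"

lemma compact_Z: "compact (Z r)"
proof -
  have "Z r = {a..b} \<inter> (\<Inter>c\<in>Cc. {x. r \<le> \<bar>x - c\<bar>})" by (auto simp: Z_def)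
  moreover have "closed {x. r \<le> \<bar>x - c\<bar>}" for c :: real
    by (intro closed_Collect_le continuous_intros)
  ultimately show ?thesis by (auto intro!: compact_Int_closed closed_INT)
qed

lemma Z_subset: "0 < r \<Longrightarrow> Z r \<subseteq> S" by (auto simp: Z_def)

lemma far_bounds:
  assumes "0 < r"
  shows "\<exists>A\<ge>1. \<forall>x\<in>Z r. \<bar>f1 x\<bar> \<le> A \<and> 1 / A \<le> \<bar>f1 x\<bar> \<and> \<bar>f2 x\<bar> \<le> A"
proof -
  have ZS: "Z r \<subseteq> S" using Z_subset[OF assms] .
  have bd: "\<exists>M. \<forall>x\<in>Z r. \<bar>g x\<bar> \<le> M" if "continuous_on S g" for g :: "real \<Rightarrow> real"
  proof -
    have "compact (g ` Z r)"
      using that ZS compact_Z continuous_on_subset by (blast intro: compact_continuous_image)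
    then have "bounded (g ` Z r)" by (rule compact_imp_bounded)
    then show ?thesis by (auto simp: bounded_iff)
  qed
  obtain M1 where M1: "\<And>x. x \<in> Z r \<Longrightarrow> \<bar>f1 x\<bar> \<le> M1" using bd[OF f1_cont] by blast
  obtain M2 where M2: "\<And>x. x \<in> Z r \<Longrightarrow> \<bar>f2 x\<bar> \<le> M2" using bd[OF f2_cont] by blast
  have "continuous_on S (\<lambda>x. inverse (f1 x))" using f1_cont f1_nz by (auto intro: continuous_on_inverse)
  then obtain M3 where M3: "\<And>x. x \<in> Z r \<Longrightarrow> \<bar>inverse (f1 x)\<bar> \<le> M3" using bd by blast
  define A where "A = max 1 (max M1 (max M2 M3))"
  have A: "1 \<le> A" "M1 \<le> A" "M2 \<le> A" "M3 \<le> A" by (auto simp: A_def)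
  have "1 / A \<le> \<bar>f1 x\<bar>" if "x \<in> Z r" for x
  proof -
    have "\<bar>inverse (f1 x)\<bar> \<le> A" using M3[OF that] A by simp
    moreover have "f1 x \<noteq> 0" using that ZS f1_nz by auto
    ultimately have "1 \<le> A * \<bar>f1 x\<bar>" by (simp add: field_simps abs_mult)
    then show ?thesis using A by (simp add: field_simps)
  qed
  then show ?thesis using M1 M2 A by (intro exI[of _ A]) force
qed

lemma Delta_nhd:
  assumes "(c, s) \<in> sides a b Cc"
  shows "\<exists>\<rho>>0. \<forall>x\<in>Delta c s \<rho>. a < x \<and> x < b \<and> x \<notin> Cc \<and> dC x = \<bar>x - c\<bar>"
proof -
  obtain g where g: "0 < g" "\<And>c'. c' \<in> Cc \<Longrightarrow> c' \<noteq> c \<Longrightarrow> g \<le> dist c c'"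
    using finite_set_avoid[OF finC, of c] by blast
  have c: "c \<in> Cc" "c \<in> {a..b}" "s = 1 \<and> c < b \<or> s = -1 \<and> a < c" using assms subC by (auto simp: sides_def)
  \<comment> \<open>Half the gap to the other points of \<open>Cc\<close> makes \<open>c\<close> the
    nearest one; the second entry keeps the neighbourhood inside the open interval.\<close>
  define \<rho> where "\<rho> = min (g / 2) (if s = 1 then b - c else c - a)"
  have \<rho>: "0 < \<rho>" "\<rho> \<le> g / 2" using c g by (auto simp: \<rho>_def)
  have "a < x \<and> x < b \<and> x \<notin> Cc \<and> dC x = \<bar>x - c\<bar>" if x: "x \<in> Delta c s \<rho>" for x
  proof -
    have 1: "a < x" "x < b" "x \<noteq> c" "\<bar>x - c\<bar> < \<rho>"
      using c x by (auto simp: Delta_def \<rho>_def split: if_splits)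
    have 2: "\<bar>x - c\<bar> \<le> \<bar>x - c'\<bar>" if "c' \<in> Cc" for c'
      using g(2)[OF that] 1 \<rho> by (cases "c' = c") (auto simp: dist_real_def)
    have "dC x = \<bar>x - c\<bar>"
    proof (rule antisym)
      show "dC x \<le> \<bar>x - c\<bar>" using infdist_le[OF c(1), of x] by (simp add: dist_real_def)
      have "Cc \<noteq> {}" using c by auto
      then show "\<bar>x - c\<bar> \<le> dC x"
        unfolding infdist_def using 2 by (auto intro!: cINF_greatest simp: dist_real_def)
    qed
    moreover have "x \<notin> Cc" using 2[of x] 1 by auto
    ultimately show ?thesis using 1 by simp
  qed
  then show ?thesis using \<rho> by blast
qed

text \<open>K always multiplies the upper bound, so that enlarging it preserves each inequality and
  one K can serve all sides.\<close>

definition N_bounds :: "real \<Rightarrow> real \<Rightarrow> real \<Rightarrow> real \<Rightarrow> real \<Rightarrow> bool" where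
  "N_bounds l K c s x \<longleftrightarrow>
     \<bar>f x - side_val f c s\<bar> \<le> K * \<bar>x - c\<bar> powr l \<and>
     \<bar>x - c\<bar> powr (l - 1) \<le> K * \<bar>f1 x\<bar> \<and> \<bar>f1 x\<bar> \<le> K * \<bar>x - c\<bar> powr (l - 1) \<and>
     \<bar>f2 x\<bar> \<le> K * \<bar>x - c\<bar> powr (l - 2)"

lemma side_constants:
  "\<exists>ord K \<rho>. 0 < \<rho> \<and> \<rho> \<le> 1 \<and> 1 \<le> K \<and> (\<forall>(c, s)\<in>sides a b Cc. 
     0 < ord c s \<and> ord c s \<noteq> 1 \<and> (1 < ord c s \<longrightarrow> cond_star a b f Cc c s (ord c s)) \<and>
     (\<forall>x\<in>Delta c s \<rho>. a < x \<and> x < b \<and> x \<notin> Cc \<and> dC x = \<bar>x - c\<bar> \<and> N_bounds (ord c s) K c s x))"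
proof -
  note fin = finite_sides
  let ?Q = "\<lambda>c s l K \<rho>. 0 < l \<and> l \<noteq> 1 \<and> (1 < l \<longrightarrow> cond_star a b f Cc c s l) \<and> 0 < K \<and> 0 < \<rho> \<and>
     (\<forall>x\<in>Delta c s \<rho>. a < x \<and> x < b \<and> x \<notin> Cc \<and> dC x = \<bar>x - c\<bar> \<and> N_bounds l K c s x)"
  have "\<exists>l K \<rho>. ?Q c s l K \<rho>" if cs: "(c, s) \<in> sides a b Cc" for c s
  proof -
    obtain l where l: "0 < l" "l \<noteq> 1" "cond_N a b f Cc c s l" "1 < l \<longrightarrow> cond_star a b f Cc c s l"
      using F cs unfolding in_class_F_def by blast
    obtain \<delta>0 K where K: "0 < \<delta>0" "0 < K" "\<And>x. x \<in> Delta c s \<delta>0 \<Longrightarrow> x \<in> S \<Longrightarrow>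
        (1 / K) * \<bar>x - c\<bar> powr l \<le> \<bar>f x - side_val f c s\<bar> \<and>
        \<bar>f x - side_val f c s\<bar> \<le> K * \<bar>x - c\<bar> powr l \<and>
        (1 / K) * \<bar>x - c\<bar> powr (l - 1) \<le> \<bar>f1 x\<bar> \<and> \<bar>f1 x\<bar> \<le> K * \<bar>x - c\<bar> powr (l - 1) \<and>
        (1 / K) * \<bar>x - c\<bar> powr (l - 2) \<le> \<bar>f2 x\<bar> \<and> \<bar>f2 x\<bar> \<le> K * \<bar>x - c\<bar> powr (l - 2)"
      using l(3) unfolding cond_N_def by blast
    obtain \<rho> where \<rho>: "0 < \<rho>" "\<forall>x\<in>Delta c s \<rho>. a < x \<and> x < b \<and> x \<notin> Cc \<and> dC x = \<bar>x - c\<bar>"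
      using Delta_nhd[OF cs] by blast
    have "?Q c s l K (min \<rho> \<delta>0)"
    proof (intro conjI ballI)
      fix x assume "x \<in> Delta c s (min \<rho> \<delta>0)"
      then have x: "x \<in> Delta c s \<rho>" "x \<in> Delta c s \<delta>0" by (auto simp: Delta_def split: if_splits)
      then show *: "a < x" "x < b" "x \<notin> Cc" "dC x = \<bar>x - c\<bar>" using \<rho> by auto
      show "N_bounds l K c s x" using K(3)[OF x(2)] K(2) * by (auto simp: N_bounds_def field_simps)
    qed (use l K \<rho> in auto)
    then show ?thesis by blast
  qed
  then have "\<forall>\<sigma>\<in>sides a b Cc. \<exists>t. ?Q (fst \<sigma>) (snd \<sigma>) (fst t) (fst (snd t)) (snd (snd t))" by auto
  from bchoice[OF this] obtain t where t: "\<And>\<sigma>. \<sigma> \<in> sides a b Cc \<Longrightarrow> ?Q (fst \<sigma>) (snd \<sigma>) (fst (t \<sigma>)) (fst (snd (t \<sigma>))) (snd (snd (t \<sigma>)))"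
    by blast
  define K where "K = Max (insert 1 ((\<lambda>\<sigma>. fst (snd (t \<sigma>))) ` sides a b Cc))"
  define \<rho> where "\<rho> = Min (insert 1 ((\<lambda>\<sigma>. snd (snd (t \<sigma>))) ` sides a b Cc))"
  have K: "1 \<le> K" "\<And>\<sigma>. \<sigma> \<in> sides a b Cc \<Longrightarrow> fst (snd (t \<sigma>)) \<le> K" using fin by (auto simp: K_def)
  have \<rho>: "0 < \<rho>" "\<rho> \<le> 1" "\<And>\<sigma>. \<sigma> \<in> sides a b Cc \<Longrightarrow> \<rho> \<le> snd (snd (t \<sigma>))"
    using fin t by (auto simp: \<rho>_def)
  have "0 < fst (t (c, s)) \<and> fst (t (c, s)) \<noteq> 1 \<and> (1 < fst (t (c, s)) \<longrightarrow> cond_star a b f Cc c s (fst (t (c, s)))) \<and>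
     (\<forall>x\<in>Delta c s \<rho>. a < x \<and> x < b \<and> x \<notin> Cc \<and> dC x = \<bar>x - c\<bar> \<and> N_bounds (fst (t (c, s))) K c s x)"
    if cs: "(c, s) \<in> sides a b Cc" for c s
  proof -
    define l K' \<rho>' where "l = fst (t (c, s))" and "K' = fst (snd (t (c, s)))" and "\<rho>' = snd (snd (t (c, s)))"
    have Q: "?Q c s l K' \<rho>'" using t[OF cs] by (simp add: l_def K'_def \<rho>'_def)
    have KK: "K' \<le> K" "\<rho> \<le> \<rho>'" using K \<rho> cs by (auto simp: K'_def \<rho>'_def)
    have "N_bounds l K c s x" if "N_bounds l K' c s x" for x
    proof -
      have "K' * y \<le> K * y" if "0 \<le> y" for y using KK(1) that by (rule mult_right_mono)
      then show ?thesis using that unfolding N_bounds_def by (meson abs_ge_zero order_trans powr_ge_zero)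
    qed
    moreover have "Delta c s \<rho> \<subseteq> Delta c s \<rho>'" using KK by (auto simp: Delta_def)
    ultimately show ?thesis using Q unfolding l_def[symmetric] by blast
  qed
  then show ?thesis using K(1) \<rho> by (intro exI[of _ "\<lambda>c s. fst (t (c, s))"] exI[of _ K] exI[of _ \<rho>]) auto
qed

lemma dC_le: "x \<in> {a..b} \<Longrightarrow> dC x \<le> b - a"
proof (cases "Cc = {}")
  case False
  assume x: "x \<in> {a..b}"
  obtain c where "c \<in> Cc" using False by blast
  then show ?thesis using infdist_le[of c Cc x] x subC by (force simp: dist_real_def)
qed (use ab in \<open>auto simp: infdist_def\<close>)

lemma near_or_far:
  assumes "x \<in> S" "0 < \<rho>" "x \<notin> Z \<rho>"
  shows "\<exists>(c, s)\<in>sides a b Cc. x \<in> Delta c s \<rho>"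
proof -
  obtain c where c: "c \<in> Cc" "\<bar>x - c\<bar> < \<rho>" using assms by (auto simp: Z_def not_le)
  have "x \<noteq> c" using c assms by auto
  then consider "c < x" | "x < c" by linarith
  then show ?thesis
  proof cases
    case 1
    then show ?thesis using c assms by (intro bexI[of _ "(c, 1)"]) (auto simp: Delta_def sides_def)
  next
    case 2
    then show ?thesis using c assms by (intro bexI[of _ "(c, -1)"]) (auto simp: Delta_def sides_def)
  qed
qed

text \<open>At distance r from a side of order l, (N) bounds f2 d/f1, f1 d and d^E/f1 by multiples
  of 1, r^l and r^(E-l+1); elsewhere compactness applies. The first bound drives the distortion
  estimates, the other two become \<open>upp\<close> and \<open>low\<close> along a critical
  orbit.\<close>

lemma global_bounds:
  "\<exists>M E. 1 \<le> M \<and> 0 \<le> E \<and> (\<forall>x\<in>S. \<bar>f2 x\<bar> * dC x \<le> M * \<bar>f1 x\<bar> \<and> \<bar>f1 x\<bar> * dC x \<le> M \<and> dC x powr E \<le> M * \<bar>f1 x\<bar>)"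
proof -
  from side_constants obtain ord K \<rho> where \<rho>: "0 < \<rho>" "\<rho> \<le> 1" and K: "1 \<le> K" and
    N0: "\<forall>(c, s)\<in>sides a b Cc. 0 < ord c s \<and> ord c s \<noteq> 1 \<and> (1 < ord c s \<longrightarrow> cond_star a b f Cc c s (ord c s)) \<and>
     (\<forall>x\<in>Delta c s \<rho>. a < x \<and> x < b \<and> x \<notin> Cc \<and> dC x = \<bar>x - c\<bar> \<and> N_bounds (ord c s) K c s x)"
    by (elim exE conjE) (rule that)
  have N: "0 < ord c s \<and> (\<forall>x\<in>Delta c s \<rho>. x \<notin> Cc \<and> dC x = \<bar>x - c\<bar> \<and> N_bounds (ord c s) K c s x)"
    if "(c, s) \<in> sides a b Cc" for c s
    using bspec[OF N0 that] unfolding prod.case by blast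
  obtain A where A: "1 \<le> A" "\<And>x. x \<in> Z \<rho> \<Longrightarrow> \<bar>f1 x\<bar> \<le> A \<and> 1 / A \<le> \<bar>f1 x\<bar> \<and> \<bar>f2 x\<bar> \<le> A"
    using far_bounds[OF \<rho>(1)] by blast
  note fin = finite_sides
  \<comment> \<open>An E at or above all orders gives r^E <= r^(l-1) for r <= 1, whichever side is
    near.\<close>
  define E where "E = Max (insert 0 ((\<lambda>(c, s). ord c s) ` sides a b Cc))"
  have E: "0 \<le> E" "\<And>c s. (c, s) \<in> sides a b Cc \<Longrightarrow> ord c s \<le> E"
    using fin by (auto simp: E_def intro!: Max_ge)
  define W where "W = b - a"
  define M where "M = max (K * K) (max (A * A * W) (max (A * W) (W powr E * A)))"
  have M: "K * K \<le> M" "A * A * W \<le> M" "A * W \<le> M" "W powr E * A \<le> M" by (auto simp: M_def)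
  have "1 \<le> K * K" using K mult_mono[of 1 K 1 K] by simp
  then have M1: "1 \<le> M" using M by linarith
  have "\<bar>f2 x\<bar> * dC x \<le> M * \<bar>f1 x\<bar> \<and> \<bar>f1 x\<bar> * dC x \<le> M \<and> dC x powr E \<le> M * \<bar>f1 x\<bar>" if x: "x \<in> S" for x
  proof (cases "x \<in> Z \<rho>")
    case True
    note b = A(2)[OF True]
    have d: "0 \<le> dC x" "dC x \<le> W" using dC_le x infdist_nonneg by (auto simp: W_def)
    have f: "1 \<le> A * \<bar>f1 x\<bar>" using b A(1) by (simp add: field_simps)
    have 1: "\<bar>f2 x\<bar> * dC x \<le> A * W" using b d A by (intro mult_mono) auto
    have "A * W * 1 \<le> A * W * (A * \<bar>f1 x\<bar>)" using f A d by (intro mult_left_mono) auto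
    also have "\<dots> \<le> M * \<bar>f1 x\<bar>" using mult_right_mono[OF M(2), of "\<bar>f1 x\<bar>"] by (simp add: mult_ac)
    finally have 2: "A * W \<le> M * \<bar>f1 x\<bar>" by simp
    have 3: "\<bar>f1 x\<bar> * dC x \<le> A * W" using b d A by (intro mult_mono) auto
    have "dC x powr E * 1 \<le> W powr E * (A * \<bar>f1 x\<bar>)" using f d E by (intro mult_mono powr_mono2) auto
    also have "\<dots> \<le> M * \<bar>f1 x\<bar>" using mult_right_mono[OF M(4), of "\<bar>f1 x\<bar>"] by (simp add: mult_ac)
    finally show ?thesis using 1 2 3 M by auto
  next
    case False
    then obtain c s where cs: "(c, s) \<in> sides a b Cc" and xD: "x \<in> Delta c s \<rho>"
      using near_or_far[OF x \<rho>(1)] by blast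
    define l where "l = ord c s"
    define r where "r = \<bar>x - c\<bar>"
    have dr: "dC x = r" and Nb: "\<bar>f x - side_val f c s\<bar> \<le> K * r powr l" "r powr (l - 1) \<le> K * \<bar>f1 x\<bar>"
       "\<bar>f1 x\<bar> \<le> K * r powr (l - 1)" "\<bar>f2 x\<bar> \<le> K * r powr (l - 2)" and l: "0 < l" "l \<le> E"
      using N[OF cs] xD E(2)[OF cs] by (auto simp: N_bounds_def l_def r_def)
    have r: "0 < r" "r \<le> 1" using xD \<rho> by (auto simp: Delta_def r_def split: if_splits)
    have "\<bar>f2 x\<bar> * r \<le> K * r powr (l - 2) * r" using Nb r by (intro mult_right_mono) auto
    also have "\<dots> = K * r powr (l - 1)" using r powr_add[of r "l - 2" 1] by simp
    also have "\<dots> \<le> K * (K * \<bar>f1 x\<bar>)" using Nb K by (intro mult_left_mono) auto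
    also have "\<dots> \<le> M * \<bar>f1 x\<bar>" using mult_right_mono[OF M(1), of "\<bar>f1 x\<bar>"] by (simp add: mult_ac)
    finally have 1: "\<bar>f2 x\<bar> * dC x \<le> M * \<bar>f1 x\<bar>" by (simp add: dr)
    have "\<bar>f1 x\<bar> * r \<le> K * r powr (l - 1) * r" using Nb r by (intro mult_right_mono) auto
    also have "\<dots> = K * r powr l" using r powr_add[of r "l - 1" 1] by simp
    also have "\<dots> \<le> K * 1" using r l K powr_le1[of l r] by (intro mult_left_mono) auto
    also have "\<dots> \<le> K * K" using K by (intro mult_left_mono) auto
    finally have 2: "\<bar>f1 x\<bar> * dC x \<le> M" using M by (simp add: dr)
    have "r powr E \<le> r powr (l - 1)" using r l by (intro powr_mono') auto
    also have "\<dots> \<le> K * \<bar>f1 x\<bar>" by (rule Nb)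
    also have "\<dots> \<le> M * \<bar>f1 x\<bar>"
      using order_trans[OF _ M(1), of K] K mult_left_mono[of 1 K K] by (intro mult_right_mono) auto
    finally show ?thesis using 1 2 by (simp add: dr)
  qed
  then show ?thesis using M1 E(1) by blast
qed

end

section \<open>Bounded distortion along shadowing orbits\<close>

text \<open>Both h + g and h - g have nonnegative derivative. In this way a pointwise bound on
  (1/Df^n)' becomes a monotone majorant, which is what controls the variation.\<close>

lemma derivative_dominated:
  fixes g h :: "real \<Rightarrow> real"
  assumes J: "is_interval J" "x \<in> J" "y \<in> J" "x < y"
    and g: "\<And>z. z \<in> J \<Longrightarrow> (g has_real_derivative g' z) (at z within J)"
    and h: "\<And>z. z \<in> J \<Longrightarrow> (h has_real_derivative h' z) (at z within J)"
    and le: "\<And>z. z \<in> J \<Longrightarrow> \<bar>g' z\<bar> \<le> h' z"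
  shows "\<bar>g y - g x\<bar> \<le> h y - h x"
proof -
  have sub: "{x..y} \<subseteq> J" using J by (meson atLeastAtMost_iff mem_is_interval_1_I subsetI)
  have "0 \<le> (h y + e * g y) - (h x + e * g x)" if e: "e = 1 \<or> e = -1" for e
  proof -
    have "\<exists>z\<in>{x<..<y}. (h y + e * g y) - (h x + e * g x) = (\<lambda>t. (h' z + e * g' z) * t) (y - x)"
    proof (rule mvt_simple[OF \<open>x < y\<close>, where f = "\<lambda>t. h t + e * g t" and f' = "\<lambda>z t. (h' z + e * g' z) * t"])
      fix z assume "x \<le> z" "z \<le> y"
      then have "z \<in> J" using sub by (meson atLeastAtMost_iff subsetD)
      have "((\<lambda>t. h t + e * g t) has_real_derivative h' z + e * g' z) (at z within {x..y})"
        using DERIV_subset[OF g[OF \<open>z \<in> J\<close>] sub] DERIV_subset[OF h[OF \<open>z \<in> J\<close>] sub]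
        by (auto intro!: derivative_eq_intros)
      then show "((\<lambda>t. h t + e * g t) has_derivative (\<lambda>t. (h' z + e * g' z) * t)) (at z within {x..y})"
        by (simp add: has_field_derivative_def)
    qed
    then obtain z where z: "z \<in> {x<..<y}" "(h y + e * g y) - (h x + e * g x) = (h' z + e * g' z) * (y - x)" by blast
    have "z \<in> J" using z sub by force
    then have "0 \<le> h' z + e * g' z" using le[of z] e by auto
    then show ?thesis using z J by simp
  qed
  from this[of 1] this[of "-1"] show ?thesis by simp
qed

context cusp_map begin

text \<open>The logarithmic derivative of \<open>Df n\<close>, that is, D^2 f^n / Df^n.\<close>

definition L :: "nat \<Rightarrow> real \<Rightarrow> real" where
  "L n x = (\<Sum>j<n. f2 ((f ^^ j) x) / f1 ((f ^^ j) x) * Df j x)"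

lemma iter_deriv:
  assumes "\<And>x j. x \<in> J \<Longrightarrow> j < n \<Longrightarrow> (f ^^ j) x \<in> S" "x \<in> J"
  shows "((f ^^ n) has_real_derivative Df n x) (at x within J)"
  using assms(1)
proof (induction n)
  case 0
  then show ?case by (simp add: id_def)
next
  case (Suc n)
  have "(f has_real_derivative f1 ((f ^^ n) x)) (at ((f ^^ n) x) within (f ^^ n) ` J)"
    by (rule DERIV_subset[OF f_deriv]) (use Suc.prems assms(2) in auto)
  moreover have "((f ^^ n) has_real_derivative Df n x) (at x within J)" using Suc by simp
  ultimately have "(f \<circ> (f ^^ n) has_real_derivative f1 ((f ^^ n) x) * Df n x) (at x within J)"
    by (rule DERIV_image_chain)
  then show ?case by (simp add: Df_Suc mult.commute o_def)
qed

lemma Df_deriv: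
  assumes "\<And>x j. x \<in> J \<Longrightarrow> j < n \<Longrightarrow> (f ^^ j) x \<in> S" "x \<in> J"
  shows "(Df n has_real_derivative Df n x * L n x) (at x within J)"
  using assms(1)
proof (induction n)
  case 0
  then show ?case by (simp add: L_def dfn_def)
next
  case (Suc n)
  have S: "(f ^^ n) x \<in> S" using Suc.prems assms(2) by simp
  have "(f1 has_real_derivative f2 ((f ^^ n) x)) (at ((f ^^ n) x) within (f ^^ n) ` J)"
    by (rule DERIV_subset[OF f1_deriv]) (use Suc.prems assms(2) in auto)
  moreover have "((f ^^ n) has_real_derivative Df n x) (at x within J)"
    by (rule iter_deriv) (use Suc.prems assms(2) in auto)
  ultimately have "(f1 \<circ> (f ^^ n) has_real_derivative f2 ((f ^^ n) x) * Df n x) (at x within J)"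
    by (rule DERIV_image_chain)
  moreover have "(Df n has_real_derivative Df n x * L n x) (at x within J)" using Suc by simp
  ultimately have "((\<lambda>x. Df n x * (f1 \<circ> (f ^^ n)) x) has_real_derivative
      (Df n x * L n x) * (f1 \<circ> (f ^^ n)) x + (f2 ((f ^^ n) x) * Df n x) * Df n x) (at x within J)"
    by (intro DERIV_mult)
  moreover have "(\<lambda>x. Df n x * (f1 \<circ> (f ^^ n)) x) = Df (Suc n)" by (auto simp: Df_Suc)
  ultimately show ?case using f1_nz[OF S] by (simp add: Df_Suc L_def algebra_simps)
qed

lemma inv_Df_deriv:
  assumes "\<And>x j. x \<in> J \<Longrightarrow> j < n \<Longrightarrow> (f ^^ j) x \<in> S" "x \<in> J"
  shows "((\<lambda>x. 1 / Df n x) has_real_derivative - (L n x / Df n x)) (at x within J)"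
proof -
  have "Df n x \<noteq> 0" using assms by (intro Df_nz) auto
  then show ?thesis using Df_deriv[OF assms]
    by (auto intro!: derivative_eq_intros simp: divide_simps)
qed

lemma dC_pos_S: "x \<in> {a..b} \<Longrightarrow> 0 < dC x \<Longrightarrow> x \<in> S"
  by auto

text \<open>A bootstrap in time. Bounded distortion of Df^m on the whole segment keeps f^m(z) within
  d_m/2 of f^m(v); the segment between them then stays d_m/2 away from \<open>Cc\<close>, so log
  |Df| oscillates little on it and the distortion bound passes to time m+1. The accumulated
  oscillation is at most a constant times |y-v| T_n, so that \<epsilon> depends neither on the orbit
  nor on n.\<close>

lemma binding:
  "\<exists>\<epsilon>>0. \<forall>v n y. v \<in> {a..b} \<longrightarrow> y \<in> {a..b} \<longrightarrow> (\<forall>k. 0 < dC ((f ^^ k) v)) \<longrightarrow>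
     \<bar>y - v\<bar> * (\<Sum>j<n. \<bar>Df j v\<bar> / dC ((f ^^ j) v)) \<le> \<epsilon> \<longrightarrow>
     (\<forall>z\<in>closed_segment v y. (\<forall>j<n. (f ^^ j) z \<in> S \<and> dC ((f ^^ j) v) / 2 \<le> dC ((f ^^ j) z)) \<and>
        (\<forall>j\<le>n. \<bar>Df j v\<bar> / 2 \<le> \<bar>Df j z\<bar> \<and> \<bar>Df j z\<bar> \<le> 2 * \<bar>Df j v\<bar>))"
proof -
  obtain M E where M: "1 \<le> M" "\<And>x. x \<in> S \<Longrightarrow> \<bar>f2 x\<bar> * dC x \<le> M * \<bar>f1 x\<bar>"
    using global_bounds by blast
  \<comment> \<open>The entry 1/4 gives 2 |Df^m(v)| |z-v| <= d_m/2; the entry ln 2/(4M) keeps the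
    total distortion below a factor 2.\<close>
  define \<epsilon> where "\<epsilon> = min (1 / 4) (ln 2 / (4 * M))"
  have \<epsilon>: "0 < \<epsilon>" "\<epsilon> \<le> 1 / 4" "\<epsilon> \<le> ln 2 / (4 * M)" using M by (auto simp: \<epsilon>_def)
  then have \<epsilon>M: "4 * M * \<epsilon> \<le> ln 2" using M by (simp add: field_simps)
  have key: "\<forall>z\<in>closed_segment v y. (\<forall>j<n. (f ^^ j) z \<in> S \<and> dC ((f ^^ j) v) / 2 \<le> dC ((f ^^ j) z)) \<and>
        (\<forall>j\<le>n. \<bar>Df j v\<bar> / 2 \<le> \<bar>Df j z\<bar> \<and> \<bar>Df j z\<bar> \<le> 2 * \<bar>Df j v\<bar>)"
    if v: "v \<in> {a..b}" and y: "y \<in> {a..b}" and d: "\<And>k. 0 < dC ((f ^^ k) v)"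
      and T: "\<bar>y - v\<bar> * (\<Sum>j<n. \<bar>Df j v\<bar> / dC ((f ^^ j) v)) \<le> \<epsilon>" for v y n
  proof -
    define J where "J = closed_segment v y"
    have Jab: "J \<subseteq> {a..b}" unfolding J_def using v y by (simp add: closed_segment_subset)
    have vJ: "v \<in> J" by (simp add: J_def)
    define Ts where "Ts n = (\<Sum>j<n. \<bar>Df j v\<bar> / dC ((f ^^ j) v))" for n
    have Ts_mono: "Ts m \<le> Ts n" if "m \<le> n" for m n
      unfolding Ts_def by (rule sum_mono2) (use that d in \<open>auto intro!: divide_nonneg_pos\<close>)
    have zv: "\<bar>z - v\<bar> \<le> \<bar>y - v\<bar>" if "z \<in> J" for z
      using that by (auto simp: J_def closed_segment_eq_real_ivl split: if_splits)
    \<comment> \<open>All points of \<open>J\<close> are treated at once, since the mean value bound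
      at the next time needs the derivative on the whole segment.\<close>
    have "\<forall>z\<in>J. (\<forall>j<m. (f ^^ j) z \<in> S \<and> dC ((f ^^ j) v) / 2 \<le> dC ((f ^^ j) z) \<and>
            \<bar>(f ^^ j) z - (f ^^ j) v\<bar> \<le> 2 * \<bar>Df j v\<bar> * \<bar>z - v\<bar> \<and> \<bar>(f ^^ j) z - (f ^^ j) v\<bar> \<le> dC ((f ^^ j) v) / 2) \<and>
        (\<bar>Df m v\<bar> / 2 \<le> \<bar>Df m z\<bar> \<and> \<bar>Df m z\<bar> \<le> 2 * \<bar>Df m v\<bar>)"
      if "\<bar>y - v\<bar> * Ts m \<le> \<epsilon>" for m
      using that
    proof (induction m)
      case (Suc m)
      have "\<bar>y - v\<bar> * Ts m \<le> \<bar>y - v\<bar> * Ts (Suc m)" by (intro mult_left_mono Ts_mono) auto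
      then have IH: "\<And>z j. z \<in> J \<Longrightarrow> j < m \<Longrightarrow> (f ^^ j) z \<in> S \<and> dC ((f ^^ j) v) / 2 \<le> dC ((f ^^ j) z) \<and>
            \<bar>(f ^^ j) z - (f ^^ j) v\<bar> \<le> 2 * \<bar>Df j v\<bar> * \<bar>z - v\<bar> \<and> \<bar>(f ^^ j) z - (f ^^ j) v\<bar> \<le> dC ((f ^^ j) v) / 2"
        and IHD: "\<And>z. z \<in> J \<Longrightarrow> \<bar>Df m z\<bar> \<le> 2 * \<bar>Df m v\<bar>"
        using Suc by auto
      have new1: "\<bar>(f ^^ m) z - (f ^^ m) v\<bar> \<le> 2 * \<bar>Df m v\<bar> * \<bar>z - v\<bar>" if z: "z \<in> J" for z
      proof -
        have "norm ((f ^^ m) z - (f ^^ m) v) \<le> 2 * \<bar>Df m v\<bar> * norm (z - v)"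
        proof (rule field_differentiable_bound[of J])
          show "convex J" by (simp add: J_def)
          show "((f ^^ m) has_real_derivative Df m w) (at w within J)" if "w \<in> J" for w
            by (rule iter_deriv) (use that IH in auto)
        qed (use z vJ IHD in auto)
        then show ?thesis by simp
      qed
      have new2: "\<bar>(f ^^ m) z - (f ^^ m) v\<bar> \<le> dC ((f ^^ m) v) / 2" if z: "z \<in> J" for z
      proof -
        have "\<bar>Df m v\<bar> / dC ((f ^^ m) v) \<le> Ts (Suc m)"
          unfolding Ts_def by (rule member_le_sum) (use d in \<open>auto intro!: divide_nonneg_pos\<close>)
        then have "\<bar>z - v\<bar> * (\<bar>Df m v\<bar> / dC ((f ^^ m) v)) \<le> \<bar>y - v\<bar> * Ts (Suc m)"
          using zv[OF z] d[of m] by (intro mult_mono) (auto intro!: divide_nonneg_pos)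
        also have "\<dots> \<le> 1 / 4" using Suc.prems \<epsilon> by linarith
        finally have "2 * \<bar>Df m v\<bar> * \<bar>z - v\<bar> \<le> dC ((f ^^ m) v) / 2" using d[of m] by (simp add: field_simps)
        then show ?thesis using new1[OF z] by linarith
      qed
      have all: "(f ^^ j) z \<in> S \<and> dC ((f ^^ j) v) / 2 \<le> dC ((f ^^ j) z) \<and>
            \<bar>(f ^^ j) z - (f ^^ j) v\<bar> \<le> 2 * \<bar>Df j v\<bar> * \<bar>z - v\<bar> \<and> \<bar>(f ^^ j) z - (f ^^ j) v\<bar> \<le> dC ((f ^^ j) v) / 2"
        if z: "z \<in> J" and j: "j < Suc m" for z j
      proof (cases "j = m")
        case True
        have "dC ((f ^^ m) v) \<le> dC ((f ^^ m) z) + dist ((f ^^ m) v) ((f ^^ m) z)" by (rule infdist_triangle)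
        then have h: "dC ((f ^^ m) v) / 2 \<le> dC ((f ^^ m) z)" using new2[OF z] unfolding dist_real_def by linarith
        moreover have "(f ^^ m) z \<in> S"
          using h d[of m] z Jab by (intro dC_pos_S iter_maps) auto
        ultimately show ?thesis using True new1[OF z] new2[OF z] by simp
      qed (use IH z j in auto)
      have "\<bar>Df (Suc m) v\<bar> / 2 \<le> \<bar>Df (Suc m) z\<bar> \<and> \<bar>Df (Suc m) z\<bar> \<le> 2 * \<bar>Df (Suc m) v\<bar>" if z: "z \<in> J" for z
      proof -
        have 1: "\<bar>ln \<bar>f1 ((f ^^ j) z)\<bar> - ln \<bar>f1 ((f ^^ j) v)\<bar>\<bar> \<le> 4 * M * \<bar>z - v\<bar> * (\<bar>Df j v\<bar> / dC ((f ^^ j) v))"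
          if j: "j < Suc m" for j
        proof -
          let ?p = "(f ^^ j) v" and ?q = "(f ^^ j) z"
          define G where "G = closed_segment ?p ?q"
          have pq: "?p \<in> {a..b}" "?q \<in> {a..b}" using v z Jab iter_maps by auto
          have G: "w \<in> S \<and> dC ?p / 2 \<le> dC w" if w: "w \<in> G" for w
          proof -
            have "w \<in> {a..b}" using w pq closed_segment_subset[of ?p "{a..b}" ?q] by (auto simp: G_def)
            have "\<bar>w - ?p\<bar> \<le> \<bar>?q - ?p\<bar>"
              using w by (auto simp: G_def closed_segment_eq_real_ivl split: if_splits)
            then have "\<bar>w - ?p\<bar> \<le> dC ?p / 2" using all[OF z j] by linarith
            moreover have "dC ?p \<le> dC w + dist ?p w" by (rule infdist_triangle)
            ultimately have h: "dC ?p / 2 \<le> dC w" unfolding dist_real_def by linarith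
            moreover have "w \<in> S" using h d[of j] \<open>w \<in> {a..b}\<close> by (intro dC_pos_S) auto
            ultimately show ?thesis by blast
          qed
          \<comment> \<open>Half the logarithm of the square is ln |f1| in a form that can be
            differentiated whatever the sign of \<open>f1\<close>.\<close>
          have "norm (ln ((f1 ?q)\<^sup>2) / 2 - ln ((f1 ?p)\<^sup>2) / 2) \<le> 2 * M / dC ?p * norm (?q - ?p)"
          proof (rule field_differentiable_bound[of G])
            fix w assume w: "w \<in> G"
            note nz = f1_nz[of w]
            have "(f1 has_real_derivative f2 w) (at w within G)"
              by (rule DERIV_subset[OF f1_deriv]) (use G w in auto)
            then show "((\<lambda>w. ln ((f1 w)\<^sup>2) / 2) has_real_derivative f2 w / f1 w) (at w within G)"
              using nz G w by (auto intro!: derivative_eq_intros simp: power2_eq_square divide_simps zero_less_mult_iff)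
            have "dC ?p / 2 * \<bar>f2 w\<bar> \<le> dC w * \<bar>f2 w\<bar>" using G w by (intro mult_right_mono) auto
            also have "\<dots> \<le> M * \<bar>f1 w\<bar>" using M(2)[of w] G w by (simp add: mult.commute)
            finally show "norm (f2 w / f1 w) \<le> 2 * M / dC ?p"
              using nz G w d[of j] by (simp add: field_simps abs_mult)
          qed (auto simp: G_def)
          moreover have "ln (t\<^sup>2) / 2 = ln \<bar>t\<bar>" for t :: real
            by (cases "t = 0") (use ln_realpow[of "\<bar>t\<bar>" 2] in auto)
          ultimately have "\<bar>ln \<bar>f1 ?q\<bar> - ln \<bar>f1 ?p\<bar>\<bar> \<le> 2 * M / dC ?p * \<bar>?q - ?p\<bar>" by simp
          also have "\<dots> \<le> 2 * M / dC ?p * (2 * \<bar>Df j v\<bar> * \<bar>z - v\<bar>)"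
            using all[OF z j] M d[of j] by (intro mult_left_mono) auto
          finally show ?thesis by (simp add: mult_ac)
        qed
        have lnD: "ln \<bar>Df (Suc m) w\<bar> = (\<Sum>j<Suc m. ln \<bar>f1 ((f ^^ j) w)\<bar>)" if "w \<in> J" for w
        proof -
          have "f1 ((f ^^ j) w) \<noteq> 0" if "j < Suc m" for j using all[OF \<open>w \<in> J\<close> that] f1_nz by blast
          then show ?thesis unfolding dfn_def abs_prod by (subst ln_prod) auto
        qed
        have "\<bar>ln \<bar>Df (Suc m) z\<bar> - ln \<bar>Df (Suc m) v\<bar>\<bar> \<le> (\<Sum>j<Suc m. \<bar>ln \<bar>f1 ((f ^^ j) z)\<bar> - ln \<bar>f1 ((f ^^ j) v)\<bar>\<bar>)"
          unfolding lnD[OF z] lnD[OF vJ] sum_subtractf[symmetric] by (rule sum_abs)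
        also have "\<dots> \<le> (\<Sum>j<Suc m. 4 * M * \<bar>z - v\<bar> * (\<bar>Df j v\<bar> / dC ((f ^^ j) v)))"
          by (rule sum_mono) (use 1 in auto)
        also have "\<dots> = 4 * M * (\<bar>z - v\<bar> * Ts (Suc m))"
          unfolding Ts_def sum_distrib_left[symmetric] by simp
        also have "\<dots> \<le> 4 * M * (\<bar>y - v\<bar> * Ts (Suc m))"
          using zv[OF z] M Ts_mono[of 0 "Suc m"] by (intro mult_left_mono mult_right_mono) (auto simp: Ts_def)
        also have "\<dots> \<le> 4 * M * \<epsilon>" using Suc.prems M by (intro mult_left_mono) auto
        also note \<epsilon>M
        finally have ln: "\<bar>ln \<bar>Df (Suc m) z\<bar> - ln \<bar>Df (Suc m) v\<bar>\<bar> \<le> ln 2" .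
        have nz: "0 < \<bar>Df (Suc m) z\<bar>" "0 < \<bar>Df (Suc m) v\<bar>"
          using Df_nz[of "Suc m" z] Df_nz[of "Suc m" v] all z vJ by auto
        have "ln \<bar>Df (Suc m) z\<bar> \<le> ln (2 * \<bar>Df (Suc m) v\<bar>)" "ln \<bar>Df (Suc m) v\<bar> \<le> ln (2 * \<bar>Df (Suc m) z\<bar>)"
          using ln nz by (auto simp: ln_mult)
        then have "\<bar>Df (Suc m) z\<bar> \<le> 2 * \<bar>Df (Suc m) v\<bar>" "\<bar>Df (Suc m) v\<bar> \<le> 2 * \<bar>Df (Suc m) z\<bar>"
          using nz by (subst (asm) ln_le_cancel_iff; simp)+
        then show ?thesis by simp
      qed
      then show ?case using all by blast
    qed auto
    note P = this
    have TJ: "\<bar>y - v\<bar> * Ts j \<le> \<epsilon>" if "j \<le> n" for j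
    proof -
      have "\<bar>y - v\<bar> * Ts j \<le> \<bar>y - v\<bar> * Ts n" by (intro mult_left_mono Ts_mono that) auto
      then show ?thesis using T by (simp add: Ts_def)
    qed
    show ?thesis using P[OF TJ] unfolding J_def by (meson order_refl)
  qed
  show ?thesis using key \<epsilon>(1) by blast
qed

end

section \<open>Inducing near critical and singular points\<close>

lemma open_interval_form:
  fixes I :: "real set"
  assumes "open I" "is_interval I" "I \<noteq> {}" "I \<subseteq> {a..b}"
  shows "\<exists>u v. u < v \<and> I = {u<..<v}"
proof -
  define u v where "u = Inf I" and "v = Sup I"
  have bd: "bdd_below I" "bdd_above I" using assms(4) by (auto intro: bdd_belowI2 bdd_aboveI2 bdd_below_mono bdd_above_mono)
  have *: "u < x \<and> x < v" if x: "x \<in> I" for x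
  proof -
    obtain e where e: "0 < e" "ball x e \<subseteq> I" using assms(1) x by (auto simp: open_contains_ball)
    have "x - e / 2 \<in> I" "x + e / 2 \<in> I" using e by (auto simp: dist_real_def intro!: subsetD[OF e(2)])
    then have "u \<le> x - e / 2" "x + e / 2 \<le> v" unfolding u_def v_def using bd by (auto intro: cInf_lower cSup_upper)
    then show ?thesis using e by linarith
  qed
  have "x \<in> I" if "u < x" "x < v" for x
  proof -
    obtain p where "p \<in> I" "p < x" using \<open>u < x\<close> assms(3) bd unfolding u_def by (auto simp: cInf_less_iff)
    moreover obtain q where "q \<in> I" "x < q" using \<open>x < v\<close> assms(3) bd unfolding v_def by (auto simp: less_cSup_iff)
    ultimately show ?thesis using assms(2) mem_is_interval_1_I[of I p q x] by auto
  qed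
  then have "I = {u<..<v}" using * by auto
  moreover have "u < v" using * assms(3) by force
  ultimately show ?thesis by blast
qed

lemma abs_le_shift:
  fixes y z :: real
  assumes "\<bar>y\<bar> \<le> z" shows "0 \<le> y + z" "y + z \<le> 2 * z"
  using assms by linarith+

lemma measure_lborel_Ioo_le: "0 \<le> w \<Longrightarrow> v - u \<le> w \<Longrightarrow> measure lborel {u<..<v::real} \<le> w"
  by (cases "u \<le> v") auto

context cusp_map begin

text \<open>
  The increments of \<open>H\<close> dominate those of \<open>1/Df\<^sup>n\<close>, so that \<open>H\<close> bounds its variation. The signed
  \<open>1/Df\<^sup>n\<close> is used in place of \<open>1/|Df\<^sup>n|\<close> because it is differentiable without case distinctions.
\<close>
definition branch :: "real \<Rightarrow> real set \<Rightarrow> nat \<Rightarrow> real \<Rightarrow> bool" where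
  "branch \<Theta> I n V \<longleftrightarrow> open I \<and> is_interval I \<and>
     (\<forall>x\<in>I. (\<forall>j<n. (f ^^ j) x \<in> S) \<and> \<Theta> \<le> \<bar>Df n x\<bar> \<and> \<bar>1 / Df n x\<bar> \<le> V) \<and>
     (\<exists>H. (\<forall>x\<in>I. 0 \<le> H x \<and> H x \<le> V) \<and>
          (\<forall>x\<in>I. \<forall>y\<in>I. x < y \<longrightarrow> \<bar>1 / Df n y - 1 / Df n x\<bar> \<le> H y - H x))"

text \<open>Exceptional sets are countable rather than merely null, because countability passes at
  once to preimages under injective iterates. The threshold \<Theta> is a parameter since pieces
  near \<open>Cc\<close> need spare expansion to offset the loss on the way there.\<close>

definition inducible :: "real \<Rightarrow> real set \<Rightarrow> bool" where
  "inducible \<Theta> A \<longleftrightarrow> A \<subseteq> {a..b} \<and> (\<exists>P t V. countable P \<and> pairwise disjnt P \<and>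
     (\<forall>I\<in>P. I \<noteq> {} \<and> I \<subseteq> A \<and> branch \<Theta> I (t I) (V I)) \<and> countable (A - \<Union>P) \<and>
     V summable_on P \<and> (\<lambda>I. real (t I) * measure lborel I) summable_on P)"

lemma inducibleI:
  assumes A: "A \<subseteq> {a..b}" and X: "countable X"
    and br: "\<And>i. i \<in> X \<Longrightarrow> I i \<subseteq> A \<and> branch \<Theta> (I i) (t i) (V i)"
    and dis: "\<And>i j. i \<in> X \<Longrightarrow> j \<in> X \<Longrightarrow> i \<noteq> j \<Longrightarrow> I i \<inter> I j = {}"
    and cov: "countable (A - (\<Union>i\<in>X. I i))"
    and V: "V summable_on X" and t: "(\<lambda>i. real (t i) * measure lborel (I i)) summable_on X"
  shows "inducible \<Theta> A"
proof -
  \<comment> \<open>Without its empty members the disjoint family is injective, so times and bounds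
    can be transferred from indices to the intervals themselves.\<close>
  define X' where "X' = {i \<in> X. I i \<noteq> {}}"
  have sub: "X' \<subseteq> X" by (auto simp: X'_def)
  have inj: "inj_on I X'" using dis by (force simp: inj_on_def X'_def)
  define g where "g = the_inv_into X' I"
  have g: "g (I i) = i" if "i \<in> X'" for i using the_inv_into_f_f[OF inj that] by (simp add: g_def)
  show ?thesis unfolding inducible_def
  proof (intro conjI exI[of _ "I ` X'"] exI[of _ "t \<circ> g"] exI[of _ "V \<circ> g"] A)
    show "countable (I ` X')" using X sub by (auto intro: countable_subset)
    show "pairwise disjnt (I ` X')" using dis by (force simp: pairwise_def disjnt_def X'_def)
    show "\<forall>J\<in>I ` X'. J \<noteq> {} \<and> J \<subseteq> A \<and> branch \<Theta> J ((t \<circ> g) J) ((V \<circ> g) J)"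
      using br g by (auto simp: X'_def)
    have "\<Union> (I ` X') = (\<Union>i\<in>X. I i)" by (auto simp: X'_def)
    then show "countable (A - \<Union> (I ` X'))" using cov by simp
    have "V summable_on X'" using V sub by (rule summable_on_subset_banach)
    then have "(V \<circ> g) \<circ> I summable_on X'" by (rule summable_on_cong[THEN iffD1, rotated]) (simp add: g)
    then show "(V \<circ> g) summable_on I ` X'" using inj by (simp add: summable_on_reindex)
    have "(\<lambda>i. real (t i) * measure lborel (I i)) summable_on X'" using t sub by (rule summable_on_subset_banach)
    then have "(\<lambda>J. real ((t \<circ> g) J) * measure lborel J) \<circ> I summable_on X'"
      by (rule summable_on_cong[THEN iffD1, rotated]) (simp add: g)
    then show "(\<lambda>J. real ((t \<circ> g) J) * measure lborel J) summable_on I ` X'"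
      using inj by (simp add: summable_on_reindex)
  qed
qed

lemma inducible_single:
  assumes "J \<subseteq> {a..b}" "branch \<Theta> J n V" shows "inducible \<Theta> J"
  by (rule inducibleI[where X = "{()}" and I = "\<lambda>_. J" and t = "\<lambda>_. n" and V = "\<lambda>_. V"]) (use assms in auto)

lemma inducible_empty: "inducible \<Theta> {}"
  by (rule inducibleI[where X = "{} :: nat set"]) auto

lemma inducible_extend:
  assumes "inducible \<Theta> A" "A \<subseteq> B" "B \<subseteq> {a..b}" "countable (B - A)"
  shows "inducible \<Theta> B"
proof -
  obtain P t V where P: "countable P" "pairwise disjnt P"
     "\<forall>I\<in>P. I \<noteq> {} \<and> I \<subseteq> A \<and> branch \<Theta> I (t I) (V I)" "countable (A - \<Union>P)"
     "V summable_on P" "(\<lambda>I. real (t I) * measure lborel I) summable_on P"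
    using assms(1) unfolding inducible_def by blast
  have "countable ((A - \<Union>P) \<union> (B - A))" using P assms by simp
  then have "countable (B - \<Union>P)" by (rule countable_subset[rotated]) auto
  then show ?thesis unfolding inducible_def using P assms by blast
qed

lemma inducible_Un:
  assumes "inducible \<Theta> A" "inducible \<Theta> B" "A \<inter> B = {}"
  shows "inducible \<Theta> (A \<union> B)"
proof -
  obtain P t V where P: "countable P" "pairwise disjnt P"
     "\<forall>I\<in>P. I \<noteq> {} \<and> I \<subseteq> A \<and> branch \<Theta> I (t I) (V I)" "countable (A - \<Union>P)"
     "V summable_on P" "(\<lambda>I. real (t I) * measure lborel I) summable_on P"
    using assms(1) unfolding inducible_def by blast
  obtain P' t' V' where P': "countable P'" "pairwise disjnt P'"
     "\<forall>I\<in>P'. I \<noteq> {} \<and> I \<subseteq> B \<and> branch \<Theta> I (t' I) (V' I)" "countable (B - \<Union>P')"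
     "V' summable_on P'" "(\<lambda>I. real (t' I) * measure lborel I) summable_on P'"
    using assms(2) unfolding inducible_def by blast
  have PA: "I \<noteq> {} \<and> I \<subseteq> A" if "I \<in> P" for I using P(3) that by simp
  have PB: "I \<noteq> {} \<and> I \<subseteq> B" if "I \<in> P'" for I using P'(3) that by simp
  have AB: "I \<inter> I' = {}" if "I \<in> P" "I' \<in> P'" for I I' using PA[OF that(1)] PB[OF that(2)] assms(3) by blast
  have d: "P \<inter> P' = {}" using PA AB by force
  then have nin: "I \<in> P' \<Longrightarrow> I \<notin> P" for I by blast
  define t'' where "t'' I = (if I \<in> P then t I else t' I)" for I
  define V'' where "V'' I = (if I \<in> P then V I else V' I)" for I
  have "pairwise disjnt (P \<union> P')"
    using P(2) P'(2) AB unfolding pairwise_def disjnt_def by (metis Int_commute UnE)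
  moreover have "\<forall>I\<in>P \<union> P'. I \<noteq> {} \<and> I \<subseteq> A \<union> B \<and> branch \<Theta> I (t'' I) (V'' I)"
    using P(3) P'(3) nin by (auto simp: t''_def V''_def)
  moreover have "countable (A \<union> B - \<Union>(P \<union> P'))"
    by (rule countable_subset[of _ "(A - \<Union>P) \<union> (B - \<Union>P')"]) (use P(4) P'(4) in auto)
  moreover have "V'' summable_on P \<union> P'"
    by (rule summable_on_Un_disjoint[OF _ _ d]; rule summable_on_cong[THEN iffD1, rotated], (rule P(5) P'(5)))
      (use nin in \<open>auto simp: V''_def\<close>)
  moreover have "(\<lambda>I. real (t'' I) * measure lborel I) summable_on P \<union> P'"
    by (rule summable_on_Un_disjoint[OF _ _ d]; rule summable_on_cong[THEN iffD1, rotated], (rule P(6) P'(6)))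
      (use nin in \<open>auto simp: t''_def\<close>)
  ultimately show ?thesis
    unfolding inducible_def using P(1) P'(1) assms(1,2) by (intro conjI exI[of _ "P \<union> P'"] exI[of _ t''] exI[of _ V''])
      (auto simp: inducible_def)
qed

lemma inducible_UN:
  assumes "finite X" "\<And>i. i \<in> X \<Longrightarrow> inducible \<Theta> (A i)"
    "\<And>i j. i \<in> X \<Longrightarrow> j \<in> X \<Longrightarrow> i \<noteq> j \<Longrightarrow> A i \<inter> A j = {}"
  shows "inducible \<Theta> (\<Union>i\<in>X. A i)"
  using assms
proof (induction X rule: finite_induct)
  case (insert i X)
  have "inducible \<Theta> (A i \<union> (\<Union>i\<in>X. A i))"
    by (rule inducible_Un) (use insert in \<open>fastforce+\<close>)
  then show ?case by simp
qed (simp add: inducible_empty)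

text \<open>Here s (x - c) is the distance r to c, and the function is a primitive of the bound k
  r^(-l) for |(1/Df^n)'|. The factor s makes it increasing on both sides of c when k >= 0; the
  constant e will shift it to nonnegative values.\<close>

lemma powr_antiderivative:
  fixes c s l x k e :: real
  assumes s: "s = 1 \<or> s = -1" and x: "0 < s * (x - c)" and l: "l \<noteq> 1"
  shows "((\<lambda>x. k * (s * ((s * (x - c)) powr (1 - l) / (1 - l)) + e)) has_real_derivative
    k * (s * (x - c)) powr (- l)) (at x within J)"
proof -
  have ss: "s * s = 1" using s by auto
  have "((\<lambda>x. s * ((s * (x - c)) powr (1 - l) / (1 - l))) has_real_derivative
     s * (((1 - l) * (s * (x - c)) powr (1 - l - 1) * s) / (1 - l))) (at x within J)"
    using x by (auto intro!: derivative_eq_intros)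
  also have "s * (((1 - l) * (s * (x - c)) powr (1 - l - 1) * s) / (1 - l)) = (s * s) * (s * (x - c)) powr (- l)"
    using l by simp
  finally have "((\<lambda>x. s * ((s * (x - c)) powr (1 - l) / (1 - l))) has_real_derivative
     (s * (x - c)) powr (- l)) (at x within J)" by (simp only: ss mult_1)
  from DERIV_cmult[OF DERIV_add[OF this DERIV_const]] show ?thesis by (simp only: add_0_right)
qed

lemma Delta_iff: "s = 1 \<or> s = -1 \<Longrightarrow> x \<in> Delta c s \<delta> \<longleftrightarrow> 0 < s * (x - c) \<and> s * (x - c) < \<delta>"
  by (auto simp: Delta_def)

lemma Df_Suc': "Df (Suc n) x = f1 x * Df n (f x)"
  using Df_add[of 1 n x] by (simp add: dfn_def)

text \<open>Separates the first step, where f2/f1 is of order 1/r near c, from the iterates that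
  shadow the critical orbit.\<close>

lemma L_Suc': assumes "x \<in> S" shows "L (Suc n) x = f2 x / f1 x + f1 x * L n (f x)"
  unfolding L_def sum.lessThan_Suc_shift sum_distrib_left
  by (auto simp: Df_Suc' funpow_swap1 intro!: sum.cong)

text \<open>For l < 1 the derivative tends to infinity at c, while |(1/f1)'| = |f2|/f1^2 <= K^3
  r^(-l) is integrable there; one branch with inducing time 1 is enough.\<close>

lemma singular_inducible:
  assumes cs: "s = 1 \<or> s = -1" and l: "0 < l" "l < 1" and K: "1 \<le> K" and \<rho>: "0 < \<rho>" "\<rho> \<le> 1"
    and N: "\<And>x. x \<in> Delta c s \<rho> \<Longrightarrow> a < x \<and> x < b \<and> x \<notin> Cc \<and> N_bounds l K c s x"
    and \<Theta>: "0 < \<Theta>"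
  shows "\<exists>\<delta>0>0. \<forall>\<delta>. 0 < \<delta> \<and> \<delta> \<le> \<delta>0 \<longrightarrow> inducible \<Theta> (Delta c s \<delta>)"
proof -
  \<comment> \<open>The radius at which the bound K r^(1-l) for 1/|f1| reaches 1/\<Theta>.\<close>
  define \<delta>1 where "\<delta>1 = (1 / (K * \<Theta>)) powr (1 / (1 - l))"
  have \<delta>1: "0 < \<delta>1" "\<delta>1 powr (1 - l) = 1 / (K * \<Theta>)" using K \<Theta> l by (auto simp: \<delta>1_def powr_powr)
  have "inducible \<Theta> (Delta c s \<delta>)" if \<delta>: "0 < \<delta>" "\<delta> \<le> min \<rho> \<delta>1" for \<delta>
  proof -
    define J where "J = Delta c s \<delta>"
    define r where "r x = s * (x - c)" for x
    have J: "0 < r x \<and> r x < \<delta> \<and> \<bar>x - c\<bar> = r x \<and> x \<in> S \<and> a < x \<and> x < b \<and> N_bounds l K c s x" if "x \<in> J" for x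
    proof -
      have "x \<in> Delta c s \<rho>" "0 < r x \<and> r x < \<delta>" using that \<delta> cs by (auto simp: J_def Delta_iff r_def)
      then show ?thesis using N[of x] cs by (auto simp: r_def)
    qed
    define h where "h x = K ^ 3 * (s * (r x powr (1 - l) / (1 - l)) + 1 / (1 - l))" for x
    have iJ: "is_interval J" "open J" by (auto simp: J_def Delta_def is_interval_1)
    have K0: "1 / \<bar>f1 x\<bar> \<le> K * r x powr (1 - l)" if "x \<in> J" for x
    proof -
      have "r x powr (l - 1) \<le> K * \<bar>f1 x\<bar>" using J[OF that] by (auto simp: N_bounds_def)
      moreover have "r x powr (1 - l) * r x powr (l - 1) = 1" using J[OF that] by (simp flip: powr_add)
      ultimately have "1 \<le> r x powr (1 - l) * (K * \<bar>f1 x\<bar>)"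
        by (metis mult_left_mono powr_ge_zero)
      moreover have "f1 x \<noteq> 0" using f1_nz J[OF that] by blast
      ultimately show ?thesis by (simp add: field_simps)
    qed
    have "branch \<Theta> J 1 (max (1 / \<Theta>) (K ^ 3 * (2 / (1 - l))))"
      unfolding branch_def
    proof (intro conjI ballI iJ exI[of _ h] impI)
      fix x assume x: "x \<in> J"
      show "\<forall>j<1. (f ^^ j) x \<in> S" using J[OF x] by simp
      have nz: "f1 x \<noteq> 0" using f1_nz J[OF x] by blast
      have "1 / \<bar>f1 x\<bar> \<le> K * r x powr (1 - l)" by (rule K0[OF x])
      also have "\<dots> \<le> K * \<delta>1 powr (1 - l)" using J[OF x] \<delta> K l by (intro mult_left_mono powr_mono2) auto
      also have "\<dots> = 1 / \<Theta>" using \<delta>1 K by simp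
      finally have "1 / \<bar>f1 x\<bar> \<le> 1 / \<Theta>" .
      then show "\<Theta> \<le> \<bar>Df 1 x\<bar>" using nz \<Theta> by (simp add: dfn_def field_simps)
      show "\<bar>1 / Df 1 x\<bar> \<le> max (1 / \<Theta>) (K ^ 3 * (2 / (1 - l)))"
        using \<open>1 / \<bar>f1 x\<bar> \<le> 1 / \<Theta>\<close> by (intro max.coboundedI1) (simp add: dfn_def)
      have "r x powr (1 - l) \<le> 1" using J[OF x] \<delta> \<rho> l by (intro powr_le1) auto
      then have "\<bar>s * (r x powr (1 - l) / (1 - l))\<bar> \<le> 1 / (1 - l)"
        using cs l by (auto simp: abs_mult intro!: divide_right_mono)
      from abs_le_shift[OF this] have "0 \<le> s * (r x powr (1 - l) / (1 - l)) + 1 / (1 - l)"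
        "s * (r x powr (1 - l) / (1 - l)) + 1 / (1 - l) \<le> 2 / (1 - l)" by simp_all
      note hb = this
      show "0 \<le> h x" unfolding h_def using K hb by simp
      have "h x \<le> K ^ 3 * (2 / (1 - l))" unfolding h_def using K by (intro mult_left_mono hb) auto
      then show "h x \<le> max (1 / \<Theta>) (K ^ 3 * (2 / (1 - l)))" by simp
      fix y assume y: "y \<in> J" "x < y"
      show "\<bar>1 / Df 1 y - 1 / Df 1 x\<bar> \<le> h y - h x"
      proof (rule derivative_dominated[OF iJ(1) x y])
        fix z assume z: "z \<in> J"
        show "((\<lambda>x. 1 / Df 1 x) has_real_derivative - (L 1 z / Df 1 z)) (at z within J)"
          by (rule inv_Df_deriv) (use J z in auto)
        show "(h has_real_derivative K ^ 3 * r z powr (- l)) (at z within J)"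
          unfolding h_def[abs_def] r_def by (rule powr_antiderivative) (use cs J[OF z] l in \<open>auto simp: r_def\<close>)
        have r: "0 < r z" using J[OF z] by simp
        have "\<bar>- (L 1 z / Df 1 z)\<bar> = \<bar>f2 z\<bar> * ((1 / \<bar>f1 z\<bar>) * (1 / \<bar>f1 z\<bar>))" by (simp add: L_def dfn_def abs_mult)
        also have "\<dots> \<le> (K * r z powr (l - 2)) * ((K * r z powr (1 - l)) * (K * r z powr (1 - l)))"
          using J[OF z] K0[OF z] K by (intro mult_mono) (auto simp: N_bounds_def)
        also have "\<dots> = K ^ 3 * (r z powr (l - 2) * r z powr (1 - l) * r z powr (1 - l))" by (simp add: power3_eq_cube)
        also have "r z powr (l - 2) * r z powr (1 - l) * r z powr (1 - l) = r z powr (- l)"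
          unfolding powr_add[symmetric] by (rule arg_cong[where f = "\<lambda>t. _ powr t"]) simp
        finally show "\<bar>- (L 1 z / Df 1 z)\<bar> \<le> K ^ 3 * r z powr (- l)" .
      qed
    qed
    then show ?thesis using inducible_single[of J] J by (force simp: J_def)
  qed
  then show ?thesis using \<delta>1 \<rho> by (intro exI[of _ "min \<rho> \<delta>1"]) auto
qed


text \<open>On the shell R(i+1) < |x-c| < R(i) the inducing time is one step into a neighbourhood of
  v and then q_i steps of shadowing. The outer radius keeps the shadowing valid up to q_i. The inner
  radius limits both the loss r^(1-l) of the first step and the variation, as |(1/Df)'| is at most a
  multiple of r^(-l)/2^i.\<close>

lemma critical_inducible:
  assumes cs: "s = 1 \<or> s = -1" and l: "1 < l" and K: "1 \<le> K" and \<rho>: "0 < \<rho>" "\<rho> \<le> 1"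
    and N: "\<And>x. x \<in> Delta c s \<rho> \<Longrightarrow> a < x \<and> x < b \<and> x \<notin> Cc \<and> N_bounds l K c s x"
    and v: "side_val f c s \<in> {a..b}" and star: "cond_star a b f Cc c s l"
    and \<Theta>: "0 < \<Theta>"
  shows "\<exists>\<delta>0>0. \<forall>\<delta>. 0 < \<delta> \<and> \<delta> \<le> \<delta>0 \<longrightarrow> inducible \<Theta> (Delta c s \<delta>)"
proof -
  define v where "v = side_val f c s"
  define D where "D k = \<bar>Df k v\<bar>" for k
  define d where "d k = dC ((f ^^ k) v)" for k
  define \<beta> where "\<beta> = 1 / (2 * l - 1)"
  \<comment> \<open>The inequality \<beta> < 1/l will make times multiplied by lengths summable; the
    identity does the same for the bounds on 1/|Df|.\<close>
  have \<beta>: "0 < \<beta>" "\<beta> < 1" "\<beta> < 1 / l" "(1 + \<beta>) * ((l - 1) / l) = 1 - \<beta>"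
    using l by (auto simp: \<beta>_def field_simps)
  have vab: "v \<in> {a..b}" using assms(7) by (simp add: v_def)
  have pos: "0 < d k" "0 < D k" for k using star by (auto simp: cond_star_def Let_def v_def d_def D_def)
  have vS: "(f ^^ k) v \<in> S" for k using pos(1)[of k] iter_maps[OF vab] by (intro dC_pos_S) (auto simp: d_def)
  have "summable (\<lambda>k. - real (Suc k) * ln (d k) / (d k * D k powr \<beta>))"
    using star by (simp add: cond_star_def Let_def v_def d_def D_def \<beta>_def)
  from BseqE[OF summable_imp_Bseq[OF this]]
  obtain B0 where "\<forall>k. norm (- real (Suc k) * ln (d k) / (d k * D k powr \<beta>)) \<le> B0" by blast
  then have B0: "\<bar>- real (Suc k) * ln (d k) / (d k * D k powr \<beta>)\<bar> \<le> B0" for k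
    unfolding real_norm_def by blast
  define B where "B = max B0 1"
  \<comment> \<open>Below 1/e one has -ln d_k >= 1, so the k-th term of \<open>cond_star\<close>
    dominates (k+1)/(d_k D_k^\<beta>).\<close>
  have near: "real (Suc k) \<le> B * d k * D k powr \<beta>" if "d k \<le> exp (-1)" for k
  proof -
    have "ln (d k) \<le> ln (exp (-1))" using that pos by (subst ln_le_cancel_iff) auto
    then have "real (Suc k) * 1 \<le> real (Suc k) * - ln (d k)" by (intro mult_left_mono) auto
    then have "real (Suc k) \<le> - real (Suc k) * ln (d k)" by (simp only: mult_minus_left mult_minus_right mult_1_right)
    then have "real (Suc k) / (d k * D k powr \<beta>) \<le> - real (Suc k) * ln (d k) / (d k * D k powr \<beta>)"
      by (rule divide_right_mono) (use pos in \<open>simp add: less_imp_le\<close>)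
    also have "\<dots> \<le> B0" using B0[of k] by linarith
    also have "\<dots> \<le> B" by (simp add: B_def)
    finally show ?thesis using pos[of k] by (simp add: field_simps)
  qed
  have "(0::real) < exp (-1)" by simp
  from E2[OF this] obtain C0 lam where C0: "0 < C0" "0 < lam" and E2all: "\<forall>x\<in>{a..b}. \<forall>n. n \<ge> 1 \<longrightarrow>
        (\<forall>j<n. \<forall>c\<in>Cc. exp (-1) < \<bar>(f ^^ j) x - c\<bar>) \<longrightarrow> C0 * exp (lam * real n) \<le> \<bar>Df n x\<bar>"
    by (elim exE conjE) (rule that)
  have E2: "C0 * exp (lam * real n) \<le> \<bar>Df n x\<bar>" if "x \<in> {a..b}" "n \<ge> 1"
      "\<And>j c. j < n \<Longrightarrow> c \<in> Cc \<Longrightarrow> exp (-1) < \<bar>(f ^^ j) x - c\<bar>" for x n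
    using E2all[rule_format, OF that(1,2)] that(3) by simp
  \<comment> \<open>(E2) concerns at least one step; C <= 1 covers runs of length 0.\<close>
  define C where "C = min C0 1"
  have C: "0 < C" using C0 by (simp add: C_def)
  have far: "C * exp (lam * real n) * D m \<le> D (m + n)"
    if far: "\<And>j. m \<le> j \<Longrightarrow> j < m + n \<Longrightarrow> exp (-1) < d j" for m n
  proof (cases "n = 0")
    case True
    then show ?thesis using pos[of m] by (simp add: C_def)
  next
    case False
    have "C0 * exp (lam * real n) \<le> \<bar>Df n ((f ^^ m) v)\<bar>"
    proof (rule E2)
      show "(f ^^ m) v \<in> {a..b}" using iter_maps vab by blast
      fix j c' assume j: "j < n" and c': "c' \<in> Cc"
      have "exp (-1) < d (m + j)" using far[of "m + j"] j by simp
      also have "\<dots> \<le> dist ((f ^^ (m + j)) v) c'" unfolding d_def by (rule infdist_le[OF c'])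
      also have "(f ^^ (m + j)) v = (f ^^ j) ((f ^^ m) v)" by (simp add: add.commute[of m] funpow_add)
      finally show "exp (-1) < \<bar>(f ^^ j) ((f ^^ m) v) - c'\<bar>" by (simp add: dist_real_def)
    qed (use False in simp)
    then have "C0 * exp (lam * real n) * D m \<le> \<bar>Df n ((f ^^ m) v)\<bar> * D m"
      using pos[of m] by (intro mult_right_mono) auto
    also have "\<dots> = D (m + n)" by (simp add: D_def Df_add abs_mult)
    finally have "C0 * exp (lam * real n) * D m \<le> D (m + n)" .
    moreover have "C * exp (lam * real n) * D m \<le> C0 * exp (lam * real n) * D m"
      using pos[of m] by (intro mult_right_mono) (auto simp: C_def)
    ultimately show ?thesis by linarith
  qed
  obtain M E where M: "1 \<le> M" "0 \<le> E" "\<And>x. x \<in> S \<Longrightarrow> \<bar>f2 x\<bar> * dC x \<le> M * \<bar>f1 x\<bar> \<and> \<bar>f1 x\<bar> * dC x \<le> M \<and> dC x powr E \<le> M * \<bar>f1 x\<bar>"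
    using global_bounds by blast
  interpret G: orbit_growth D d "exp (-1)" B \<beta> C lam "1 / M" E M "b - a"
  proof
    show "D 0 = 1" by (simp add: D_def)
    show "d k \<le> b - a" for k unfolding d_def by (intro dC_le iter_maps vab)
    show "1 / M * d k powr E * D k \<le> D (Suc k)" for k
    proof -
      have "1 / M * d k powr E \<le> \<bar>f1 ((f ^^ k) v)\<bar>" using M(3)[OF vS[of k]] M(1) by (simp add: field_simps d_def)
      then have "1 / M * d k powr E * D k \<le> \<bar>f1 ((f ^^ k) v)\<bar> * D k" using pos[of k] by (intro mult_right_mono) auto
      then show ?thesis by (simp add: D_def Df_Suc abs_mult mult.commute)
    qed
    show "D (Suc k) \<le> M * (D k / d k)" for k
    proof -
      have "\<bar>f1 ((f ^^ k) v)\<bar> * d k \<le> M" using M(3)[OF vS[of k]] by (simp add: d_def)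
      then have "\<bar>f1 ((f ^^ k) v)\<bar> * d k * (D k / d k) \<le> M * (D k / d k)"
        using pos[of k] by (intro mult_right_mono) auto
      then show ?thesis using pos(1)[of k] by (simp add: D_def Df_Suc abs_mult mult.commute)
    qed
  qed (use pos near far C C0 \<beta> M in \<open>auto simp: B_def\<close>)
  obtain q CC where CC: "0 < CC" and q: "\<And>i. i \<ge> 1 \<Longrightarrow> 1 \<le> q i \<and> q i \<le> q (Suc i) \<and> 2 ^ i \<le> D (q i) \<and> 2 ^ i \<le> CC * G.T (q i) \<and>
     G.T (q (Suc i)) \<le> CC * 2 powr (real i * (1 + \<beta>)) * real (Suc i) \<and> real (q i) \<le> CC * G.T (q i) powr \<beta>"
    using G.record_times by blast
  have Tpos: "0 < G.T (q i)" if "1 \<le> i" for i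
  proof -
    have "0 < CC * G.T (q i)" using q[OF that] zero_less_power[of "2::real" i] by linarith
    then show ?thesis using CC zero_less_mult_pos by blast
  qed
  obtain \<epsilon> where \<epsilon>: "0 < \<epsilon>" and bind: "\<And>y n z j. y \<in> {a..b} \<Longrightarrow> \<bar>y - v\<bar> * G.T n \<le> \<epsilon> \<Longrightarrow>
       (j < n \<longrightarrow> (f ^^ j) y \<in> S \<and> d j / 2 \<le> dC ((f ^^ j) y)) \<and>
        (j \<le> n \<longrightarrow> D j / 2 \<le> \<bar>Df j y\<bar> \<and> \<bar>Df j y\<bar> \<le> 2 * D j)"
  proof -
    from binding obtain \<epsilon> where "0 < \<epsilon>" and b: "\<And>v n y. v \<in> {a..b} \<Longrightarrow> y \<in> {a..b} \<Longrightarrow> \<forall>k. 0 < dC ((f ^^ k) v) \<Longrightarrow>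
     \<bar>y - v\<bar> * (\<Sum>j<n. \<bar>Df j v\<bar> / dC ((f ^^ j) v)) \<le> \<epsilon> \<Longrightarrow>
     (\<forall>z\<in>closed_segment v y. (\<forall>j<n. (f ^^ j) z \<in> S \<and> dC ((f ^^ j) v) / 2 \<le> dC ((f ^^ j) z)) \<and>
        (\<forall>j\<le>n. \<bar>Df j v\<bar> / 2 \<le> \<bar>Df j z\<bar> \<and> \<bar>Df j z\<bar> \<le> 2 * \<bar>Df j v\<bar>))"
      by blast
    have "(j < n \<longrightarrow> (f ^^ j) y \<in> S \<and> d j / 2 \<le> dC ((f ^^ j) y)) \<and>
        (j \<le> n \<longrightarrow> D j / 2 \<le> \<bar>Df j y\<bar> \<and> \<bar>Df j y\<bar> \<le> 2 * D j)"
      if y: "y \<in> {a..b}" "\<bar>y - v\<bar> * G.T n \<le> \<epsilon>" for y n j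
    proof -
      have "\<forall>k. 0 < dC ((f ^^ k) v)" using pos(1) by (simp add: d_def)
      from b[OF vab y(1) this, of n] have "(\<forall>j<n. (f ^^ j) y \<in> S \<and> dC ((f ^^ j) v) / 2 \<le> dC ((f ^^ j) y)) \<and>
        (\<forall>j\<le>n. \<bar>Df j v\<bar> / 2 \<le> \<bar>Df j y\<bar> \<and> \<bar>Df j y\<bar> \<le> 2 * \<bar>Df j v\<bar>)"
        using y(2) by (simp add: G.T_def D_def d_def)
      then show ?thesis by (simp add: D_def d_def)
    qed
    then show thesis using \<open>0 < \<epsilon>\<close> that by blast
  qed
  \<comment> \<open>By (N), |f(x) - v| <= K r^l. Thus \<open>R i\<close> is the radius with K r^l
    T(q_i) = \<epsilon>, and every point closer to c shadows the critical orbit for q_i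
    steps.\<close>
  define e0 where "e0 = \<epsilon> / K"
  have e0: "0 < e0" using \<epsilon> K by (simp add: e0_def)
  define R where "R i = (e0 / G.T (q i)) powr (1 / l)" for i
  have R: "0 < R i" "R i powr l * G.T (q i) = e0" if "1 \<le> i" for i
    using Tpos[OF that] e0 l by (auto simp: R_def powr_powr)
  have R_Suc: "R (Suc i) \<le> R i" if "1 \<le> i" for i
  proof -
    have "G.T (q i) \<le> G.T (q (Suc i))" using q[OF that] by (intro G.T_mono) auto
    then show ?thesis unfolding R_def using Tpos[OF that] e0 l by (intro powr_mono2 divide_left_mono) auto
  qed
  have R_anti: "R j \<le> R i" if "1 \<le> i" "i \<le> j" for i j
    using that(2) by (induction j rule: dec_induct) (use R_Suc that(1) order_trans in \<open>force+\<close>)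
  \<comment> \<open>A bound for r |L|: the first step contributes K^2 and the shadowing steps 4 M
    \<epsilon>.\<close>
  define K4 where "K4 = K * K + 4 * M * \<epsilon>"
  have K4: "0 < K4" using K M \<epsilon> by (simp add: K4_def add_pos_pos)
  \<comment> \<open>In units of R(i+1)^(1-l)/2^i, the first summand bounds 1/|Df| on the i-th shell
    and the second bounds the majorant of its oscillation.\<close>
  define K5 where "K5 = 2 * K + 4 * K * K4 / (l - 1)"
  have K5: "2 * K \<le> K5" "4 * K * K4 / (l - 1) \<le> K5" "0 < K5" using K K4 l by (auto simp: K5_def add_pos_nonneg)
  define K6 where "K6 = K5 * (1 / e0) powr ((l - 1) / l) * CC powr ((l - 1) / l)"
  define \<theta> where "\<theta> = 2 powr (- \<beta>)"
  have \<theta>: "0 < \<theta>" "\<theta> < 1" using \<beta> by (auto simp: \<theta>_def powr_less_one)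
  have VR: "K5 * R (Suc i) powr (1 - l) / 2 ^ i \<le> K6 * (real (Suc i) * \<theta> ^ i)" if i: "1 \<le> i" for i
  proof -
    have T: "0 < G.T (q (Suc i))" by (rule Tpos) simp
    have X: "(CC * 2 powr (real i * (1 + \<beta>)) * real (Suc i)) powr ((l - 1) / l)
       \<le> CC powr ((l - 1) / l) * (\<theta> ^ i * 2 ^ i) * real (Suc i)"
    proof -
    have "(CC * 2 powr (real i * (1 + \<beta>)) * real (Suc i)) powr ((l - 1) / l)
       = CC powr ((l - 1) / l) * 2 powr (real i * ((1 + \<beta>) * ((l - 1) / l))) * real (Suc i) powr ((l - 1) / l)"
      using CC by (simp add: powr_mult powr_powr mult.assoc)
    also have "\<dots> \<le> CC powr ((l - 1) / l) * 2 powr (real i * ((1 + \<beta>) * ((l - 1) / l))) * real (Suc i)"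
    proof (rule mult_left_mono)
      have "(l - 1) / l \<le> 1" using l by simp
      then have "real (Suc i) powr ((l - 1) / l) \<le> real (Suc i) powr 1" by (intro powr_mono) auto
      then show "real (Suc i) powr ((l - 1) / l) \<le> real (Suc i)" by simp
    qed simp
    also have "2 powr (real i * ((1 + \<beta>) * ((l - 1) / l))) = \<theta> ^ i * 2 ^ i"
    proof -
      have "\<theta> ^ i * 2 ^ i = 2 powr (- \<beta> * real i) * 2 powr real i"
        by (simp add: \<theta>_def powr_power powr_realpow mult.commute)
      also have "\<dots> = 2 powr (real i * (1 - \<beta>))" by (simp add: algebra_simps flip: powr_add)
      finally show ?thesis unfolding \<beta>(4) by simp
    qed
    finally show ?thesis .
    qed
    have "R (Suc i) powr (1 - l) = (e0 / G.T (q (Suc i))) powr (- ((l - 1) / l))"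
      unfolding R_def powr_powr by (rule arg_cong[where f = "\<lambda>t. _ powr t"]) (use l in \<open>simp add: field_simps\<close>)
    also have "\<dots> = (1 / e0 * G.T (q (Suc i))) powr ((l - 1) / l)"
      using e0 T by (simp add: powr_minus_divide powr_divide powr_mult)
    also have "\<dots> = (1 / e0) powr ((l - 1) / l) * G.T (q (Suc i)) powr ((l - 1) / l)"
      using e0 T by (intro powr_mult)
    also have "\<dots> \<le> (1 / e0) powr ((l - 1) / l) * (CC * 2 powr (real i * (1 + \<beta>)) * real (Suc i)) powr ((l - 1) / l)"
      using q[OF i] T l by (intro mult_left_mono powr_mono2) auto
    also have "\<dots> \<le> (1 / e0) powr ((l - 1) / l) * (CC powr ((l - 1) / l) * (\<theta> ^ i * 2 ^ i) * real (Suc i))"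
      by (rule mult_left_mono[OF X]) simp
    finally have "R (Suc i) powr (1 - l) \<le> (1 / e0) powr ((l - 1) / l) * (CC powr ((l - 1) / l) * (\<theta> ^ i * 2 ^ i) * real (Suc i))" .
    then have "K5 * R (Suc i) powr (1 - l) / 2 ^ i \<le> K5 * ((1 / e0) powr ((l - 1) / l) * (CC powr ((l - 1) / l) * (\<theta> ^ i * 2 ^ i) * real (Suc i))) / 2 ^ i"
      using K5 by (intro divide_right_mono mult_left_mono) auto
    also have "\<dots> = K6 * (real (Suc i) * \<theta> ^ i)" by (simp add: K6_def)
    finally show ?thesis .
  qed
  define V where "V i = K6 * (real (Suc i) * \<theta> ^ i)" for i
  have Vsum: "summable V"
    unfolding V_def using geometric_deriv_sums[of \<theta>] \<theta> by (intro summable_mult) (auto simp: sums_iff)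
  then have "V \<longlonglongrightarrow> 0" by (rule summable_LIMSEQ_zero)
  then have "eventually (\<lambda>i. V i < 1 / \<Theta>) sequentially" using \<Theta> by (intro order_tendstoD) auto
  then obtain i1 where i1: "\<And>i. i \<ge> i1 \<Longrightarrow> V i < 1 / \<Theta>" by (auto simp: eventually_sequentially)
  \<comment> \<open>\<open>V i\<close> will bound 1/|Df| on the i-th shell and tends to 0, so that
    shells of large index have any prescribed expansion \<Theta>.\<close>
  define i0 where "i0 = max i1 1"
  have i0: "1 \<le> i0" "\<And>i. i \<ge> i0 \<Longrightarrow> V i < 1 / \<Theta>" using i1 by (auto simp: i0_def)
  \<comment> \<open>R_i is of order T(q_i)^(-1/l) and q_i at most of order T(q_i)^\<beta>, so their
    product is at most of order T(q_i)^(-(1/l-\<beta>)); since 2^i = O(T(q_i)), this decays like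
    \<phi>^i.\<close>
  define \<phi> where "\<phi> = 2 powr (- (1 / l - \<beta>))"
  have \<phi>: "0 < \<phi>" "\<phi> < 1" using \<beta> by (auto simp: \<phi>_def powr_less_one)
  define K7 where "K7 = 2 * CC * e0 powr (1 / l) * CC powr (1 / l - \<beta>)"
  have tR: "real (Suc (q i)) * R i \<le> K7 * \<phi> ^ i" if i: "1 \<le> i" for i
  proof -
    note T = Tpos[OF i]
    have "real (Suc (q i)) \<le> 2 * (CC * G.T (q i) powr \<beta>)" using q[OF i] by simp
    then have "real (Suc (q i)) * R i \<le> 2 * (CC * G.T (q i) powr \<beta>) * R i"
      using R(1)[OF i] by (intro mult_right_mono) auto
    also have "\<dots> = 2 * CC * e0 powr (1 / l) * G.T (q i) powr (- (1 / l - \<beta>))"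
      using T e0 by (simp add: R_def powr_divide powr_diff)
    also have "\<dots> \<le> 2 * CC * e0 powr (1 / l) * (2 ^ i / CC) powr (- (1 / l - \<beta>))"
    proof (rule mult_left_mono)
      have "2 ^ i / CC \<le> G.T (q i)" using q[OF i] CC by (simp add: field_simps)
      then show "G.T (q i) powr (- (1 / l - \<beta>)) \<le> (2 ^ i / CC) powr (- (1 / l - \<beta>))"
        using CC \<beta> by (intro powr_mono2') auto
    qed (use CC in auto)
    also have "(2 ^ i / CC) powr (- (1 / l - \<beta>)) = CC powr (1 / l - \<beta>) * \<phi> ^ i"
    proof -
      have "(2 ^ i / CC) powr (- (1 / l - \<beta>)) = (2 ^ i) powr (- (1 / l - \<beta>)) / CC powr (- (1 / l - \<beta>))"
        using CC by (simp add: powr_divide)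
      also have "(2 ^ i) powr (- (1 / l - \<beta>)) = \<phi> ^ i"
        by (simp add: \<phi>_def powr_power powr_powr mult.commute flip: powr_realpow)
      also have "1 / CC powr (- (1 / l - \<beta>)) = CC powr (1 / l - \<beta>)"
        by (subst powr_minus) (simp add: divide_inverse)
      then have "\<phi> ^ i / CC powr (- (1 / l - \<beta>)) = CC powr (1 / l - \<beta>) * \<phi> ^ i"
        by (metis mult.commute mult.right_neutral times_divide_eq_right)
      finally show ?thesis .
    qed
    finally show ?thesis by (simp add: K7_def mult_ac)
  qed
  have tsum: "summable (\<lambda>i. K7 * \<phi> ^ i)" using \<phi> by (intro summable_mult summable_geometric) auto
  have Rlim: "\<exists>j\<ge>i0. R j \<le> w" if "0 < w" for w
  proof -
    have "eventually (\<lambda>i. K7 * \<phi> ^ i < w) sequentially"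
      using summable_LIMSEQ_zero[OF tsum] that by (intro order_tendstoD) auto
    then obtain j where j: "\<And>i. i \<ge> j \<Longrightarrow> K7 * \<phi> ^ i < w" by (auto simp: eventually_sequentially)
    define i where "i = max j i0"
    have i: "1 \<le> i" "i \<ge> j" "i \<ge> i0" using i0 by (auto simp: i_def)
    have "1 * R i \<le> real (Suc (q i)) * R i" using R(1)[OF i(1)] by (intro mult_right_mono) auto
    also have "\<dots> \<le> K7 * \<phi> ^ i" by (rule tR[OF i(1)])
    also have "\<dots> < w" by (rule j[OF i(2)])
    finally show ?thesis using i by auto
  qed
  have "inducible \<Theta> (Delta c s \<delta>)" if \<delta>: "0 < \<delta>" "\<delta> \<le> min \<rho> (R i0)" for \<delta>
  proof -
    define r where "r x = s * (x - c)" for x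
    \<comment> \<open>Truncation at \<delta> lets the construction serve every smaller
      neighbourhood, which is needed for a common \<delta> on all sides. A shell may be
      empty.\<close>
    define I where "I i = {x. R (Suc i) < r x \<and> r x < min (R i) \<delta>}" for i
    have I_eq: "I i = (if s = 1 then {c + R (Suc i)<..<c + min (R i) \<delta>} else {c - min (R i) \<delta><..<c - R (Suc i)})" for i
      using cs by (auto simp: I_def r_def)
    have Dl: "x \<in> Delta c s \<delta> \<Longrightarrow> x \<in> Delta c s \<rho> \<and> 0 < r x \<and> r x < \<delta> \<and> \<bar>x - c\<bar> = r x" for x
      using cs \<delta> by (auto simp: Delta_def r_def)
    have I_sub: "I i \<subseteq> Delta c s \<delta>" if "1 \<le> i" for i
    proof
      fix x assume x: "x \<in> I i"
      have "0 < R (Suc i)" by (rule R) simp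
      then show "x \<in> Delta c s \<delta>" using x cs by (auto simp: I_def r_def Delta_iff)
    qed
    have br: "branch \<Theta> (I i) (Suc (q i)) (V i)" if i: "i0 \<le> i" for i
    proof -
      have i': "1 \<le> i" using i i0 by simp
      define n where "n = q i"
      have nT: "G.T n * R i powr l = e0" "0 < G.T n" using R(2)[OF i'] Tpos[OF i'] by (auto simp: n_def mult.commute)
      have Rs: "0 < R (Suc i)" by (rule R) simp
      have iJ: "is_interval (I i)" "open (I i)" by (auto simp: I_eq is_interval_1)
      have J: "0 < r x \<and> R (Suc i) < r x \<and> r x < R i \<and> \<bar>x - c\<bar> = r x \<and> x \<in> S \<and> N_bounds l K c s x" if "x \<in> I i" for x
      proof -
        have "x \<in> Delta c s \<delta>" using I_sub[OF i'] that by blast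
        then show ?thesis using that Dl[of x] N[of x] by (auto simp: I_def)
      qed
      have fxT: "K * r x powr l * G.T n \<le> \<epsilon>" if x: "x \<in> I i" for x
      proof -
        have "r x powr l \<le> R i powr l" using J[OF x] l by (intro powr_mono2) auto
        then have "K * r x powr l * G.T n \<le> K * R i powr l * G.T n"
          using K nT by (intro mult_right_mono mult_left_mono) auto
        also have "\<dots> = \<epsilon>" using nT K by (simp add: mult.assoc mult.commute[of "R i powr l"] e0_def)
        finally show ?thesis .
      qed
      have fx: "f x \<in> {a..b} \<and> \<bar>f x - v\<bar> * G.T n \<le> \<epsilon>" if x: "x \<in> I i" for x
      proof -
        have "\<bar>f x - v\<bar> \<le> K * r x powr l" using J[OF x] by (auto simp: N_bounds_def v_def)
        then have "\<bar>f x - v\<bar> * G.T n \<le> K * r x powr l * G.T n" using nT by (intro mult_right_mono) auto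
        then show ?thesis using fxT[OF x] J[OF x] maps by auto
      qed
      have bx: "\<And>j. j < n \<Longrightarrow> (f ^^ j) (f x) \<in> S \<and> d j / 2 \<le> dC ((f ^^ j) (f x))"
        "\<And>j. j \<le> n \<Longrightarrow> D j / 2 \<le> \<bar>Df j (f x)\<bar> \<and> \<bar>Df j (f x)\<bar> \<le> 2 * D j" if "x \<in> I i" for x
        using bind[of "f x" n] fx[OF that] by blast+
      have orb: "(f ^^ j) x \<in> S" if "x \<in> I i" "j < Suc n" for x j
      proof (cases j)
        case 0
        then show ?thesis using J that by simp
      next
        case (Suc m)
        then have "(f ^^ j) x = (f ^^ m) (f x)" by (simp add: funpow_swap1)
        then show ?thesis using bx(1)[OF that(1), of m] that Suc by simp
      qed
      have K0: "1 / \<bar>f1 x\<bar> \<le> K * r x powr (1 - l)" if "x \<in> I i" for x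
      proof -
        have "r x powr (l - 1) \<le> K * \<bar>f1 x\<bar>" using J[OF that] by (auto simp: N_bounds_def)
        moreover have "r x powr (1 - l) * r x powr (l - 1) = 1" using J[OF that] by (simp flip: powr_add)
        ultimately have "1 \<le> r x powr (1 - l) * (K * \<bar>f1 x\<bar>)"
          by (metis mult_left_mono powr_ge_zero)
        moreover have "f1 x \<noteq> 0" using f1_nz J[OF that] by blast
        ultimately show ?thesis by (simp add: field_simps)
      qed
      have Dinv: "\<bar>1 / Df (Suc n) x\<bar> \<le> 2 * K * r x powr (1 - l) / 2 ^ i" if x: "x \<in> I i" for x
      proof -
        have "2 ^ i \<le> D n" using q[OF i'] by (simp add: n_def)
        then have h: "2 ^ i / 2 \<le> \<bar>Df n (f x)\<bar>" using bx(2)[OF x, of n] by linarith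
        have "\<bar>1 / Df (Suc n) x\<bar> = (1 / \<bar>f1 x\<bar>) * (1 / \<bar>Df n (f x)\<bar>)" by (simp add: Df_Suc' abs_mult)
        also have "\<dots> \<le> (K * r x powr (1 - l)) * (1 / (2 ^ i / 2))"
          using K0[OF x] h K by (intro mult_mono divide_left_mono) (auto intro!: mult_pos_pos less_le_trans[OF _ h])
        finally show ?thesis by (simp add: mult_ac)
      qed
      have rR: "r x powr (1 - l) \<le> R (Suc i) powr (1 - l)" if "x \<in> I i" for x
        using J[OF that] Rs l by (intro powr_mono2') auto
      \<comment> \<open>The shadowing steps contribute at most 4 M T_n |f1(x)|. With |f1(x)| <= K
        r^(l-1) and K r^l T_n <= \<epsilon> this is of order 1/r, the same as the contribution f2/f1
        of the first step.\<close>
      have Lb: "\<bar>L (Suc n) x\<bar> \<le> K4 * r x powr (-1)" if x: "x \<in> I i" for x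
      proof -
        have r: "0 < r x" using J[OF x] by simp
        have "\<bar>L n (f x)\<bar> \<le> (\<Sum>j<n. \<bar>f2 ((f ^^ j) (f x)) / f1 ((f ^^ j) (f x)) * Df j (f x)\<bar>)"
          unfolding L_def by (rule sum_abs)
        also have "\<dots> \<le> (\<Sum>j<n. 4 * M * (D j / d j))"
        proof (rule sum_mono)
          fix j assume "j \<in> {..<n}"
          then have j: "j < n" by simp
          let ?y = "(f ^^ j) (f x)"
          have y: "?y \<in> S" "d j / 2 \<le> dC ?y" using bx(1)[OF x j] by auto
          have "d j / 2 * \<bar>f2 ?y\<bar> \<le> dC ?y * \<bar>f2 ?y\<bar>" using y by (intro mult_right_mono) auto
          also have "\<dots> \<le> M * \<bar>f1 ?y\<bar>" using M(3)[OF y(1)] by (simp add: mult.commute)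
          finally have "\<bar>f2 ?y / f1 ?y\<bar> \<le> 2 * M / d j"
            using f1_nz[OF y(1)] pos(1)[of j] by (simp add: field_simps abs_mult)
          then have "\<bar>f2 ?y / f1 ?y\<bar> * \<bar>Df j (f x)\<bar> \<le> 2 * M / d j * (2 * D j)"
            using bx(2)[OF x, of j] j pos(1)[of j] M by (intro mult_mono) auto
          then show "\<bar>f2 ?y / f1 ?y * Df j (f x)\<bar> \<le> 4 * M * (D j / d j)" by (simp add: abs_mult)
        qed
        also have "\<dots> = 4 * M * G.T n" by (simp add: G.T_def sum_distrib_left)
        finally have 1: "\<bar>L n (f x)\<bar> \<le> 4 * M * G.T n" .
        have nb: "\<bar>f1 x\<bar> \<le> K * r x powr (l - 1)" "\<bar>f2 x\<bar> \<le> K * r x powr (l - 2)"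
          using J[OF x] by (auto simp: N_bounds_def)
        have "\<bar>f1 x * L n (f x)\<bar> \<le> (K * r x powr (l - 1)) * (4 * M * G.T n)"
          unfolding abs_mult using 1 nb K by (intro mult_mono) auto
        also have "\<dots> = 4 * M * (K * r x powr l * G.T n) * r x powr (-1)"
          using r powr_add[of "r x" l "-1"] by (simp add: mult_ac)
        also have "\<dots> \<le> 4 * M * \<epsilon> * r x powr (-1)"
          using fxT[OF x] M by (intro mult_right_mono mult_left_mono) auto
        finally have 2: "\<bar>f1 x * L n (f x)\<bar> \<le> 4 * M * \<epsilon> * r x powr (-1)" .
        have "\<bar>f2 x / f1 x\<bar> = \<bar>f2 x\<bar> * (1 / \<bar>f1 x\<bar>)" by simp
        also have "\<dots> \<le> (K * r x powr (l - 2)) * (K * r x powr (1 - l))"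
          using nb K0[OF x] K by (intro mult_mono) auto
        also have "\<dots> = K * K * r x powr (-1)"
          using r powr_add[of "r x" "l - 2" "1 - l"] by (simp add: mult_ac)
        finally have 3: "\<bar>f2 x / f1 x\<bar> \<le> K * K * r x powr (-1)" .
        have "x \<in> S" using J[OF x] by simp
        then have "L (Suc n) x = f2 x / f1 x + f1 x * L n (f x)" by (rule L_Suc')
        then have "\<bar>L (Suc n) x\<bar> \<le> \<bar>f2 x / f1 x\<bar> + \<bar>f1 x * L n (f x)\<bar>" by (simp only: abs_triangle_ineq)
        then show ?thesis using 2 3 unfolding K4_def distrib_right by linarith
      qed
      define K8 where "K8 = 2 * K * K4 / 2 ^ i"
      have K8: "0 \<le> K8" using K K4 by (simp add: K8_def)
      \<comment> \<open>For l > 1 the primitive of r^(-l) is unbounded at c. On the shell r >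
        R(i+1), so R(i+1)^(1-l)/(l-1) bounds its modulus, and this shift makes \<open>h\<close>
        nonnegative.\<close>
      define h where "h x = K8 * (s * (r x powr (1 - l) / (1 - l)) + R (Suc i) powr (1 - l) / (l - 1))" for x
      have VR': "K5 * R (Suc i) powr (1 - l) / 2 ^ i \<le> V i" using VR[OF i'] by (simp add: V_def)
      show ?thesis unfolding branch_def n_def[symmetric]
      proof (intro conjI ballI iJ exI[of _ h] impI allI)
        fix x assume x: "x \<in> I i"
        show "(f ^^ j) x \<in> S" if "j < Suc n" for j by (rule orb[OF x that])
        have "\<bar>1 / Df (Suc n) x\<bar> \<le> 2 * K * r x powr (1 - l) / 2 ^ i" by (rule Dinv[OF x])
        also have "\<dots> \<le> K5 * R (Suc i) powr (1 - l) / 2 ^ i"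
          using K5 rR[OF x] by (intro divide_right_mono mult_mono) auto
        also note VR'
        finally show DV: "\<bar>1 / Df (Suc n) x\<bar> \<le> V i" .
        have "Df (Suc n) x \<noteq> 0" using orb[OF x] by (intro Df_nz) auto
        moreover have "\<bar>1 / Df (Suc n) x\<bar> \<le> 1 / \<Theta>" using DV i0(2)[OF i] by linarith
        ultimately show "\<Theta> \<le> \<bar>Df (Suc n) x\<bar>" using \<Theta> by (simp add: field_simps)
        have "\<bar>s * (r x powr (1 - l) / (1 - l))\<bar> = r x powr (1 - l) / (l - 1)"
          using cs l by (auto simp: abs_mult)
        also have "\<dots> \<le> R (Suc i) powr (1 - l) / (l - 1)" using rR[OF x] l by (intro divide_right_mono) auto
        finally have "\<bar>s * (r x powr (1 - l) / (1 - l))\<bar> \<le> R (Suc i) powr (1 - l) / (l - 1)" .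
        note hb = abs_le_shift[OF this]
        show "0 \<le> h x" unfolding h_def using K8 hb by simp
        have "h x \<le> K8 * (2 * (R (Suc i) powr (1 - l) / (l - 1)))" unfolding h_def using K8 hb by (intro mult_left_mono)
        also have "\<dots> = 4 * K * K4 / (l - 1) * R (Suc i) powr (1 - l) / 2 ^ i" by (simp add: K8_def mult_ac)
        also have "\<dots> \<le> K5 * R (Suc i) powr (1 - l) / 2 ^ i"
          using K5 by (intro divide_right_mono mult_right_mono) auto
        also note VR'
        finally show "h x \<le> V i" .
        fix y assume y: "y \<in> I i" "x < y"
        show "\<bar>1 / Df (Suc n) y - 1 / Df (Suc n) x\<bar> \<le> h y - h x"
        proof (rule derivative_dominated[OF iJ(1) x y])
          fix z assume z: "z \<in> I i"
          show "((\<lambda>x. 1 / Df (Suc n) x) has_real_derivative - (L (Suc n) z / Df (Suc n) z)) (at z within I i)"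
            by (rule inv_Df_deriv) (use orb z in auto)
          show "(h has_real_derivative K8 * r z powr (- l)) (at z within I i)"
            unfolding h_def[abs_def] r_def by (rule powr_antiderivative) (use cs J[OF z] l in \<open>auto simp: r_def\<close>)
          have r: "0 < r z" using J[OF z] by simp
          have "\<bar>- (L (Suc n) z / Df (Suc n) z)\<bar> = \<bar>L (Suc n) z\<bar> * \<bar>1 / Df (Suc n) z\<bar>" by simp
          also have "\<dots> \<le> (K4 * r z powr (-1)) * (2 * K * r z powr (1 - l) / 2 ^ i)"
            using Lb[OF z] Dinv[OF z] K4 by (intro mult_mono) auto
          also have "\<dots> = K8 * r z powr (- l)"
            using r powr_add[of "r z" "-1" "1 - l"] by (simp add: K8_def mult_ac)
          finally show "\<bar>- (L (Suc n) z / Df (Suc n) z)\<bar> \<le> K8 * r z powr (- l)" .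
        qed
      qed
    qed
    show ?thesis
    proof (rule inducibleI[where X = "{i0..}" and I = I and t = "\<lambda>i. Suc (q i)" and V = V])
      show "Delta c s \<delta> \<subseteq> {a..b}" using Dl N by (force intro: less_imp_le)
      show "I i \<subseteq> Delta c s \<delta> \<and> branch \<Theta> (I i) (Suc (q i)) (V i)" if "i \<in> {i0..}" for i
        using that i0 I_sub br by auto
      show "I i \<inter> I j = {}" if "i \<in> {i0..}" "j \<in> {i0..}" "i \<noteq> j" for i j
      proof -
        have *: "I i \<inter> I j = {}" if "i0 \<le> i" "i < j" for i j
        proof -
          have "R j \<le> R (Suc i)" using that i0 by (intro R_anti) auto
          then show ?thesis unfolding I_def by auto
        qed
        have "i < j \<or> j < i" using that(3) by linarith
        then show ?thesis using *[of i j] *[of j i] that(1,2) by auto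
      qed
      \<comment> \<open>Since R_j tends to 0, each point has a first index j with R_j <= r, and j >
        i0 because r < \<delta> <= R_i0. If the inequality were strict the point would lie in a
        shell, so only distances equal to some R_j are missed.\<close>
      have "Delta c s \<delta> - (\<Union>i\<in>{i0..}. I i) \<subseteq> range (\<lambda>i. c + s * R i)"
      proof
        fix x assume x: "x \<in> Delta c s \<delta> - (\<Union>i\<in>{i0..}. I i)"
        have w: "0 < r x" "r x < \<delta>" using Dl x by auto
        define j where "j = (LEAST j. i0 \<le> j \<and> R j \<le> r x)"
        have j: "i0 \<le> j \<and> R j \<le> r x" unfolding j_def by (rule LeastI_ex) (use Rlim[OF w(1)] in blast)
        have "j \<noteq> i0" using j w \<delta> by auto
        then obtain i where ji: "j = Suc i" "i0 \<le> i" using j by (cases j) auto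
        have "\<not> R i \<le> r x" using not_less_Least[of i "\<lambda>j. i0 \<le> j \<and> R j \<le> r x"] ji by (auto simp: j_def[symmetric])
        moreover have "x \<notin> I i" using x ji by auto
        ultimately have "r x = R j" using j ji w by (auto simp: I_def)
        then have "x = c + s * R j" using cs by (auto simp: r_def)
        then show "x \<in> range (\<lambda>i. c + s * R i)" by blast
      qed
      then show "countable (Delta c s \<delta> - (\<Union>i\<in>{i0..}. I i))" by (rule countable_subset) simp
      have V0: "0 \<le> V i" for i unfolding V_def K6_def using K5 \<theta> by (intro mult_nonneg_nonneg) auto
      have "V summable_on UNIV" using Vsum V0 by (intro norm_summable_imp_summable_on) auto
      then show "V summable_on {i0..}" by (rule summable_on_subset_banach) auto
      have K7: "0 \<le> K7" using CC by (simp add: K7_def)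
      have "(\<lambda>i. K7 * \<phi> ^ i) summable_on UNIV" using tsum K7 \<phi> by (intro norm_summable_imp_summable_on) auto
      then have "(\<lambda>i. K7 * \<phi> ^ i) summable_on {i0..}" by (rule summable_on_subset_banach) auto
      then show "(\<lambda>i. real (Suc (q i)) * measure lborel (I i)) summable_on {i0..}"
      proof (rule summable_on_comparison_test)
        fix i assume i: "i \<in> {i0..}"
        have i': "1 \<le> i" using i i0 by simp
        have "measure lborel (I i) \<le> R i"
          using R(1)[OF i'] R(1)[of "Suc i"] by (auto simp: I_eq measure_lborel_Ioo_le)
        then have "real (Suc (q i)) * measure lborel (I i) \<le> real (Suc (q i)) * R i" by (intro mult_left_mono) auto
        then show "real (Suc (q i)) * measure lborel (I i) \<le> K7 * \<phi> ^ i" using tR[OF i'] by linarith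
      qed auto
    qed simp
  qed
  then show ?thesis using \<rho> R(1)[OF i0(1)] by (intro exI[of _ "min \<rho> (R i0)"]) auto
qed

end

section \<open>Pulling back along free orbit segments\<close>

context cusp_map begin

text \<open>The value at a one-sided point is a limit that f may not attain; it lies in M because M
  is closed, so its forward orbit stays in M.\<close>

lemma side_val_mem:
  assumes "(c, s) \<in> sides a b Cc"
  shows "side_val f c s \<in> {a..b}"
proof -
  have c: "c \<in> {a..b}" "s = 1 \<and> c < b \<or> s = -1 \<and> a < c" using assms subC by (auto simp: sides_def)
  have "\<forall>(c, s)\<in>sides a b Cc. \<exists>L. (f \<longlongrightarrow> L) (side_filter c s)"
    using F unfolding in_class_F_def piecewise_C2_def by (elim conjE)
  from bspec[OF this assms] obtain l where l: "(f \<longlongrightarrow> l) (side_filter c s)" by auto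
  have nt: "side_filter c s \<noteq> bot" by (simp add: side_filter_def)
  have "eventually (\<lambda>x. x \<in> {a..b}) (side_filter c s)"
  proof (cases "s = 1")
    case True
    then have "c < b" using c by auto
    then show ?thesis using True c by (auto simp: side_filter_def eventually_at_right[of c b] intro!: exI[of _ b])
  next
    case False
    then have "a < c" using c by auto
    then show ?thesis using False c by (auto simp: side_filter_def eventually_at_left[of a c] intro!: exI[of _ a])
  qed
  then have "eventually (\<lambda>x. f x \<in> {a..b}) (side_filter c s)" by (rule eventually_mono) (rule maps)
  then have ev: "eventually (\<lambda>x. a \<le> f x) (side_filter c s)" "eventually (\<lambda>x. f x \<le> b) (side_filter c s)"
    by (auto elim: eventually_mono)
  have "a \<le> l" using tendsto_lowerbound[OF l ev(1) nt] .
  moreover have "l \<le> b" using tendsto_upperbound[OF l ev(2) nt] .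
  ultimately show ?thesis using tendsto_Lim[OF nt l] by (simp add: side_val_def)
qed

text \<open>The local results hold for all sufficiently small radii, and there are finitely many
  sides, so one \<delta> works for all; disjointness will allow their pulled-back partitions to be
  merged.\<close>

lemma near_inducible:
  assumes \<Theta>: "0 < \<Theta>"
  shows "\<exists>\<delta>>0. (\<forall>(c, s)\<in>sides a b Cc. inducible \<Theta> (Delta c s \<delta>)) \<and>
    (\<forall>\<sigma>\<in>sides a b Cc. \<forall>\<sigma>'\<in>sides a b Cc. \<sigma> \<noteq> \<sigma>' \<longrightarrow> Delta (fst \<sigma>) (snd \<sigma>) \<delta> \<inter> Delta (fst \<sigma>') (snd \<sigma>') \<delta> = {})"
proof -
  from side_constants obtain ord K \<rho> where \<rho>: "0 < \<rho>" "\<rho> \<le> 1" and K: "1 \<le> K" and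
    N0: "\<forall>(c, s)\<in>sides a b Cc. 0 < ord c s \<and> ord c s \<noteq> 1 \<and> (1 < ord c s \<longrightarrow> cond_star a b f Cc c s (ord c s)) \<and>
     (\<forall>x\<in>Delta c s \<rho>. a < x \<and> x < b \<and> x \<notin> Cc \<and> dC x = \<bar>x - c\<bar> \<and> N_bounds (ord c s) K c s x)"
    by (elim exE conjE) (rule that)
  have N: "0 < ord c s \<and> ord c s \<noteq> 1 \<and> (1 < ord c s \<longrightarrow> cond_star a b f Cc c s (ord c s)) \<and>
     (\<forall>x\<in>Delta c s \<rho>. a < x \<and> x < b \<and> x \<notin> Cc \<and> dC x = \<bar>x - c\<bar> \<and> N_bounds (ord c s) K c s x)"
    if "(c, s) \<in> sides a b Cc" for c s
    using bspec[OF N0 that] unfolding prod.case .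
  note fin = finite_sides
  have "\<exists>\<delta>0>0. \<forall>\<delta>. 0 < \<delta> \<and> \<delta> \<le> \<delta>0 \<longrightarrow> inducible \<Theta> (Delta c s \<delta>)" if cs: "(c, s) \<in> sides a b Cc" for c s
  proof -
    have s: "s = 1 \<or> s = -1" using cs by (auto simp: sides_def)
    note n = N[OF cs]
    have nb: "a < x \<and> x < b \<and> x \<notin> Cc \<and> N_bounds (ord c s) K c s x" if "x \<in> Delta c s \<rho>" for x
      using n that by blast
    show ?thesis
    proof (cases "1 < ord c s")
      case True
      then have star: "cond_star a b f Cc c s (ord c s)" using n by blast
      show ?thesis by (rule critical_inducible[OF s True K \<rho> nb side_val_mem[OF cs] star \<Theta>])
    next
      case False
      then have l: "0 < ord c s" "ord c s < 1" using n by auto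
      show ?thesis by (rule singular_inducible[OF s l K \<rho> nb \<Theta>])
    qed
  qed
  then have "\<forall>\<sigma>\<in>sides a b Cc. \<exists>\<delta>0>0. \<forall>\<delta>. 0 < \<delta> \<and> \<delta> \<le> \<delta>0 \<longrightarrow> inducible \<Theta> (Delta (fst \<sigma>) (snd \<sigma>) \<delta>)" by auto
  from bchoice[OF this] obtain e where e: "\<And>\<sigma>. \<sigma> \<in> sides a b Cc \<Longrightarrow> 0 < e \<sigma>"
     "\<And>\<sigma> \<delta>. \<sigma> \<in> sides a b Cc \<Longrightarrow> 0 < \<delta> \<Longrightarrow> \<delta> \<le> e \<sigma> \<Longrightarrow> inducible \<Theta> (Delta (fst \<sigma>) (snd \<sigma>) \<delta>)" by blast
  (* Half of \<rho> suffices to separate the one-sided neighbourhoods of distinct points: a common point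
     would be equidistant from both, putting one inside the \<rho>-neighbourhood of the other. *)
  define \<delta> where "\<delta> = Min (insert (\<rho> / 2) (e ` sides a b Cc))"
  have "\<delta> \<le> \<rho> / 2" unfolding \<delta>_def using fin by (intro Min_le) auto
  then have \<delta>: "0 < \<delta>" "\<delta> \<le> \<rho> / 2" "\<And>\<sigma>. \<sigma> \<in> sides a b Cc \<Longrightarrow> \<delta> \<le> e \<sigma>"
    using fin e(1) \<rho> by (auto simp: \<delta>_def)
  have sep: "x \<notin> Delta c' s' \<delta>" if "x \<in> Delta c s \<delta>" "(c, s) \<in> sides a b Cc" "(c', s') \<in> sides a b Cc" "c < c'" for x c s c' s'
  proof
    assume x': "x \<in> Delta c' s' \<delta>"
    have ss: "s = 1 \<or> s = -1" "s' = 1 \<or> s' = -1" using that by (auto simp: sides_def)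
    have "x \<in> Delta c s \<rho>" "x \<in> Delta c' s' \<rho>"
      using that(1) x' \<delta>(1,2) unfolding Delta_iff[OF ss(1)] Delta_iff[OF ss(2)] by auto
    then have "dC x = \<bar>x - c\<bar>" "dC x = \<bar>x - c'\<bar>"
      using N[OF that(2)] N[OF that(3)] by blast+
    then have "x - c = c' - x" using \<open>c < c'\<close> by auto
    moreover have "\<bar>x - c\<bar> < \<delta>" using that(1) ss by (auto simp: Delta_def split: if_splits)
    ultimately have "c' - c < \<rho>" "c < x" using \<delta> \<open>c < c'\<close> by auto
    then have "s = 1" using that(1) ss by (auto simp: Delta_def split: if_splits)
    then have "c' \<in> Delta c s \<rho>" using \<open>c' - c < \<rho>\<close> \<open>c < c'\<close> by (simp add: Delta_def)
    then have "c' \<notin> Cc" using N[OF that(2)] by blast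
    then show False using that(3) by (simp add: sides_def)
  qed
  have "Delta (fst \<sigma>) (snd \<sigma>) \<delta> \<inter> Delta (fst \<sigma>') (snd \<sigma>') \<delta> = {}"
    if "\<sigma> \<in> sides a b Cc" "\<sigma>' \<in> sides a b Cc" "\<sigma> \<noteq> \<sigma>'" for \<sigma> \<sigma>'
  proof -
    obtain c s c' s' where \<sigma>: "\<sigma> = (c, s)" "\<sigma>' = (c', s')" by fastforce
    have ss: "s = 1 \<or> s = -1" "s' = 1 \<or> s' = -1" using that \<sigma> by (auto simp: sides_def)
    have "c < c' \<or> c' < c \<or> c = c' \<and> s \<noteq> s'" using that(3) \<sigma> by auto
    then consider "c < c'" | "c' < c" | "c = c'" "s \<noteq> s'" by blast
    then show ?thesis
    proof cases
      case 1
      then show ?thesis using sep[of _ c s c' s'] that \<sigma> by auto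
    next
      case 2
      then show ?thesis using sep[of _ c' s' c s] that \<sigma> by auto
    next
      case 3
      then show ?thesis using ss \<sigma> by (auto simp: Delta_def)
    qed
  qed
  moreover have "inducible \<Theta> (Delta c s \<delta>)" if "(c, s) \<in> sides a b Cc" for c s
    using e(2)[OF that \<delta>(1) \<delta>(3)[OF that]] by simp
  ultimately show ?thesis using \<delta>(1) by blast
qed

section \<open>Monotonicity, preimages and lengths for smooth iterates on an interval\<close>

lemma iter_mean_value:
  assumes "is_interval J" "\<And>x j. x \<in> J \<Longrightarrow> j < m \<Longrightarrow> (f ^^ j) x \<in> S" "x \<in> J" "y \<in> J" "x < y"
  shows "\<exists>z\<in>J. (f ^^ m) y - (f ^^ m) x = Df m z * (y - x)"
proof -
  have sub: "{x..y} \<subseteq> J" using assms by (meson atLeastAtMost_iff mem_is_interval_1_I subsetI)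
  have "\<exists>z\<in>{x<..<y}. (f ^^ m) y - (f ^^ m) x = (\<lambda>t. Df m z * t) (y - x)"
  proof (rule mvt_simple[OF \<open>x < y\<close>, where f' = "\<lambda>z t. Df m z * t"])
    fix z assume "x \<le> z" "z \<le> y"
    then have "z \<in> J" using sub by (meson atLeastAtMost_iff subsetD)
    then have "((f ^^ m) has_real_derivative Df m z) (at z within {x..y})"
      using DERIV_subset[OF iter_deriv[of J m z] sub] assms(2) by blast
    then show "((f ^^ m) has_derivative (\<lambda>t. Df m z * t)) (at z within {x..y})"
      by (simp add: has_field_derivative_def)
  qed
  then show ?thesis using sub by force
qed

text \<open>\<open>Df m\<close> is continuous without zeros on \<open>J\<close>, so connectedness
  gives it a constant sign.\<close>

lemma iter_monotone:
  assumes J: "is_interval J" and S: "\<And>x j. x \<in> J \<Longrightarrow> j < m \<Longrightarrow> (f ^^ j) x \<in> S"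
  shows "(\<forall>x\<in>J. \<forall>y\<in>J. x < y \<longrightarrow> (f ^^ m) x < (f ^^ m) y) \<or> (\<forall>x\<in>J. \<forall>y\<in>J. x < y \<longrightarrow> (f ^^ m) y < (f ^^ m) x)"
proof -
  have nz: "Df m x \<noteq> 0" if "x \<in> J" for x using Df_nz S that by blast
  have "continuous_on J (Df m)"
    unfolding continuous_on_eq_continuous_within using DERIV_continuous[OF Df_deriv[of J m]] S by blast
  then have "connected (Df m ` J)" using is_interval_connected[OF J] by (rule connected_continuous_image)
  then have "is_interval (Df m ` J)" by (simp add: is_interval_connected_1)
  then have "(\<forall>x\<in>J. 0 < Df m x) \<or> (\<forall>x\<in>J. Df m x < 0)"
    using nz mem_is_interval_1_I[of "Df m ` J" _ _ 0] by (smt (verit, best) imageE imageI)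
  then show ?thesis
  proof
    assume *: "\<forall>x\<in>J. 0 < Df m x"
    have "(f ^^ m) x < (f ^^ m) y" if xy: "x \<in> J" "y \<in> J" "x < y" for x y
    proof -
      obtain z where z: "z \<in> J" "(f ^^ m) y - (f ^^ m) x = Df m z * (y - x)" using iter_mean_value[OF J S xy] by blast
      then have "0 < Df m z * (y - x)" using * xy by (intro mult_pos_pos) auto
      then show ?thesis using z by linarith
    qed
    then show ?thesis by blast
  next
    assume *: "\<forall>x\<in>J. Df m x < 0"
    have "(f ^^ m) y < (f ^^ m) x" if xy: "x \<in> J" "y \<in> J" "x < y" for x y
    proof -
      obtain z where z: "z \<in> J" "(f ^^ m) y - (f ^^ m) x = Df m z * (y - x)" using iter_mean_value[OF J S xy] by blast
      then have "Df m z * (y - x) < 0" using * xy by (intro mult_neg_pos) auto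
      then show ?thesis using z by linarith
    qed
    then show ?thesis by blast
  qed
qed

lemma iter_inj:
  assumes "is_interval J" "\<And>x j. x \<in> J \<Longrightarrow> j < m \<Longrightarrow> (f ^^ j) x \<in> S"
  shows "inj_on (f ^^ m) J"
proof (rule inj_onI, rule ccontr)
  fix x y assume "x \<in> J" "y \<in> J" "(f ^^ m) x = (f ^^ m) y" "x \<noteq> y"
  then show False using iter_monotone[OF assms] by (cases "x < y") (force simp: not_less)+
qed

lemma iter_preimage:
  assumes J: "open J" "is_interval J" and S: "\<And>x j. x \<in> J \<Longrightarrow> j < m \<Longrightarrow> (f ^^ j) x \<in> S"
    and W: "open W" "is_interval W"
  shows "open (J \<inter> (f ^^ m) -` W)" "is_interval (J \<inter> (f ^^ m) -` W)"
proof -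
  have "continuous_on J (f ^^ m)"
    unfolding continuous_on_eq_continuous_within using DERIV_continuous[OF iter_deriv[of J m]] S by blast
  then show "open (J \<inter> (f ^^ m) -` W)" using J W by (intro continuous_open_preimage)
  show "is_interval (J \<inter> (f ^^ m) -` W)"
    unfolding is_interval_1
  proof (intro ballI allI impI)
    fix x z y assume xz: "x \<in> J \<inter> (f ^^ m) -` W" "z \<in> J \<inter> (f ^^ m) -` W" and "x \<le> y \<and> y \<le> z"
    then have y: "x \<le> y" "y \<le> z" by auto
    have yJ: "y \<in> J" using J(2) xz y mem_is_interval_1_I[of J x z y] by auto
    have W': "w \<in> W" if "p \<in> W" "q \<in> W" "p \<le> w" "w \<le> q" for p q w
      using W(2) that mem_is_interval_1_I[of W p q w] by auto
    have "(f ^^ m) y \<in> W"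
    proof (cases "x = y \<or> y = z")
      case False
      then have lt: "x < y" "y < z" using y by auto
      from iter_monotone[OF J(2) S] show ?thesis
      proof
        assume "\<forall>x\<in>J. \<forall>y\<in>J. x < y \<longrightarrow> (f ^^ m) x < (f ^^ m) y"
        then have "(f ^^ m) x < (f ^^ m) y" "(f ^^ m) y < (f ^^ m) z" using lt xz yJ by auto
        then show ?thesis by (intro W'[of "(f ^^ m) x" "(f ^^ m) z" "(f ^^ m) y"]) (use xz in \<open>simp_all add: less_imp_le\<close>)
      next
        assume "\<forall>x\<in>J. \<forall>y\<in>J. x < y \<longrightarrow> (f ^^ m) y < (f ^^ m) x"
        then have "(f ^^ m) y < (f ^^ m) x" "(f ^^ m) z < (f ^^ m) y" using lt xz yJ by auto
        then show ?thesis by (intro W'[of "(f ^^ m) z" "(f ^^ m) x" "(f ^^ m) y"]) (use xz in \<open>simp_all add: less_imp_le\<close>)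
      qed
    qed (use xz in auto)
    then show "y \<in> J \<inter> (f ^^ m) -` W" using yJ by simp
  qed
qed

lemma measure_preimage_le:
  assumes I: "open I" "is_interval I" "I \<subseteq> {a..b}" "I \<noteq> {}" and W: "open W" "is_interval W" "W \<subseteq> {a..b}"
    and S: "\<And>x j. x \<in> I \<Longrightarrow> j < m \<Longrightarrow> (f ^^ j) x \<in> S" and im: "\<And>x. x \<in> I \<Longrightarrow> (f ^^ m) x \<in> W"
    and k: "0 < k" "\<And>x. x \<in> I \<Longrightarrow> k \<le> \<bar>Df m x\<bar>"
  shows "measure lborel I \<le> measure lborel W / k"
proof -
  have "W \<noteq> {}" using I im by blast
  then obtain p q where pq: "p < q" "W = {p<..<q}" using open_interval_form W by blast
  obtain u v where uv: "u < v" "I = {u<..<v}" using open_interval_form I by blast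
  have "v - u \<le> (q - p) / k"
  proof (rule ccontr)
    assume n: "\<not> v - u \<le> (q - p) / k"
    \<comment> \<open>The mean value theorem needs points inside the open interval; after moving
      both endpoints inwards by \<open>h\<close>, their distance still exceeds (q-p)/k by
      2h.\<close>
    define h where "h = (v - u - (q - p) / k) / 4"
    have "0 < (q - p) / k" using k pq by simp
    then have h: "0 < h" "4 * h = v - u - (q - p) / k" using n by (auto simp: h_def)
    have "4 * h < v - u" using h \<open>0 < (q - p) / k\<close> by linarith
    then have x: "u + h \<in> I" "v - h \<in> I" "u + h < v - h" using uv h by auto
    obtain z where z: "z \<in> I" "(f ^^ m) (v - h) - (f ^^ m) (u + h) = Df m z * (v - h - (u + h))"
      using iter_mean_value[OF I(2) S x] by blast
    have "(q - p) / k < v - h - (u + h)" using h by linarith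
    then have "q - p < k * (v - h - (u + h))" using k by (simp add: field_simps)
    also have "\<dots> \<le> \<bar>Df m z\<bar> * (v - h - (u + h))" using k(2)[OF z(1)] x by (intro mult_right_mono) auto
    also have "\<dots> = \<bar>(f ^^ m) (v - h) - (f ^^ m) (u + h)\<bar>" using z x by (simp add: abs_mult)
    also have "\<dots> < q - p" using im[OF x(1)] im[OF x(2)] pq by auto
    finally show False .
  qed
  then show ?thesis using uv pq by simp
qed

section \<open>Free orbit segments and pulled-back partitions\<close>

definition far :: "real \<Rightarrow> nat \<Rightarrow> real set \<Rightarrow> bool" where
  "far \<delta> m J \<longleftrightarrow> open J \<and> is_interval J \<and> J \<subseteq> {a..b} \<and> (\<forall>x\<in>J. \<forall>j<m. \<forall>c\<in>Cc. \<delta> < \<bar>(f ^^ j) x - c\<bar>)"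

lemma far_Z: "far \<delta> m J \<Longrightarrow> x \<in> J \<Longrightarrow> j < m \<Longrightarrow> (f ^^ j) x \<in> Z \<delta>"
  unfolding far_def Z_def using iter_maps by (auto simp: less_imp_le)

lemma far_S: "0 < \<delta> \<Longrightarrow> far \<delta> m J \<Longrightarrow> x \<in> J \<Longrightarrow> j < m \<Longrightarrow> (f ^^ j) x \<in> S"
  using far_Z Z_subset by blast

text \<open>Free orbits stay in the compact set \<open>Z \<delta>\<close>, where \<open>f1\<close>,
  \<open>1 / f1\<close> and \<open>f2\<close> have a common bound A. For fixed m this bounds 1/Df^m
  and its derivative by a constant that does not depend on \<open>J\<close>.\<close>

lemma far_lipschitz:
  assumes \<delta>: "0 < \<delta>"
  shows "\<exists>\<Lambda>\<ge>0. \<forall>J. far \<delta> m J \<longrightarrow> (\<forall>x\<in>J. \<bar>1 / Df m x\<bar> \<le> \<Lambda>) \<and>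
    (\<forall>x\<in>J. \<forall>y\<in>J. x < y \<longrightarrow> \<bar>1 / Df m y - 1 / Df m x\<bar> \<le> \<Lambda> * (y - x))"
proof -
  obtain A where A: "1 \<le> A" "\<And>x. x \<in> Z \<delta> \<Longrightarrow> \<bar>f1 x\<bar> \<le> A \<and> 1 / A \<le> \<bar>f1 x\<bar> \<and> \<bar>f2 x\<bar> \<le> A"
    using far_bounds[OF \<delta>] by blast
  define \<Lambda> where "\<Lambda> = A ^ m + A ^ m * (\<Sum>j<m. A * A * A ^ j)"
  have "(\<forall>x\<in>J. \<bar>1 / Df m x\<bar> \<le> \<Lambda>) \<and> (\<forall>x\<in>J. \<forall>y\<in>J. x < y \<longrightarrow> \<bar>1 / Df m y - 1 / Df m x\<bar> \<le> \<Lambda> * (y - x))"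
    if J: "far \<delta> m J" for J
  proof -
    have b: "\<bar>f1 ((f ^^ j) x)\<bar> \<le> A" "1 / A \<le> \<bar>f1 ((f ^^ j) x)\<bar>" "\<bar>f2 ((f ^^ j) x)\<bar> \<le> A" if "x \<in> J" "j < m" for x j
      using A(2)[OF far_Z[OF J that]] by auto
    have b': "1 / \<bar>f1 ((f ^^ j) x)\<bar> \<le> A" if "x \<in> J" "j < m" for x j
    proof -
      have "0 < 1 / A" using A by simp
      then have "0 < \<bar>f1 ((f ^^ j) x)\<bar>" using b(2)[OF that] by linarith
      then show ?thesis using b(2)[OF that] A by (simp add: field_simps)
    qed
    have up: "\<bar>Df n x\<bar> \<le> A ^ n" if "x \<in> J" "n \<le> m" for x n
      using that(2)
    proof (induction n)
      case (Suc n)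
      then have "\<bar>Df n x\<bar> * \<bar>f1 ((f ^^ n) x)\<bar> \<le> A ^ n * A"
        using b(1)[OF that(1), of n] A by (intro mult_mono) auto
      then show ?case by (simp add: Df_Suc abs_mult mult.commute)
    qed simp
    have dn: "\<bar>1 / Df n x\<bar> \<le> A ^ n" if "x \<in> J" "n \<le> m" for x n
      using that(2)
    proof (induction n)
      case (Suc n)
      then have "\<bar>1 / Df n x\<bar> * (1 / \<bar>f1 ((f ^^ n) x)\<bar>) \<le> A ^ n * A"
        using b'[OF that(1), of n] A by (intro mult_mono) auto
      then show ?case by (simp add: Df_Suc abs_mult mult.commute)
    qed simp
    have Lb: "\<bar>L m x\<bar> \<le> (\<Sum>j<m. A * A * A ^ j)" if "x \<in> J" for x
    proof -
      have "\<bar>L m x\<bar> \<le> (\<Sum>j<m. \<bar>f2 ((f ^^ j) x) / f1 ((f ^^ j) x) * Df j x\<bar>)" unfolding L_def by (rule sum_abs)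
      also have "\<dots> \<le> (\<Sum>j<m. A * A * A ^ j)"
      proof (rule sum_mono)
        fix j assume "j \<in> {..<m}"
        then have j: "j < m" by simp
        have "\<bar>f2 ((f ^^ j) x)\<bar> * (1 / \<bar>f1 ((f ^^ j) x)\<bar>) * \<bar>Df j x\<bar> \<le> A * A * A ^ j"
          using b(3)[OF that j] b'[OF that j] up[OF that, of j] j A by (intro mult_mono) auto
        then show "\<bar>f2 ((f ^^ j) x) / f1 ((f ^^ j) x) * Df j x\<bar> \<le> A * A * A ^ j" by (simp add: abs_mult)
      qed
      finally show ?thesis .
    qed
    have \<Lambda>1: "A ^ m \<le> \<Lambda>" "A ^ m * (\<Sum>j<m. A * A * A ^ j) \<le> \<Lambda>"
      using A by (auto simp: \<Lambda>_def intro!: mult_nonneg_nonneg sum_nonneg)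
    have "\<bar>1 / Df m y - 1 / Df m x\<bar> \<le> \<Lambda> * (y - x)" if xy: "x \<in> J" "y \<in> J" "x < y" for x y
    proof -
      have iJ: "is_interval J" using J by (simp add: far_def)
      have "\<bar>1 / Df m y - 1 / Df m x\<bar> \<le> \<Lambda> * y - \<Lambda> * x"
      proof (rule derivative_dominated[OF iJ xy])
        fix z assume z: "z \<in> J"
        show "((\<lambda>x. 1 / Df m x) has_real_derivative - (L m z / Df m z)) (at z within J)"
          by (rule inv_Df_deriv) (use far_S[OF \<delta> J] z in auto)
        show "((*) \<Lambda> has_real_derivative \<Lambda>) (at z within J)" by (auto intro!: derivative_eq_intros)
        have "\<bar>- (L m z / Df m z)\<bar> = \<bar>1 / Df m z\<bar> * \<bar>L m z\<bar>" by simp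
        also have "\<dots> \<le> A ^ m * (\<Sum>j<m. A * A * A ^ j)"
          using dn[OF z, of m] Lb[OF z] A by (intro mult_mono) auto
        also have "\<dots> \<le> \<Lambda>" by (rule \<Lambda>1)
        finally show "\<bar>- (L m z / Df m z)\<bar> \<le> \<Lambda>" .
      qed
      then show ?thesis by (simp add: right_diff_distrib)
    qed
    moreover have "\<bar>1 / Df m x\<bar> \<le> \<Lambda>" if "x \<in> J" for x using dn[OF that, of m] \<Lambda>1 by simp
    ultimately show ?thesis by blast
  qed
  moreover have "0 \<le> \<Lambda>" using A by (auto simp: \<Lambda>_def intro!: add_nonneg_nonneg mult_nonneg_nonneg sum_nonneg)
  ultimately show ?thesis by blast
qed

text \<open>The reciprocal derivative of the composite is a product, so its oscillation is at most
  \<Lambda> V (y-x) from the free factor plus 1/k times the oscillation of the pulled-back branch.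
  The bounds V therefore grow by one constant, lengths by at most 1/k, and expansion falls by at
  most k.\<close>

lemma inducible_pull:
  assumes \<delta>: "0 < \<delta>" and J: "far \<delta> m J" and B: "inducible \<Theta> B"
    and k: "0 < k" "\<And>x. x \<in> J \<Longrightarrow> (f ^^ m) x \<in> B \<Longrightarrow> k \<le> \<bar>Df m x\<bar>" and \<Theta>: "1 < \<Theta>" "\<Theta>' \<le> k * \<Theta>"
  shows "inducible \<Theta>' (J \<inter> (f ^^ m) -` B)"
proof -
  obtain P t V where Bab: "B \<subseteq> {a..b}" and P: "countable P" "pairwise disjnt P"
     "\<And>I. I \<in> P \<Longrightarrow> I \<noteq> {} \<and> I \<subseteq> B \<and> branch \<Theta> I (t I) (V I)" "countable (B - \<Union>P)"
     "V summable_on P" "(\<lambda>I. real (t I) * measure lborel I) summable_on P"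
    using B unfolding inducible_def by (elim conjE exE) blast
  from far_lipschitz[OF \<delta>, of m] obtain \<Lambda> where \<Lambda>1: "0 \<le> \<Lambda>" and
    "\<forall>J. far \<delta> m J \<longrightarrow> (\<forall>x\<in>J. \<bar>1 / Df m x\<bar> \<le> \<Lambda>) \<and>
      (\<forall>x\<in>J. \<forall>y\<in>J. x < y \<longrightarrow> \<bar>1 / Df m y - 1 / Df m x\<bar> \<le> \<Lambda> * (y - x))"
    by (elim exE conjE) (rule that)
  with J have \<Lambda>2: "\<forall>x\<in>J. \<forall>y\<in>J. x < y \<longrightarrow> \<bar>1 / Df m y - 1 / Df m x\<bar> \<le> \<Lambda> * (y - x)" by simp
  have \<Lambda>: "0 \<le> \<Lambda>" "\<bar>1 / Df m y - 1 / Df m x\<bar> \<le> \<Lambda> * (y - x)" if "x \<in> J" "y \<in> J" "x < y" for x y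
    using \<Lambda>1 \<Lambda>2 that by auto
  have J': "open J" "is_interval J" "J \<subseteq> {a..b}" using J by (auto simp: far_def)
  have S: "(f ^^ j) x \<in> S" if "x \<in> J" "j < m" for x j using far_S[OF \<delta> J that] .
  define Q where "Q W = J \<inter> (f ^^ m) -` W" for W
  define C where "C = \<Lambda> * (b - a) + 1 / k"
  have QW: "open (Q W)" "is_interval (Q W)" if "W \<in> P" for W
    unfolding Q_def using iter_preimage[OF J'(1,2) S] P(3)[OF that] by (auto simp: branch_def)
  have V0: "0 \<le> V W" if W: "W \<in> P" for W
  proof -
    obtain x where "x \<in> W" using P(3)[OF W] by blast
    then have "\<bar>1 / Df (t W) x\<bar> \<le> V W" using P(3)[OF W] unfolding branch_def by blast
    then show ?thesis by linarith
  qed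
  have br: "branch \<Theta>' (Q W) (m + t W) (C * V W)" if W: "W \<in> P" for W
  proof -
    have pW: "W \<subseteq> B" "branch \<Theta> W (t W) (V W)" using P(3)[OF W] by auto
    then obtain H where H: "\<And>x. x \<in> W \<Longrightarrow> 0 \<le> H x \<and> H x \<le> V W"
      "\<And>x y. x \<in> W \<Longrightarrow> y \<in> W \<Longrightarrow> x < y \<Longrightarrow> \<bar>1 / Df (t W) y - 1 / Df (t W) x\<bar> \<le> H y - H x"
      unfolding branch_def by blast
    have tW: "\<And>j. j < t W \<Longrightarrow> (f ^^ j) y \<in> S" "\<Theta> \<le> \<bar>Df (t W) y\<bar>" "\<bar>1 / Df (t W) y\<bar> \<le> V W" if "y \<in> W" for y
      using pW(2) that unfolding branch_def by blast+
    have kx: "k \<le> \<bar>Df m x\<bar>" "\<bar>1 / Df m x\<bar> \<le> 1 / k" if "x \<in> Q W" for x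
    proof -
      show 1: "k \<le> \<bar>Df m x\<bar>" using that pW k(2) by (auto simp: Q_def)
      then have "1 / \<bar>Df m x\<bar> \<le> 1 / k" using k by (intro divide_left_mono) auto
      then show "\<bar>1 / Df m x\<bar> \<le> 1 / k" by simp
    qed
    \<comment> \<open>A majorant has to increase with x, so H is replaced by V - H when f^m reverses
      orientation.\<close>
    have "\<exists>G. (\<forall>x\<in>J. (f ^^ m) x \<in> W \<longrightarrow> 0 \<le> G x \<and> G x \<le> V W) \<and>
      (\<forall>x\<in>J. \<forall>y\<in>J. x < y \<longrightarrow> (f ^^ m) x \<in> W \<longrightarrow> (f ^^ m) y \<in> W \<longrightarrow>
        \<bar>1 / Df (t W) ((f ^^ m) y) - 1 / Df (t W) ((f ^^ m) x)\<bar> \<le> G y - G x)"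
      using iter_monotone[OF J'(2) S]
    proof
      assume mono: "\<forall>x\<in>J. \<forall>y\<in>J. x < y \<longrightarrow> (f ^^ m) x < (f ^^ m) y"
      then show ?thesis using H by (intro exI[of _ "\<lambda>x. H ((f ^^ m) x)"]) blast
    next
      assume mono: "\<forall>x\<in>J. \<forall>y\<in>J. x < y \<longrightarrow> (f ^^ m) y < (f ^^ m) x"
      have "\<bar>1 / Df (t W) ((f ^^ m) y) - 1 / Df (t W) ((f ^^ m) x)\<bar> \<le> (V W - H ((f ^^ m) y)) - (V W - H ((f ^^ m) x))"
        if "x \<in> J" "y \<in> J" "x < y" "(f ^^ m) x \<in> W" "(f ^^ m) y \<in> W" for x y
        using H(2)[of "(f ^^ m) y" "(f ^^ m) x"] mono that by (simp add: abs_minus_commute)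
      moreover have "0 \<le> V W - H ((f ^^ m) x) \<and> V W - H ((f ^^ m) x) \<le> V W" if "(f ^^ m) x \<in> W" for x
        using H(1)[OF that] by linarith
      ultimately show ?thesis by (intro exI[of _ "\<lambda>x. V W - H ((f ^^ m) x)"]) blast
    qed
    then obtain G where G: "\<And>x. x \<in> Q W \<Longrightarrow> 0 \<le> G x \<and> G x \<le> V W"
      "\<And>x y. x \<in> Q W \<Longrightarrow> y \<in> Q W \<Longrightarrow> x < y \<Longrightarrow>
        \<bar>1 / Df (t W) ((f ^^ m) y) - 1 / Df (t W) ((f ^^ m) x)\<bar> \<le> G y - G x"
      unfolding Q_def by blast
    define H' where "H' x = \<Lambda> * V W * (x - a) + G x / k" for x
    have D: "1 / Df (m + t W) x = (1 / Df m x) * (1 / Df (t W) ((f ^^ m) x))" for x by (simp add: Df_add)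
    show ?thesis unfolding branch_def
    proof (intro conjI ballI QW[OF W] exI[of _ H'] impI allI)
      fix x assume x: "x \<in> Q W"
      have xJ: "x \<in> J" "(f ^^ m) x \<in> W" "x \<in> {a..b}" using x J' by (auto simp: Q_def)
      show "(f ^^ j) x \<in> S" if j: "j < m + t W" for j
      proof (cases "j < m")
        case True
        then show ?thesis using S xJ by blast
      next
        case False
        have "(f ^^ j) x = (f ^^ ((j - m) + m)) x" using False by simp
        also have "\<dots> = (f ^^ (j - m)) ((f ^^ m) x)" unfolding funpow_add by simp
        finally show ?thesis using tW(1)[OF xJ(2), of "j - m"] j False by auto
      qed
      have "\<Theta>' \<le> k * \<Theta>" by (rule \<Theta>)
      also have "\<dots> \<le> \<bar>Df m x\<bar> * \<bar>Df (t W) ((f ^^ m) x)\<bar>"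
        using kx[OF x] tW(2)[OF xJ(2)] k \<Theta> by (intro mult_mono) auto
      finally show "\<Theta>' \<le> \<bar>Df (m + t W) x\<bar>" by (simp add: Df_add abs_mult)
      have ab0: "0 \<le> \<Lambda> * (b - a) * V W" using \<Lambda>1 V0[OF W] ab by simp
      have "\<bar>1 / Df (m + t W) x\<bar> \<le> (1 / k) * V W"
        unfolding D abs_mult using kx[OF x] tW(3)[OF xJ(2)] k by (intro mult_mono) auto
      then show "\<bar>1 / Df (m + t W) x\<bar> \<le> C * V W" using ab0 unfolding C_def distrib_right by linarith
      show "0 \<le> H' x" using G(1)[OF x] xJ \<Lambda>1 V0[OF W] k by (auto simp: H'_def)
      have "\<Lambda> * V W * (x - a) \<le> \<Lambda> * V W * (b - a)" using \<Lambda>1 V0[OF W] xJ by (intro mult_left_mono) auto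
      moreover have "G x / k \<le> V W / k" using G(1)[OF x] k by (intro divide_right_mono) auto
      ultimately show "H' x \<le> C * V W" by (simp add: H'_def C_def algebra_simps)
      fix y assume y: "y \<in> Q W" "x < y"
      have yJ: "y \<in> J" "(f ^^ m) y \<in> W" using y by (auto simp: Q_def)
      let ?u = "\<lambda>x. 1 / Df m x" and ?w = "\<lambda>x. 1 / Df (t W) ((f ^^ m) x)"
      have "1 / Df (m + t W) y - 1 / Df (m + t W) x = (?u y - ?u x) * ?w x + ?u y * (?w y - ?w x)"
        unfolding D by (simp add: algebra_simps)
      then have "\<bar>1 / Df (m + t W) y - 1 / Df (m + t W) x\<bar> \<le> \<bar>?u y - ?u x\<bar> * \<bar>?w x\<bar> + \<bar>?u y\<bar> * \<bar>?w y - ?w x\<bar>"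
        by (metis abs_mult abs_triangle_ineq)
      also have "\<dots> \<le> (\<Lambda> * (y - x)) * V W + (1 / k) * (G y - G x)"
        using \<Lambda>1 \<Lambda>(2)[OF xJ(1) yJ(1) y(2)] tW(3)[OF xJ(2)] kx[OF y(1)] G(2)[OF x y] y k
        by (intro add_mono mult_mono) auto
      also have "\<dots> = H' y - H' x" by (simp add: H'_def algebra_simps diff_divide_distrib)
      finally show "\<bar>1 / Df (m + t W) y - 1 / Df (m + t W) x\<bar> \<le> H' y - H' x" .
    qed
  qed
  show ?thesis
  proof (rule inducibleI[where X = P and I = Q and t = "\<lambda>W. m + t W" and V = "\<lambda>W. C * V W"])
    show "J \<inter> (f ^^ m) -` B \<subseteq> {a..b}" using J' by auto
    show "Q W \<subseteq> J \<inter> (f ^^ m) -` B \<and> branch \<Theta>' (Q W) (m + t W) (C * V W)" if "W \<in> P" for W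
      using br[OF that] P(3)[OF that] by (auto simp: Q_def)
    show "Q W \<inter> Q W' = {}" if "W \<in> P" "W' \<in> P" "W \<noteq> W'" for W W'
      using P(2) that by (auto simp: Q_def pairwise_def disjnt_def)
    have "inj_on (f ^^ m) ((f ^^ m) -` (B - \<Union>P) \<inter> J)"
      using iter_inj[OF J'(2) S] by (rule inj_on_subset) auto
    moreover have "countable ((f ^^ m) ` ((f ^^ m) -` (B - \<Union>P) \<inter> J))"
      using P(4) by (rule countable_subset[rotated]) auto
    ultimately have "countable ((f ^^ m) -` (B - \<Union>P) \<inter> J)" by (rule countable_image_inj_on[rotated])
    then show "countable (J \<inter> (f ^^ m) -` B - (\<Union>W\<in>P. Q W))"
      by (rule countable_subset[rotated]) (auto simp: Q_def)
    show "(\<lambda>W. C * V W) summable_on P" using P(5) by (rule summable_on_cmult_right)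
    have "(\<lambda>W. (real m + 1) * (1 / k * (real (t W) * measure lborel W))) summable_on P"
      using P(6) by (intro summable_on_cmult_right)
    then show "(\<lambda>W. real (m + t W) * measure lborel (Q W)) summable_on P"
    proof (rule summable_on_comparison_test)
      fix W assume W: "W \<in> P"
      have pW: "W \<noteq> {}" "W \<subseteq> B" "branch \<Theta> W (t W) (V W)" using P(3)[OF W] by auto
      \<comment> \<open>Because \<open>Df 0\<close> is 1 and \<Theta> > 1, no branch has time 0.
        Hence m + t <= (m+1) t, and the additional m steps cost only a constant factor in the sum of
        times multiplied by lengths.\<close>
      have t1: "1 \<le> t W"
      proof (rule ccontr)
        assume "\<not> 1 \<le> t W"
        then have t0: "t W = 0" by simp
        obtain y where "y \<in> W" using pW(1) by blast
        then have "\<Theta> \<le> \<bar>Df (t W) y\<bar>" using pW(3) unfolding branch_def by blast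
        then show False using \<Theta> t0 by simp
      qed
      have "measure lborel (Q W) \<le> measure lborel W / k"
      proof (cases "Q W = {}")
        case False
        show ?thesis
        proof (rule measure_preimage_le[OF QW[OF W] _ False])
          show "open W" "is_interval W" using pW by (auto simp: branch_def)
          show "(f ^^ j) x \<in> S" if "x \<in> Q W" "j < m" for x j using S that by (auto simp: Q_def)
        qed (use pW J' k Bab in \<open>auto simp: Q_def\<close>)
      qed (use k in simp)
      moreover have "real (m + t W) \<le> (real m + 1) * real (t W)"
        using t1 mult_left_mono[of 1 "real (t W)" "real m"] by (simp add: distrib_right)
      ultimately have "real (m + t W) * measure lborel (Q W) \<le> ((real m + 1) * real (t W)) * (measure lborel W / k)"
        by (intro mult_mono) auto
      then show "real (m + t W) * measure lborel (Q W) \<le> (real m + 1) * (1 / k * (real (t W) * measure lborel W))"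
        by simp
    qed simp
  qed (rule P(1))
qed

end

section \<open>Regularity of the induced map\<close>

lemma variation_le:
  fixes \<phi> H :: "real \<Rightarrow> real"
  assumes zero: "\<And>x. x \<notin> {u<..<v} \<Longrightarrow> \<phi> x = 0"
    and bd: "\<And>x. x \<in> {u<..<v} \<Longrightarrow> \<bar>\<phi> x\<bar> \<le> V \<and> 0 \<le> H x \<and> H x \<le> V"
    and H: "\<And>x y. x \<in> {u<..<v} \<Longrightarrow> y \<in> {u<..<v} \<Longrightarrow> x < y \<Longrightarrow> \<bar>\<phi> y - \<phi> x\<bar> \<le> H y - H x"
    and V: "0 \<le> V"
  shows "variation \<phi> a b \<le> ereal (3 * V)"
proof -
  (* A monotone majorant whose jumps at u and v absorb those of \<phi>, so that the sum telescopes. *)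
  define G where "G x = (if x \<le> u then 0 else if x < v then V + H x else 3 * V)" for x
  have G0: "0 \<le> G x \<and> G x \<le> 3 * V" for x using bd[of x] V by (auto simp: G_def)
  have G: "\<bar>\<phi> y - \<phi> x\<bar> \<le> G y - G x" if "x < y" for x y
  proof -
    have "x \<le> u \<or> x \<in> {u<..<v} \<or> v \<le> x" "y \<le> u \<or> y \<in> {u<..<v} \<or> v \<le> y" by auto
    then show ?thesis
      using zero[of x] zero[of y] bd[of x] bd[of y] H[of x y] that V by (auto simp: G_def)
  qed
  show ?thesis unfolding variation_def
  proof (rule SUP_least)
    fix p :: "real list" assume "p \<in> {p. p \<noteq> [] \<and> hd p = a \<and> last p = b \<and> sorted_wrt (<) p}"
    then have srt: "sorted_wrt (<) p" by simp
    have "(\<Sum>i<length p - 1. \<bar>\<phi> (p ! Suc i) - \<phi> (p ! i)\<bar>) \<le> (\<Sum>i<length p - 1. G (p ! Suc i) - G (p ! i))"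
      by (rule sum_mono, rule G) (use srt in \<open>auto simp: sorted_wrt_iff_nth_less\<close>)
    also have "\<dots> = G (p ! (length p - 1)) - G (p ! 0)" by (rule sum_lessThan_telescope)
    also have "\<dots> \<le> 3 * V" using G0[of "p ! (length p - 1)"] G0[of "p ! 0"] by linarith
    finally show "ereal (\<Sum>i<length p - 1. \<bar>\<phi> (p ! Suc i) - \<phi> (p ! i)\<bar>) \<le> ereal (3 * V)" by simp
  qed
qed

lemma variation_nonneg:
  assumes "a < b" shows "0 \<le> variation \<phi> a b"
  unfolding variation_def by (rule SUP_upper2[of "[a, b]"]) (use assms in auto)

lemma C1_diffeo_ontoI:
  fixes F g :: "real \<Rightarrow> real"
  assumes I: "open I" and F: "\<And>x. x \<in> I \<Longrightarrow> (F has_real_derivative g x) (at x)"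
    and g: "continuous_on I g" "\<And>x. x \<in> I \<Longrightarrow> g x \<noteq> 0" and inj: "inj_on F I"
  shows "C1_diffeo_onto F I"
proof -
  define h where "h = the_inv_into I F"
  have hF: "h (F x) = x" if "x \<in> I" for x using the_inv_into_f_f[OF inj that] by (simp add: h_def)
  have cF: "continuous_on I F" using F by (meson DERIV_isCont continuous_at_imp_continuous_on)
  have dh: "(h has_real_derivative inverse (g x)) (at (F x))" if "x \<in> I" for x
    unfolding has_field_derivative_def
    by (rule has_derivative_inverse_strong[OF I that cF hF F[OF that, unfolded has_field_derivative_def]])
      (use g(2)[OF that] in \<open>auto simp: o_def id_def\<close>)
  define h' where "h' y = inverse (g (h y))" for y
  have dh': "(h has_real_derivative h' y) (at y)" if "y \<in> F ` I" for y
    using that dh hF by (auto simp: h'_def)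
  have ch: "continuous_on (F ` I) h" using dh' by (meson DERIV_isCont continuous_at_imp_continuous_on)
  have "continuous_on (F ` I) (\<lambda>y. g (h y))"
    by (rule continuous_on_compose2[OF g(1) ch]) (use hF in auto)
  then have "continuous_on (F ` I) h'"
    unfolding h'_def by (rule continuous_on_inverse) (use hF g(2) in auto)
  then show ?thesis
    unfolding C1_diffeo_onto_def
    using F g(1) inj hF dh' by (meson has_field_derivative_at_within)
qed

context cusp_map begin

text \<open>Induction on the number \<open>r\<close> of free steps still allowed. After N free
  steps, J itself is a branch. Before that, J is cut according to f^m: the parts that avoid the
  \<delta>-neighbourhoods are free for one more step, and the parts that enter one receive its
  partition by pull-back, where expansion 2/k against a loss of at most k leaves 2.\<close>

lemma far_inducible:
  assumes \<delta>: "0 < \<delta>" and k: "0 < k" "k \<le> 1"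
    and near: "\<And>\<sigma>. \<sigma> \<in> sides a b Cc \<Longrightarrow> inducible (2 / k) (Delta (fst \<sigma>) (snd \<sigma>) \<delta>)"
    and dis: "\<And>\<sigma> \<sigma>'. \<sigma> \<in> sides a b Cc \<Longrightarrow> \<sigma>' \<in> sides a b Cc \<Longrightarrow> \<sigma> \<noteq> \<sigma>' \<Longrightarrow>
      Delta (fst \<sigma>) (snd \<sigma>) \<delta> \<inter> Delta (fst \<sigma>') (snd \<sigma>') \<delta> = {}"
    and enter: "\<And>x m. x \<in> {a..b} \<Longrightarrow> (\<forall>j<m. \<forall>c\<in>Cc. \<delta> < \<bar>(f ^^ j) x - c\<bar>) \<Longrightarrow>
      (\<exists>c\<in>Cc. \<bar>(f ^^ m) x - c\<bar> \<le> \<delta>) \<Longrightarrow> k \<le> \<bar>Df m x\<bar>"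
    and free: "\<And>x. x \<in> {a..b} \<Longrightarrow> (\<forall>j<N. \<forall>c\<in>Cc. \<delta> < \<bar>(f ^^ j) x - c\<bar>) \<Longrightarrow> 2 \<le> \<bar>Df N x\<bar>"
    and mN: "m + r = N" and J: "far \<delta> m J"
  shows "inducible 2 J"
  using mN J
proof (induction r arbitrary: m J)
  case 0
  then have J: "far \<delta> N J" by simp
  from far_lipschitz[OF \<delta>, of N] obtain \<Lambda> where \<Lambda>: "0 \<le> \<Lambda>" and
    "\<forall>J. far \<delta> N J \<longrightarrow> (\<forall>x\<in>J. \<bar>1 / Df N x\<bar> \<le> \<Lambda>) \<and>
      (\<forall>x\<in>J. \<forall>y\<in>J. x < y \<longrightarrow> \<bar>1 / Df N y - 1 / Df N x\<bar> \<le> \<Lambda> * (y - x))"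
    by (elim exE conjE) (rule that)
  with J have *: "\<forall>x\<in>J. \<bar>1 / Df N x\<bar> \<le> \<Lambda>" "\<forall>x\<in>J. \<forall>y\<in>J. x < y \<longrightarrow> \<bar>1 / Df N y - 1 / Df N x\<bar> \<le> \<Lambda> * (y - x)" by auto
  have J': "open J" "is_interval J" "J \<subseteq> {a..b}" using J by (auto simp: far_def)
  have V: "\<Lambda> \<le> \<Lambda> * (1 + (b - a))" using \<Lambda> ab by (simp add: algebra_simps mult_left_mono)
  have "branch 2 J N (\<Lambda> * (1 + (b - a)))" unfolding branch_def
  proof (intro conjI ballI J' impI allI exI[of _ "\<lambda>x. \<Lambda> * (x - a)"])
    fix x assume x: "x \<in> J"
    then have xab: "a \<le> x" "x \<le> b" using J' by auto
    show "(f ^^ j) x \<in> S" if "j < N" for j by (rule far_S[OF \<delta> J x that])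
    show "2 \<le> \<bar>Df N x\<bar>" using free[of x] x J by (auto simp: far_def)
    show "\<bar>1 / Df N x\<bar> \<le> \<Lambda> * (1 + (b - a))" using *(1) x V by fastforce
    show "0 \<le> \<Lambda> * (x - a)" using \<Lambda> xab by simp
    show "\<Lambda> * (x - a) \<le> \<Lambda> * (1 + (b - a))" using \<Lambda> xab by (intro mult_left_mono) auto
    fix y assume "y \<in> J" "x < y"
    then have "\<bar>1 / Df N y - 1 / Df N x\<bar> \<le> \<Lambda> * (y - x)" using * x by blast
    then show "\<bar>1 / Df N y - 1 / Df N x\<bar> \<le> \<Lambda> * (y - a) - \<Lambda> * (x - a)" by (simp add: algebra_simps)
  qed
  then show ?case using inducible_single J' by blast
next
  case (Suc r)
  have J: "open J" "is_interval J" "J \<subseteq> {a..b}" and Jf: "\<And>x j c. x \<in> J \<Longrightarrow> j < m \<Longrightarrow> c \<in> Cc \<Longrightarrow> \<delta> < \<bar>(f ^^ j) x - c\<bar>"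
    using Suc.prems(2) unfolding far_def by blast+
  have S: "(f ^^ j) x \<in> S" if "x \<in> J" "j < m" for x j using far_S[OF \<delta> Suc.prems(2) that] .
  (* A lists the points of Cc to the left of a cell; this avoids enumerating the components. *)
  define W where "W A = {a<..<b} \<inter> (\<Inter>c\<in>A. {c + \<delta><..}) \<inter> (\<Inter>c\<in>Cc - A. {..<c - \<delta>})" for A
  have finA: "finite A" if "A \<in> Pow Cc" for A using that finC by (auto intro: finite_subset)
  have oW: "open (W A)" if "A \<in> Pow Cc" for A
    unfolding W_def using finA[OF that] finC by (intro open_Int open_INT) auto
  have iW: "is_interval (W A)" for A
    unfolding is_interval_convex_1 W_def by (intro convex_Int convex_INT) auto
  have Wfar: "\<delta> < \<bar>y - c\<bar>" if "y \<in> W A" "c \<in> Cc" for y c A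
    using that \<delta> by (cases "c \<in> A") (force simp: W_def)+
  have ind_W: "inducible 2 (J \<inter> (f ^^ m) -` W A)" if "A \<in> Pow Cc" for A
  proof (rule Suc.IH)
    show "Suc m + r = N" using Suc.prems by simp
    show "far \<delta> (Suc m) (J \<inter> (f ^^ m) -` W A)"
      unfolding far_def
    proof (intro conjI ballI allI impI)
      show "open (J \<inter> (f ^^ m) -` W A)" "is_interval (J \<inter> (f ^^ m) -` W A)"
        using iter_preimage[OF J(1,2) S oW[OF that] iW] by auto
      show "J \<inter> (f ^^ m) -` W A \<subseteq> {a..b}" using J by blast
      fix x j c assume "x \<in> J \<inter> (f ^^ m) -` W A" "j < Suc m" "c \<in> Cc"
      then show "\<delta> < \<bar>(f ^^ j) x - c\<bar>" using Jf[of x j c] Wfar[of "(f ^^ m) x" A c] by (cases "j = m") auto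
    qed
  qed
  have ind_D: "inducible 2 (J \<inter> (f ^^ m) -` Delta (fst \<sigma>) (snd \<sigma>) \<delta>)" if \<sigma>: "\<sigma> \<in> sides a b Cc" for \<sigma>
  proof (rule inducible_pull[OF \<delta> Suc.prems(2) near[OF \<sigma>] k(1)])
    fix x assume x: "x \<in> J" "(f ^^ m) x \<in> Delta (fst \<sigma>) (snd \<sigma>) \<delta>"
    show "k \<le> \<bar>Df m x\<bar>"
    proof (rule enter)
      show "x \<in> {a..b}" using x J by blast
      show "\<forall>j<m. \<forall>c\<in>Cc. \<delta> < \<bar>(f ^^ j) x - c\<bar>" using Jf x by blast
      have "fst \<sigma> \<in> Cc" "snd \<sigma> = 1 \<or> snd \<sigma> = -1" using \<sigma> by (auto simp: sides_def)
      then show "\<exists>c\<in>Cc. \<bar>(f ^^ m) x - c\<bar> \<le> \<delta>"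
        using x(2) by (intro bexI[of _ "fst \<sigma>"]) (auto simp: Delta_def split: if_splits)
    qed
  qed (use k in auto)
  note fs = finite_sides
  define U1 where "U1 = (\<Union>A\<in>Pow Cc. J \<inter> (f ^^ m) -` W A)"
  define U2 where "U2 = (\<Union>\<sigma>\<in>sides a b Cc. J \<inter> (f ^^ m) -` Delta (fst \<sigma>) (snd \<sigma>) \<delta>)"
  have WW: "W A \<inter> W A' = {}" if "A \<in> Pow Cc" "A' \<in> Pow Cc" "A \<noteq> A'" for A A'
  proof -
    have *: "W A \<inter> W A' = {}" if "c \<in> A" "c \<notin> A'" "A \<in> Pow Cc" for A A' c
    proof -
      have "W A \<subseteq> {c + \<delta><..}" "W A' \<subseteq> {..<c - \<delta>}" using that by (auto simp: W_def)
      then show ?thesis using \<delta> by force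
    qed
    have "\<exists>c. c \<in> A \<and> c \<notin> A' \<or> c \<in> A' \<and> c \<notin> A" using that(3) by blast
    then show ?thesis using *[of _ A A'] *[of _ A' A] that(1,2) by blast
  qed
  have "inducible 2 U1" unfolding U1_def
  proof (rule inducible_UN)
    show "(J \<inter> (f ^^ m) -` W A) \<inter> (J \<inter> (f ^^ m) -` W A') = {}" if "A \<in> Pow Cc" "A' \<in> Pow Cc" "A \<noteq> A'" for A A'
      using WW[OF that] by blast
  qed (use finC ind_W in auto)
  moreover have "inducible 2 U2" unfolding U2_def
  proof (rule inducible_UN)
    show "(J \<inter> (f ^^ m) -` Delta (fst \<sigma>) (snd \<sigma>) \<delta>) \<inter> (J \<inter> (f ^^ m) -` Delta (fst \<sigma>') (snd \<sigma>') \<delta>) = {}"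
      if "\<sigma> \<in> sides a b Cc" "\<sigma>' \<in> sides a b Cc" "\<sigma> \<noteq> \<sigma>'" for \<sigma> \<sigma>'
      using dis[OF that] by blast
  qed (use fs ind_D in auto)
  moreover have "U1 \<inter> U2 = {}"
  proof -
    have "W A \<inter> Delta c s \<delta> = {}" if "(c, s) \<in> sides a b Cc" for A c s
    proof -
      have "c \<in> Cc" "s = 1 \<or> s = -1" using that by (auto simp: sides_def)
      then show ?thesis using Wfar[of _ A c] by (force simp: Delta_def)
    qed
    then show ?thesis unfolding U1_def U2_def by fastforce
  qed
  ultimately have ind: "inducible 2 (U1 \<union> U2)" by (rule inducible_Un)
  \<comment> \<open>The points left uncovered by the cells lie in this finite set; f^m is injective
    on \<open>J\<close>, so only finitely many points of \<open>J\<close> are lost.\<close>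
  define R where "R = {a, b} \<union> Cc \<union> (\<lambda>c. c + \<delta>) ` Cc \<union> (\<lambda>c. c - \<delta>) ` Cc"
  have "finite R" using finC by (simp add: R_def)
  have cover: "J - (U1 \<union> U2) \<subseteq> (f ^^ m) -` R \<inter> J"
  proof
    fix x assume x: "x \<in> J - (U1 \<union> U2)"
    let ?y = "(f ^^ m) x"
    have yab: "?y \<in> {a..b}" using x J iter_maps by blast
    show "x \<in> (f ^^ m) -` R \<inter> J"
    proof (rule ccontr)
      assume "\<not> ?thesis"
      then have y: "?y \<notin> R" using x by auto
      have yS: "?y \<in> S" using y yab by (auto simp: R_def)
      show False
      proof (cases "?y \<in> Z \<delta>")
        case True
        have "\<delta> < \<bar>?y - c\<bar>" if c: "c \<in> Cc" for c
        proof -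
          have "?y \<noteq> c + \<delta>" "?y \<noteq> c - \<delta>" using y c by (auto simp: R_def)
          moreover have "\<delta> \<le> \<bar>?y - c\<bar>" using True c by (auto simp: Z_def)
          ultimately show ?thesis by linarith
        qed
        moreover have "?y \<noteq> a" "?y \<noteq> b" using y by (auto simp: R_def)
        ultimately have "?y \<in> W {c \<in> Cc. c < ?y}" using yab by (force simp: W_def)
        then show False using x by (auto simp: U1_def)
      next
        case False
        then obtain \<sigma> where "\<sigma> \<in> sides a b Cc" "?y \<in> Delta (fst \<sigma>) (snd \<sigma>) \<delta>"
          using near_or_far[OF yS \<delta>] by force
        then show False using x by (auto simp: U2_def)
      qed
    qed
  qed
  have "finite ((f ^^ m) -` R \<inter> J)" by (rule finite_vimage_IntI[OF \<open>finite R\<close> iter_inj[OF J(2) S]])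
  then have "countable (J - (U1 \<union> U2))" using cover by (meson countable_finite countable_subset)
  moreover have "U1 \<union> U2 \<subseteq> J" by (auto simp: U1_def U2_def)
  ultimately show ?case using inducible_extend[OF ind _ J(3)] by blast
qed

text \<open>The order of choices matters: \<kappa> fixes the expansion 2/k wanted near
  \<open>Cc\<close>, this expansion fixes \<delta>, and (E2) for that \<delta> fixes N. The loss on
  entry is then at most k for the chosen \<delta> because (E1) holds with the same \<kappa> for all
  \<delta>.\<close>

lemma interval_inducible: "inducible 2 {a..b}"
proof -
  have "\<exists>\<kappa>>0. \<forall>\<delta>>0. \<forall>x\<in>{a..b}. \<forall>n\<ge>1.
        (\<forall>j<n. \<forall>c\<in>Cc. \<delta> < \<bar>(f ^^ j) x - c\<bar>) \<and> (\<exists>c\<in>Cc. \<bar>(f ^^ n) x - c\<bar> \<le> \<delta>) \<longrightarrow> \<kappa> \<le> \<bar>Df n x\<bar>"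
    using F unfolding in_class_F_def cond_E1_def by (elim conjE)
  then obtain \<kappa> where \<kappa>: "0 < \<kappa>" and E1: "\<forall>\<delta>>0. \<forall>x\<in>{a..b}. \<forall>n\<ge>1.
        (\<forall>j<n. \<forall>c\<in>Cc. \<delta> < \<bar>(f ^^ j) x - c\<bar>) \<and> (\<exists>c\<in>Cc. \<bar>(f ^^ n) x - c\<bar> \<le> \<delta>) \<longrightarrow> \<kappa> \<le> \<bar>Df n x\<bar>"
    by (elim exE conjE) (rule that)
  \<comment> \<open>The cap at 1 covers entry at time 0, which (E1) excludes and where the
    derivative is 1.\<close>
  define k where "k = min \<kappa> 1"
  have k: "0 < k" "k \<le> 1" "k \<le> \<kappa>" using \<kappa> by (auto simp: k_def)
  have "0 < 2 / k" using k by simp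
  from near_inducible[OF this] obtain \<delta> where \<delta>: "0 < \<delta>"
    and near: "\<forall>(c, s)\<in>sides a b Cc. inducible (2 / k) (Delta c s \<delta>)"
    and dis: "\<forall>\<sigma>\<in>sides a b Cc. \<forall>\<sigma>'\<in>sides a b Cc. \<sigma> \<noteq> \<sigma>' \<longrightarrow> Delta (fst \<sigma>) (snd \<sigma>) \<delta> \<inter> Delta (fst \<sigma>') (snd \<sigma>') \<delta> = {}"
    by (elim exE conjE) (rule that)
  from E2[OF \<delta>] obtain C lam where C: "0 < C" "0 < lam" and E2all: "\<forall>x\<in>{a..b}. \<forall>n. n \<ge> 1 \<longrightarrow>
        (\<forall>j<n. \<forall>c\<in>Cc. \<delta> < \<bar>(f ^^ j) x - c\<bar>) \<longrightarrow> C * exp (lam * real n) \<le> \<bar>Df n x\<bar>"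
    by (elim exE conjE) (rule that)
  obtain N0 where N0: "2 / C / lam < real N0" using reals_Archimedean2 by blast
  define N where "N = max N0 1"
  have N: "1 \<le> N" "2 / C / lam < real N" using N0 by (auto simp: N_def)
  have "2 / C < lam * real N" using N C by (simp add: field_simps)
  also have "\<dots> \<le> exp (lam * real N)" using exp_ge_add_one_self[of "lam * real N"] by linarith
  finally have big: "2 \<le> C * exp (lam * real N)" using C by (simp add: field_simps)
  have "inducible 2 {a<..<b}"
  proof (rule far_inducible[OF \<delta> k(1,2), where m = 0 and N = N and r = N])
    show "inducible (2 / k) (Delta (fst \<sigma>) (snd \<sigma>) \<delta>)" if "\<sigma> \<in> sides a b Cc" for \<sigma>
      using bspec[OF near that] by (simp add: case_prod_unfold)
    show "Delta (fst \<sigma>) (snd \<sigma>) \<delta> \<inter> Delta (fst \<sigma>') (snd \<sigma>') \<delta> = {}"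
      if "\<sigma> \<in> sides a b Cc" "\<sigma>' \<in> sides a b Cc" "\<sigma> \<noteq> \<sigma>'" for \<sigma> \<sigma>'
      using dis that by blast
    show "k \<le> \<bar>Df m x\<bar>" if x: "x \<in> {a..b}" "\<forall>j<m. \<forall>c\<in>Cc. \<delta> < \<bar>(f ^^ j) x - c\<bar>" "\<exists>c\<in>Cc. \<bar>(f ^^ m) x - c\<bar> \<le> \<delta>" for x m
    proof (cases "m = 0")
      case True
      then show ?thesis using k by simp
    next
      case False
      then have "\<kappa> \<le> \<bar>Df m x\<bar>" using E1[rule_format, OF \<delta> x(1), of m] x(2,3) by simp
      then show ?thesis using k by linarith
    qed
    show "2 \<le> \<bar>Df N x\<bar>" if x: "x \<in> {a..b}" "\<forall>j<N. \<forall>c\<in>Cc. \<delta> < \<bar>(f ^^ j) x - c\<bar>" for x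
      using E2all[rule_format, OF x(1) N(1)] x(2) big by (meson order_trans)
    show "far \<delta> 0 {a<..<b}" by (auto simp: far_def is_interval_1)
  qed simp
  then show ?thesis
  proof (rule inducible_extend)
    show "countable ({a..b} - {a<..<b})" by (rule countable_subset[of _ "{a, b}"]) auto
  qed auto
qed

text \<open>Taking the modulus of 1/Df does not increase differences, so the signed majorants still
  apply; together with the jumps at the ends of I they give variation at most 3 V.\<close>

lemma induced_map:
  "\<exists>(P :: real set set) (\<tau> :: real \<Rightarrow> nat).
    countable P \<and>
    (\<forall>I\<in>P. \<exists>u v. u < v \<and> I = {u<..<v} \<and> I \<subseteq> {a..b}) \<and>
    pairwise disjnt P \<and>
    {a..b} - \<Union>P \<in> null_sets lborel \<and>
    (\<forall>I\<in>P. \<forall>x\<in>I. \<forall>y\<in>I. \<tau> x = \<tau> y) \<and>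
    (\<forall>I\<in>P. C1_diffeo_onto (induced f \<tau>) I) \<and>
    (\<exists>lam>1. \<forall>I\<in>P. \<forall>x\<in>I. lam \<le> \<bar>deriv (induced f \<tau>) x\<bar>) \<and>
    (\<forall>I\<in>P. variation (\<lambda>x. indicator I x / \<bar>deriv (induced f \<tau>) x\<bar>) a b < \<infinity>) \<and>
    (\<lambda>I. real_of_ereal (variation (\<lambda>x. indicator I x / \<bar>deriv (induced f \<tau>) x\<bar>) a b))
       summable_on P \<and>
    (\<lambda>I. real (\<tau> (SOME x. x \<in> I)) * measure lborel I) summable_on P"
proof -
  obtain P t V where P: "countable P" "pairwise disjnt P"
     "\<And>I. I \<in> P \<Longrightarrow> I \<noteq> {} \<and> I \<subseteq> {a..b} \<and> branch 2 I (t I) (V I)" "countable ({a..b} - \<Union>P)"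
     "V summable_on P" "(\<lambda>I. real (t I) * measure lborel I) summable_on P"
    using interval_inducible unfolding inducible_def by (elim conjE exE) blast
  \<comment> \<open>Disjointness makes the chosen interval unique; off the partition the value of
    \<tau> is arbitrary.\<close>
  define \<tau> where "\<tau> x = t (THE I. I \<in> P \<and> x \<in> I)" for x
  have \<tau>: "\<tau> x = t I" if "I \<in> P" "x \<in> I" for x I
  proof -
    have "(THE I. I \<in> P \<and> x \<in> I) = I"
      using P(2) that by (intro the_equality) (auto simp: pairwise_def disjnt_def)
    then show ?thesis by (simp add: \<tau>_def)
  qed
  have oi: "open I" "is_interval I" "I \<noteq> {}" "I \<subseteq> {a..b}" if "I \<in> P" for I
    using P(3)[OF that] by (auto simp: branch_def)
  have form: "\<exists>u v. u < v \<and> I = {u<..<v} \<and> I \<subseteq> {a..b}" if "I \<in> P" for I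
    using open_interval_form[OF oi[OF that]] oi(4)[OF that] by blast
  have S: "(f ^^ j) x \<in> S" if "I \<in> P" "x \<in> I" "j < t I" for I x j
    using P(3)[OF that(1)] that(2,3) unfolding branch_def by blast
  have exp: "2 \<le> \<bar>Df (t I) x\<bar>" if "I \<in> P" "x \<in> I" for I x
    using P(3)[OF that(1)] that(2) unfolding branch_def by blast
  have DF: "(induced f \<tau> has_real_derivative Df (t I) x) (at x)" if I: "I \<in> P" and x: "x \<in> I" for I x
  proof -
    have "((f ^^ t I) has_real_derivative Df (t I) x) (at x within I)"
      by (rule iter_deriv) (use S I x in auto)
    then have "((f ^^ t I) has_real_derivative Df (t I) x) (at x)"
      using at_within_open[OF x oi(1)[OF I]] by simp
    then show ?thesis
      by (rule has_field_derivative_transform_within_open[OF _ oi(1)[OF I] x]) (use \<tau>[OF I] in \<open>simp add: induced_def\<close>)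
  qed
  have dF: "deriv (induced f \<tau>) x = Df (t I) x" if "I \<in> P" "x \<in> I" for I x
    by (rule DERIV_imp_deriv[OF DF[OF that]])
  have diffeo: "C1_diffeo_onto (induced f \<tau>) I" if I: "I \<in> P" for I
  proof (rule C1_diffeo_ontoI[OF oi(1)[OF I] DF[OF I]])
    show "continuous_on I (Df (t I))"
      unfolding continuous_on_eq_continuous_within
      using DERIV_continuous[OF Df_deriv[of I "t I"]] S[OF I] by blast
    show "Df (t I) x \<noteq> 0" if "x \<in> I" for x using exp[OF I that] by auto
    have "inj_on (f ^^ t I) I" by (rule iter_inj[OF oi(2)[OF I] S[OF I]])
    then show "inj_on (induced f \<tau>) I"
      by (rule inj_on_cong[THEN iffD1, rotated]) (use \<tau>[OF I] in \<open>simp add: induced_def\<close>)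
  qed
  have V0: "0 \<le> V I" if I: "I \<in> P" for I
  proof -
    obtain x where "x \<in> I" using oi(3)[OF I] by blast
    then have "\<bar>1 / Df (t I) x\<bar> \<le> V I" using P(3)[OF I] unfolding branch_def by blast
    then show ?thesis by linarith
  qed
  let ?w = "\<lambda>I x. indicator I x / \<bar>deriv (induced f \<tau>) x\<bar>"
  have var: "variation (?w I) a b \<le> ereal (3 * V I)" if I: "I \<in> P" for I
  proof -
    obtain u v where uv: "I = {u<..<v}" using form[OF I] by blast
    obtain H where H: "\<And>x. x \<in> I \<Longrightarrow> 0 \<le> H x \<and> H x \<le> V I"
      "\<And>x y. x \<in> I \<Longrightarrow> y \<in> I \<Longrightarrow> x < y \<Longrightarrow> \<bar>1 / Df (t I) y - 1 / Df (t I) x\<bar> \<le> H y - H x"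
      using P(3)[OF I] unfolding branch_def by blast
    have w: "?w I x = \<bar>1 / Df (t I) x\<bar>" if "x \<in> I" for x using dF[OF I that] that by simp
    have wV: "\<bar>?w I x\<bar> \<le> V I" if "x \<in> I" for x
    proof -
      have "\<bar>1 / Df (t I) x\<bar> \<le> V I" using P(3)[OF I] that unfolding branch_def by blast
      then show ?thesis unfolding w[OF that] by simp
    qed
    show ?thesis
    proof (rule variation_le)
      show "?w I x = 0" if "x \<notin> {u<..<v}" for x using that uv by simp
      show "\<bar>?w I x\<bar> \<le> V I \<and> 0 \<le> H x \<and> H x \<le> V I" if "x \<in> {u<..<v}" for x
        using wV H(1) that uv by blast
      show "\<bar>?w I y - ?w I x\<bar> \<le> H y - H x" if "x \<in> {u<..<v}" "y \<in> {u<..<v}" "x < y" for x y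
      proof -
        have xy: "x \<in> I" "y \<in> I" using that uv by auto
        have "\<bar>?w I y - ?w I x\<bar> \<le> \<bar>1 / Df (t I) y - 1 / Df (t I) x\<bar>"
          unfolding w[OF xy(1)] w[OF xy(2)] by (rule abs_triangle_ineq3)
        then show ?thesis using H(2)[OF xy that(3)] by linarith
      qed
    qed (rule V0[OF I])
  qed
  have "{a..b} - \<Union>P \<in> null_sets lborel" using P(4) by (rule countable_imp_null_set_lborel)
  moreover have "\<forall>I\<in>P. variation (?w I) a b < \<infinity>"
    by (rule ballI, rule le_less_trans, erule var) simp
  moreover have "(\<lambda>I. real_of_ereal (variation (?w I) a b)) summable_on P"
  proof (rule summable_on_comparison_test)
    show "(\<lambda>I. 3 * V I) summable_on P" using P(5) by (rule summable_on_cmult_right)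
    fix I assume I: "I \<in> P"
    show "real_of_ereal (variation (?w I) a b) \<le> 3 * V I"
      using var[OF I] variation_nonneg[OF ab, of "?w I"] by (cases "variation (?w I) a b") auto
    show "0 \<le> real_of_ereal (variation (?w I) a b)"
      using variation_nonneg[OF ab, of "?w I"] by (rule real_of_ereal_pos)
  qed
  moreover have "(\<lambda>I. real (\<tau> (SOME x. x \<in> I)) * measure lborel I) summable_on P"
  proof (rule summable_on_cong[THEN iffD1, OF _ P(6)])
    fix I assume I: "I \<in> P"
    have "(SOME x. x \<in> I) \<in> I" using oi(3)[OF I] by (simp add: some_in_eq)
    then show "real (t I) * measure lborel I = real (\<tau> (SOME x. x \<in> I)) * measure lborel I" using \<tau>[OF I] by simp
  qed
  moreover have "\<exists>lam>1. \<forall>I\<in>P. \<forall>x\<in>I. lam \<le> \<bar>deriv (induced f \<tau>) x\<bar>"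
    using exp dF by (intro exI[of _ 2]) auto
  moreover have "\<forall>I\<in>P. \<forall>x\<in>I. \<forall>y\<in>I. \<tau> x = \<tau> y" using \<tau> by auto
  moreover have "\<forall>I\<in>P. \<exists>u v. u < v \<and> I = {u<..<v} \<and> I \<subseteq> {a..b}" by (rule ballI, rule form)
  moreover have "\<forall>I\<in>P. C1_diffeo_onto (induced f \<tau>) I" by (rule ballI, rule diffeo)
  ultimately show ?thesis using P(1,2) by (intro exI[of _ P] exI[of _ \<tau>] conjI)
qed

end

theorem theorem1:
  fixes a b :: real and f :: "real \<Rightarrow> real" and Cc :: "real set"
  assumes "in_class_F a b f Cc"
  shows "\<exists>(P :: real set set) (\<tau> :: real \<Rightarrow> nat).
    countable P \<and>
    (\<forall>I\<in>P. \<exists>u v. u < v \<and> I = {u<..<v} \<and> I \<subseteq> {a..b}) \<and>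
    pairwise disjnt P \<and>
    {a..b} - \<Union>P \<in> null_sets lborel \<and>
    (\<forall>I\<in>P. \<forall>x\<in>I. \<forall>y\<in>I. \<tau> x = \<tau> y) \<and>
    (\<forall>I\<in>P. C1_diffeo_onto (induced f \<tau>) I) \<and>
    (\<exists>lam>1. \<forall>I\<in>P. \<forall>x\<in>I. lam \<le> \<bar>deriv (induced f \<tau>) x\<bar>) \<and>
    (\<forall>I\<in>P. variation (\<lambda>x. indicator I x / \<bar>deriv (induced f \<tau>) x\<bar>) a b < \<infinity>) \<and>
    (\<lambda>I. real_of_ereal (variation (\<lambda>x. indicator I x / \<bar>deriv (induced f \<tau>) x\<bar>) a b))
       summable_on P \<and>
    (\<lambda>I. real (\<tau> (SOME x. x \<in> I)) * measure lborel I) summable_on P"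
  by (rule cusp_map.induced_map[OF cusp_map.intro[OF assms]])

end
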